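(* Let $\mathfrak s=\mathfrak{sl}(n)$, $n\ge2$, and let $V\cong\mathbb C^{n|n}$ be the $\mathfrak g$-module described in the context. For $r\ge0$ let $\phi_r:\mathbb C S_r\to\mathrm{End}_{\mathfrak g}(V^{\otimes r})$ be the algebra morphism given by the signed permutation action of $S_r$ on the tensor factors. Then: (1) For $r<n$, and for $r=n\ge3$, $\phi_r$ is an isomorphism $\mathbb C S_r\xrightarrow{\sim}\mathrm{End}_{\mathfrak g}(V^{\otimes r})$. For $r=n=2$, $\phi_r$ is not surjective. (2) For $r>2n-2$, $\phi_r$ is not surjective. (3) For $r>1$, the natural morphism $U(\mathfrak g)\to\mathrm{End}_{\mathbb C S_r}(V^{\otimes r})$ is not surjective.
   Context: Let $\wedge(\xi)$ be the Grassmann superalgebra on one odd generator $\xi$, $\partial_\xi$ the odd derivation with $\partial_\xi(\xi)=1$, $\mathfrak d=\mathbb C\partial_\xi\oplus\mathbb C\xi\partial_\xi$, and $\mathfrak g=(\mathfrak{sl}(n)\otimes\wedge(\xi))\rtimes\mathfrak d$. Via the (faithful) representation on the simple $\mathfrak g$-module $V=L(\omega_1)\cong\mathbb C^{n|n}$ of highest weight the first fundamental weight $\omega_1$ of $\mathfrak{sl}(n)$, $\mathfrak g$ is identified with the subalgebra of $\mathfrak{gl}(n|n)$ consisting of the block matrices $\begin{pmatrix}A&bI_n\\ C&A+dI_n\end{pmatrix}$ with $A,C\in\mathbb C^{n\times n}$, $\mathrm{tr}A=0=\mathrm{tr}C$, $b,d\in\mathbb C$ ($I_n$ the identity matrix;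 the diagonal blocks are even, the off-diagonal blocks odd), and $V$ is the natural module $\mathbb C^{n|n}$. The symmetric group $S_r$ acts on $V^{\otimes r}$ by permuting tensor factors with the usual super sign rule (a transposition of adjacent homogeneous factors $v\otimes w$ gives $(-1)^{|v||w|}w\otimes v$); this action commutes with $\mathfrak g$. *)

theory Defs
  imports Complex_Main "HOL-Combinatorics.Permutations"
begin

text \<open>Concrete model. V = C^{n|n} has basis e_0..e_{2n-1}; e_i is even iff i < n.
  V^{\<otimes>r} has basis e_w indexed by words w (lists of length r with entries < 2n).
  Linear endomorphisms of V^{\<otimes>r} are represented by their matrices
  M a b = coefficient of e_a in M e_b, required to vanish outside words x words.\<close>

type_synonym mat = "nat list \<Rightarrow> nat list \<Rightarrow> complex"

definition words :: "nat \<Rightarrow> nat \<Rightarrow> nat list set" where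
  "words n r = {w. length w = r \<and> set w \<subseteq> {..<2*n}}"

definition par :: "nat \<Rightarrow> nat \<Rightarrow> nat" where
  "par n i = (if i < n then 0 else 1)"

definition wpar :: "nat \<Rightarrow> nat list \<Rightarrow> nat" where
  "wpar n w = (\<Sum>x\<leftarrow>w. par n x) mod 2"

definition supported :: "nat \<Rightarrow> nat \<Rightarrow> mat \<Rightarrow> bool" where
  "supported n r M \<longleftrightarrow> (\<forall>a b. (a \<notin> words n r \<or> b \<notin> words n r) \<longrightarrow> M a b = 0)"

definition mmul :: "nat \<Rightarrow> nat \<Rightarrow> mat \<Rightarrow> mat \<Rightarrow> mat" where
  "mmul n r M N = (\<lambda>a b. \<Sum>u\<in>words n r. M a u * N u b)"

definition ident :: "nat \<Rightarrow> nat \<Rightarrow> mat" where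
  "ident n r = (\<lambda>a b. if a \<in> words n r \<and> a = b then 1 else 0)"

definition tr :: "nat \<Rightarrow> (nat \<Rightarrow> nat \<Rightarrow> complex) \<Rightarrow> complex" where
  "tr n A = (\<Sum>i<n. A i i)"

definition gmat :: "nat \<Rightarrow> (nat \<Rightarrow> nat \<Rightarrow> complex) \<Rightarrow> (nat \<Rightarrow> nat \<Rightarrow> complex)
    \<Rightarrow> complex \<Rightarrow> complex \<Rightarrow> nat \<Rightarrow> nat \<Rightarrow> complex" where
  "gmat n A C b d i j =
     (if i < n \<and> j < n then A i j
      else if i < n \<and> n \<le> j \<and> j < 2*n then (if j = i + n then b else 0)
      else if n \<le> i \<and> i < 2*n \<and> j < n then C (i - n) j
      else if n \<le> i \<and> i < 2*n \<and> n \<le> j \<and> j < 2*n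
        then A (i - n) (j - n) + (if i = j then d else 0)
      else 0)"

definition zmat :: "nat \<Rightarrow> nat \<Rightarrow> complex" where
  "zmat = (\<lambda>_ _. 0)"

text \<open>Action on V^{\<otimes>r} of a homogeneous element X of parity q (super Leibniz rule).\<close>
definition rho :: "nat \<Rightarrow> nat \<Rightarrow> nat \<Rightarrow> (nat \<Rightarrow> nat \<Rightarrow> complex) \<Rightarrow> mat" where
  "rho n r q X = (\<lambda>a b. if a \<in> words n r \<and> b \<in> words n r then
      (\<Sum>k<r. if (\<forall>l<r. l \<noteq> k \<longrightarrow> a ! l = b ! l)
              then (-1) ^ (q * (\<Sum>l<k. par n (b ! l))) * X (a ! k) (b ! k) else 0)
     else 0)"

definition rhoG :: "nat \<Rightarrow> nat \<Rightarrow> (nat \<Rightarrow> nat \<Rightarrow> complex) \<Rightarrow> (nat \<Rightarrow> nat \<Rightarrow> complex)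
    \<Rightarrow> complex \<Rightarrow> complex \<Rightarrow> mat" where
  "rhoG n r A C b d = (\<lambda>x y. rho n r 0 (gmat n A zmat 0 d) x y + rho n r 1 (gmat n zmat C b 0) x y)"

definition permact :: "nat \<Rightarrow> nat \<Rightarrow> (nat \<Rightarrow> nat) \<Rightarrow> mat" where
  "permact n r \<sigma> = (\<lambda>a b. if a \<in> words n r \<and> b \<in> words n r \<and> (\<forall>i<r. a ! (\<sigma> i) = b ! i)
      then (-1) ^ card {(i, j). i < j \<and> j < r \<and> \<sigma> j < \<sigma> i \<and> par n (b ! i) = 1 \<and> par n (b ! j) = 1}
      else 0)"

definition CS :: "nat \<Rightarrow> ((nat \<Rightarrow> nat) \<Rightarrow> complex) set" where
  "CS r = {c. \<forall>\<sigma>. \<not> \<sigma> permutes {..<r} \<longrightarrow> c \<sigma> = 0}"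

definition phi :: "nat \<Rightarrow> nat \<Rightarrow> ((nat \<Rightarrow> nat) \<Rightarrow> complex) \<Rightarrow> mat" where
  "phi n r c = (\<lambda>a b. \<Sum>\<sigma>\<in>{\<sigma>. \<sigma> permutes {..<r}}. c \<sigma> * permact n r \<sigma> a b)"

definition homg :: "nat \<Rightarrow> nat \<Rightarrow> nat \<Rightarrow> mat \<Rightarrow> bool" where
  "homg n r p f \<longleftrightarrow> supported n r f
     \<and> (\<forall>a b. f a b \<noteq> 0 \<longrightarrow> wpar n a = (wpar n b + p) mod 2)
     \<and> (\<forall>A d. tr n A = 0 \<longrightarrow>
          mmul n r f (rho n r 0 (gmat n A zmat 0 d)) = mmul n r (rho n r 0 (gmat n A zmat 0 d)) f)
     \<and> (\<forall>C b. tr n C = 0 \<longrightarrow>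
          mmul n r f (rho n r 1 (gmat n zmat C b 0))
          = (\<lambda>x y. (-1) ^ p * mmul n r (rho n r 1 (gmat n zmat C b 0)) f x y))"

definition Endg :: "nat \<Rightarrow> nat \<Rightarrow> mat set" where
  "Endg n r = {(\<lambda>x y. f0 x y + f1 x y) | f0 f1. homg n r 0 f0 \<and> homg n r 1 f1}"

definition EndS :: "nat \<Rightarrow> nat \<Rightarrow> mat set" where
  "EndS n r = {f. supported n r f \<and>
     (\<forall>\<sigma>. \<sigma> permutes {..<r} \<longrightarrow> mmul n r f (permact n r \<sigma>) = mmul n r (permact n r \<sigma>) f)}"

text \<open>Image of U(g): linear span of all finite products of actions of elements of g
  (the empty product being the identity).\<close>
definition gact :: "nat \<Rightarrow> nat \<Rightarrow> mat set" where
  "gact n r = {rhoG n r A C b d | A C b d. tr n A = 0 \<and> tr n C = 0}"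

definition gmonos :: "nat \<Rightarrow> nat \<Rightarrow> mat set" where
  "gmonos n r = {foldr (mmul n r) xs (ident n r) | xs. set xs \<subseteq> gact n r}"

definition UImg :: "nat \<Rightarrow> nat \<Rightarrow> mat set" where
  "UImg n r = {M. \<exists>(k::nat) c P. (\<forall>i<k. P i \<in> gmonos n r) \<and>
                    M = (\<lambda>x y. \<Sum>i<k. (c i :: complex) * P i x y)}"

end

theory Submission
  imports Defs "HOL-Library.Function_Algebras"
begin

text \<open>
  (1) Every endomorphism preserves the degree (number of odd letters) and the weight, so for r at most
  n the image of the word [0..<r] is a combination of permuted words. After subtracting the
  corresponding element of the group algebra one is left with an endomorphism killing this word.
  For r < n the word generates everything; for r = n it generates everything except one class in
  degree one, on which the endomorphism must vanish as soon as n is at least 3.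

  (2) If h is an odd operator of degree one that supercommutes with sl(n) and its odd copy, then its
  anticommutator with the odd derivation is an endomorphism over the whole superalgebra. Such an h
  exists on 2n - 1 tensor factors: symmetrisation composed with parity reversal of the part of
  degree n - 1. The resulting endomorphism changes the multiset of letters of a word, which no
  permutation does.

  (3) The top degree part of the tensor power generates a proper submodule that is not stable under
  gl(n|n), although gl(n|n) commutes with the permutations.
\<close>

section \<open>Operators on words\<close>

text \<open>In \<open>g\<close> the block \<open>C\<close> is traceless and the upper right block is
  the scalar \<open>b\<close>; both restrictions shape the proof. Since \<open>C = I_n\<close> is
  excluded, the diagonal odd elements turn a word that uses all of C^n only into differences of
  words with one odd letter. If another letter is already odd, the second term of the difference
  vanishes, so higher degrees cause no trouble. Degree one is settled from the row side, with a
  matrix unit whose two indices both avoid the odd letter. This takes three indices, and for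
  \<open>n = r = 2\<close> an extra endomorphism lives in the gap. The number
  \<open>2n - 1 = (n - 1) + n\<close> makes parity reversal send degree \<open>n - 1\<close> to
  degree \<open>n\<close>, but degree \<open>n - 2\<close> to \<open>n + 1\<close>, beyond the top
  exterior power of C^n. It is also odd, so the reversal behaves as an odd operator towards the
  remaining factors. Bracketing with the derivation works by the super Jacobi identity, as the
  derivation sends the odd copy of sl(n) to sl(n). Since \<open>b\<close> is scalar, the derivation
  lowers all odd letters of a word together, with fixed signs; a general upper right block in
  gl(n|n) can lower one of them alone.\<close>

lemma words_iff: "w \<in> words n r \<longleftrightarrow> length w = r \<and> (\<forall>i<r. w ! i < 2 * n)"
  by (auto simp: words_def set_conv_nth)

lemma finite_words [simp]: "finite (words n r)"
proof -
  have "words n r = {w. set w \<subseteq> {..<2*n} \<and> length w = r}"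
    by (auto simp: words_def)
  then show ?thesis by (simp add: finite_lists_length_eq)
qed

lemma words_update [simp]: "w \<in> words n r \<Longrightarrow> x < 2 * n \<Longrightarrow> w[k := x] \<in> words n r"
  by (cases "k < r") (auto simp: words_iff nth_list_update)

lemma par_le_1: "par n x \<le> 1"
  by (simp add: par_def)

abbreviation odds :: "nat \<Rightarrow> nat list \<Rightarrow> nat \<Rightarrow> nat" where
  "odds n w k \<equiv> (\<Sum>l<k. par n (w ! l))"

lemma wpar_odds: "w \<in> words n r \<Longrightarrow> wpar n w = odds n w r mod 2"
  by (auto simp: wpar_def words_iff sum_list_sum_nth atLeast0LessThan)

lemma odds_update_le [simp]: "k \<le> j \<Longrightarrow> odds n (w[j := x]) k = odds n w k"
  by (intro sum.cong) auto

lemma odds_update: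
  assumes "j < k" "j < length w"
  shows "odds n (w[j := x]) k + par n (w ! j) = odds n w k + par n x"
proof -
  have "odds n (w[j := x]) k = par n x + (\<Sum>l\<in>{..<k} - {j}. par n (w ! l))"
    using assms by (subst sum.remove[of _ j]) (auto intro!: sum.cong)
  moreover have "odds n w k = par n (w ! j) + (\<Sum>l\<in>{..<k} - {j}. par n (w ! l))"
    using assms by (subst sum.remove[of _ j]) auto
  ultimately show ?thesis by simp
qed

section \<open>Ring operations on matrices indexed by words\<close>

lemma mmul_assoc: "mmul n r (mmul n r A B) C = mmul n r A (mmul n r B C)"
  unfolding mmul_def
  by (intro ext)
    (simp add: sum_distrib_left sum_distrib_right mult.assoc, subst sum.swap, rule refl)

lemma mmul_add_left: "mmul n r (A + B) C = mmul n r A C + mmul n r B C"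
  by (intro ext) (simp add: mmul_def distrib_right sum.distrib)

lemma mmul_add_right: "mmul n r A (B + C) = mmul n r A B + mmul n r A C"
  by (intro ext) (simp add: mmul_def distrib_left sum.distrib)

lemma mmul_minus_left: "mmul n r (- A) C = - mmul n r A C"
  by (intro ext) (simp add: mmul_def sum_negf)

lemma mmul_minus_right: "mmul n r A (- C) = - mmul n r A C"
  by (intro ext) (simp add: mmul_def sum_negf)

lemma mmul_diff_left: "mmul n r (A - B) C = mmul n r A C - mmul n r B C"
  by (intro ext) (simp add: mmul_def left_diff_distrib sum_subtractf)

lemma mmul_diff_right: "mmul n r A (B - C) = mmul n r A B - mmul n r A C"
  by (intro ext) (simp add: mmul_def right_diff_distrib sum_subtractf)

lemma mmul_zero_left [simp]: "mmul n r 0 C = 0"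
  by (intro ext) (simp add: mmul_def)

lemma mmul_zero_right [simp]: "mmul n r C 0 = 0"
  by (intro ext) (simp add: mmul_def)

text \<open>The super Leibniz action with a matrix that may depend on the tensor position. This allows
  one to act on a block of tensor factors only.\<close>
definition prho :: "nat \<Rightarrow> nat \<Rightarrow> nat \<Rightarrow> (nat \<Rightarrow> nat \<Rightarrow> nat \<Rightarrow> complex) \<Rightarrow> mat" where
  "prho n r q Y = (\<lambda>a b. if a \<in> words n r \<and> b \<in> words n r then
      (\<Sum>k<r. if (\<forall>l<r. l \<noteq> k \<longrightarrow> a ! l = b ! l)
              then (-1) ^ (q * odds n b k) * Y k (a ! k) (b ! k) else 0)
     else 0)"

lemma rho_prho: "rho n r q X = prho n r q (\<lambda>_. X)"
  by (simp add: rho_def prho_def)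

lemma supported_prho: "supported n r (prho n r q Y)"
  by (auto simp: supported_def prho_def)

lemma sum_words_single_update:
  assumes "b \<in> words n r" "k < r"
  shows "(\<Sum>u\<in>words n r. if (\<forall>l<r. l \<noteq> k \<longrightarrow> u ! l = b ! l) then g u else (0::complex))
       = (\<Sum>x<2*n. g (b[k := x]))"
proof -
  have "(\<Sum>u\<in>words n r. if (\<forall>l<r. l \<noteq> k \<longrightarrow> u ! l = b ! l) then g u else 0)
      = (\<Sum>u\<in>{u \<in> words n r. \<forall>l<r. l \<noteq> k \<longrightarrow> u ! l = b ! l}. g u)"
    by (rule sum.inter_filter[symmetric]) simp
  also have "\<dots> = (\<Sum>x<2*n. g (b[k := x]))"
  proof (rule sum.reindex_bij_witness[where i = "\<lambda>x. b[k := x]" and j = "\<lambda>u. u ! k"])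
    fix u assume u: "u \<in> {u \<in> words n r. \<forall>l<r. l \<noteq> k \<longrightarrow> u ! l = b ! l}"
    show eq: "b[k := u ! k] = u"
      using u assms by (intro nth_equalityI) (auto simp: words_iff nth_list_update)
    show "u ! k \<in> {..<2*n}"
      using u assms by (auto simp: words_iff)
    show "g (b[k := u ! k]) = g u" by (simp add: eq)
  qed (use assms in \<open>auto simp: words_iff nth_list_update\<close>)
  finally show ?thesis .
qed

text \<open>This formula and its left counterpart carry nearly all later computations: the sum over
  words becomes a sum over a position and a replacement letter.\<close>

lemma mmul_prho_right:
  assumes b: "b \<in> words n r"
  shows "mmul n r M (prho n r q Y) a b
    = (\<Sum>k<r. \<Sum>x<2*n. (-1) ^ (q * odds n b k) * Y k x (b ! k) * M a (b[k := x]))"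
proof -
  have "mmul n r M (prho n r q Y) a b = (\<Sum>u\<in>words n r. \<Sum>k<r.
      if (\<forall>l<r. l \<noteq> k \<longrightarrow> u ! l = b ! l)
      then (-1) ^ (q * odds n b k) * Y k (u ! k) (b ! k) * M a u else 0)"
    unfolding mmul_def prho_def using b
    by (intro sum.cong refl) (auto simp: sum_distrib_left intro!: sum.cong)
  also have "\<dots> = (\<Sum>k<r. \<Sum>u\<in>words n r. if (\<forall>l<r. l \<noteq> k \<longrightarrow> u ! l = b ! l)
      then (-1) ^ (q * odds n b k) * Y k (u ! k) (b ! k) * M a u else 0)"
    by (rule sum.swap)
  also have "\<dots> = (\<Sum>k<r. \<Sum>x<2*n. (-1) ^ (q * odds n b k) * Y k (b[k := x] ! k) (b ! k)
      * M a (b[k := x]))"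
    using b by (intro sum.cong refl sum_words_single_update) auto
  also have "\<dots> = (\<Sum>k<r. \<Sum>x<2*n. (-1) ^ (q * odds n b k) * Y k x (b ! k) * M a (b[k := x]))"
    using b by (intro sum.cong refl) (auto simp: words_iff)
  finally show ?thesis .
qed

lemma mmul_prho_left:
  assumes a: "a \<in> words n r"
  shows "mmul n r (prho n r q Y) M a b
    = (\<Sum>k<r. \<Sum>x<2*n. (-1) ^ (q * odds n a k) * Y k (a ! k) x * M (a[k := x]) b)"
proof -
  \<comment> \<open>The Leibniz sign depends only on positions left of \<open>k\<close>, where
    \<open>a\<close> and \<open>u\<close> agree, so it may be read off the row word.\<close>
  have sign: "(if \<forall>l<r. l \<noteq> k \<longrightarrow> a ! l = u ! l
        then (-1) ^ (q * odds n u k) * Y k (a ! k) (u ! k) else 0) * M u b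
      = (if \<forall>l<r. l \<noteq> k \<longrightarrow> u ! l = a ! l
        then (-1) ^ (q * odds n a k) * Y k (a ! k) (u ! k) * M u b else 0)" if "k < r" for u k
  proof (cases "\<forall>l<r. l \<noteq> k \<longrightarrow> a ! l = u ! l")
    case True
    then have "odds n u k = odds n a k" using that by (intro sum.cong) auto
    then show ?thesis using True by simp
  next
    case False
    then have "\<not> (\<forall>l<r. l \<noteq> k \<longrightarrow> u ! l = a ! l)" by metis
    then show ?thesis using False by (simp only: if_False mult_zero_left)
  qed
  have "mmul n r (prho n r q Y) M a b = (\<Sum>u\<in>words n r. \<Sum>k<r.
      if (\<forall>l<r. l \<noteq> k \<longrightarrow> u ! l = a ! l)
      then (-1) ^ (q * odds n a k) * Y k (a ! k) (u ! k) * M u b else 0)"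
    unfolding mmul_def
  proof (intro sum.cong refl)
    fix u assume "u \<in> words n r"
    then show "prho n r q Y a u * M u b = (\<Sum>k<r. if (\<forall>l<r. l \<noteq> k \<longrightarrow> u ! l = a ! l)
      then (-1) ^ (q * odds n a k) * Y k (a ! k) (u ! k) * M u b else 0)"
      using a by (simp only: prho_def simp_thms if_True sum_distrib_right)
        (intro sum.cong refl, simp only: sign lessThan_iff)
  qed
  also have "\<dots> = (\<Sum>k<r. \<Sum>u\<in>words n r. if (\<forall>l<r. l \<noteq> k \<longrightarrow> u ! l = a ! l)
      then (-1) ^ (q * odds n a k) * Y k (a ! k) (u ! k) * M u b else 0)"
    by (rule sum.swap)
  also have "\<dots> = (\<Sum>k<r. \<Sum>x<2*n. (-1) ^ (q * odds n a k) * Y k (a ! k) (a[k := x] ! k)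
      * M (a[k := x]) b)"
    using a by (intro sum.cong refl sum_words_single_update) auto
  also have "\<dots> = (\<Sum>k<r. \<Sum>x<2*n. (-1) ^ (q * odds n a k) * Y k (a ! k) x * M (a[k := x]) b)"
    using a by (intro sum.cong refl) (auto simp: words_iff)
  finally show ?thesis .
qed

lemma supported_mmul: "supported n r A \<Longrightarrow> supported n r B \<Longrightarrow> supported n r (mmul n r A B)"
  by (auto simp: supported_def mmul_def)

lemma supported_eqI:
  assumes "supported n r A" "supported n r B"
    and "\<And>a b. a \<in> words n r \<Longrightarrow> b \<in> words n r \<Longrightarrow> A a b = B a b"
  shows "A = B"
  using assms by (intro ext) (metis supported_def)

section \<open>Homogeneous families and the signs of permutations\<close>

definition homog :: "nat \<Rightarrow> nat \<Rightarrow> (nat \<Rightarrow> nat \<Rightarrow> nat \<Rightarrow> complex) \<Rightarrow> bool" where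
  "homog n q Y \<longleftrightarrow> q < 2 \<and> (\<forall>k x y. Y k x y \<noteq> 0 \<longrightarrow> par n x = (par n y + q) mod 2)"

lemma homog_0: "homog n 0 Y \<longleftrightarrow> (\<forall>k x y. Y k x y \<noteq> 0 \<longrightarrow> par n x = par n y)"
  by (auto simp: homog_def par_def)

lemma homog_1: "homog n 1 Y \<longleftrightarrow> (\<forall>k x y. Y k x y \<noteq> 0 \<longrightarrow> par n x = 1 - par n y)"
  by (auto simp: homog_def par_def)

lemma homog_gmat_0: "homog n 0 (\<lambda>_. gmat n A zmat 0 d)"
  by (auto simp: homog_0 gmat_def zmat_def par_def)

lemma homog_gmat_1: "homog n 1 (\<lambda>_. gmat n zmat C b 0)"
  unfolding homog_1 by (auto simp: gmat_def zmat_def par_def)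

text \<open>The sign by which \<sigma> acts on a word whose odd letters sit at the positions in S.\<close>
definition eps :: "(nat \<Rightarrow> nat) \<Rightarrow> nat set \<Rightarrow> complex" where
  "eps \<sigma> S = (\<Prod>(i,j)\<in>{(i,j). i \<in> S \<and> j \<in> S \<and> i < j}. if \<sigma> j < \<sigma> i then -1 else 1)"

definition oddpos :: "nat \<Rightarrow> nat \<Rightarrow> nat list \<Rightarrow> nat set" where
  "oddpos n r w = {i. i < r \<and> par n (w ! i) = 1}"

lemma finite_oddpos [simp]: "finite (oddpos n r w)"
  by (simp add: oddpos_def)

lemma finite_pairs: "finite S \<Longrightarrow> finite {(i,j). i \<in> S \<and> j \<in> S \<and> i < (j::nat)}"
  by (rule finite_subset[of _ "S \<times> S"]) auto

lemma prod_sign_card: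
  "finite S \<Longrightarrow> (\<Prod>x\<in>S. if P x then -1 else (1::complex)) = (-1) ^ card {x\<in>S. P x}"
  by (simp add: prod.If_cases Collect_conj_eq)

text \<open>Separates the sign from the letters: it depends on the word only through its set of odd
  positions, which an odd operator changes by a single element.\<close>

lemma permact_eps:
  "permact n r \<sigma> a b = (if a \<in> words n r \<and> b \<in> words n r \<and> (\<forall>i<r. a ! (\<sigma> i) = b ! i)
      then eps \<sigma> (oddpos n r b) else 0)"
proof -
  have "eps \<sigma> (oddpos n r b)
      = (\<Prod>p\<in>{(i,j). i \<in> oddpos n r b \<and> j \<in> oddpos n r b \<and> i < j}.
           if \<sigma> (snd p) < \<sigma> (fst p) then -1 else 1)"
    by (auto simp: eps_def intro!: prod.cong)
  also have "\<dots> = (-1) ^ card {p \<in> {(i,j). i \<in> oddpos n r b \<and> j \<in> oddpos n r b \<and> i < j}.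
      \<sigma> (snd p) < \<sigma> (fst p)}"
    by (rule prod_sign_card) (simp add: finite_pairs)
  also have "{p \<in> {(i,j). i \<in> oddpos n r b \<and> j \<in> oddpos n r b \<and> i < j}. \<sigma> (snd p) < \<sigma> (fst p)}
      = {(i, j). i < j \<and> j < r \<and> \<sigma> j < \<sigma> i \<and> par n (b ! i) = 1 \<and> par n (b ! j) = 1}"
    by (auto simp: oddpos_def)
  finally show ?thesis by (simp add: permact_def)
qed

text \<open>A pair formed by \<open>k\<close> and some \<open>l\<close> contributes
  \<open>-1\<close> exactly when \<sigma> reverses it, that is, when one of \<open>l < k\<close> and
  \<open>\<sigma> l < \<sigma> k\<close> holds and the other fails. The two powers are the Leibniz
  signs of an odd operator at \<open>k\<close> before and at \<open>\<sigma> k\<close> after the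
  permutation.\<close>

lemma eps_insert:
  assumes "finite S" "k \<notin> S" "inj \<sigma>"
  shows "eps \<sigma> (insert k S)
    = eps \<sigma> S * (-1) ^ card {l\<in>S. l < k} * (-1) ^ card {l\<in>S. \<sigma> l < \<sigma> k}"
proof -
  let ?g = "\<lambda>(i,j). if \<sigma> j < \<sigma> i then -1 else (1::complex)"
  let ?s = "\<lambda>l. if l < k then (l, k) else (k, l)"
  have split: "{(i,j). i \<in> insert k S \<and> j \<in> insert k S \<and> i < j}
      = {(i,j). i \<in> S \<and> j \<in> S \<and> i < j} \<union> ?s ` S"
  proof (intro set_eqI iffI)
    fix p assume "p \<in> {(i,j). i \<in> insert k S \<and> j \<in> insert k S \<and> i < j}"
    then obtain i j where p: "p = (i, j)" "i \<in> insert k S" "j \<in> insert k S" "i < j" by auto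
    consider "i = k" "j \<in> S" "j \<noteq> k" | "j = k" "i \<in> S" | "i \<in> S" "j \<in> S" using p assms(2) by auto
    then show "p \<in> {(i,j). i \<in> S \<and> j \<in> S \<and> i < j} \<union> ?s ` S"
    proof cases
      case 1
      then have "p = ?s j" using p by auto
      then show ?thesis using 1 by blast
    next
      case 2
      then have "p = ?s i" using p by auto
      then show ?thesis using 2 by blast
    qed (use p in auto)
  next
    fix p assume "p \<in> {(i,j). i \<in> S \<and> j \<in> S \<and> i < j} \<union> ?s ` S"
    then show "p \<in> {(i,j). i \<in> insert k S \<and> j \<in> insert k S \<and> i < j}"
    proof
      assume "p \<in> ?s ` S"
      then obtain l where "l \<in> S" "p = ?s l" by blast
      moreover have "l \<noteq> k" using assms(2) \<open>l \<in> S\<close> by auto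
      ultimately show ?thesis by (cases "l < k") auto
    qed auto
  qed
  have inj: "inj_on ?s S"
    using assms(2) by (auto simp: inj_on_def split: if_splits)
  have "eps \<sigma> (insert k S) = eps \<sigma> S * (\<Prod>p\<in>?s ` S. ?g p)"
  proof -
    have "{(i,j). i \<in> S \<and> j \<in> S \<and> i < j} \<inter> ?s ` S = {}"
      using assms(2) by (auto split: if_splits)
    then show ?thesis
      unfolding eps_def split using assms(1) by (subst prod.union_disjoint) (simp_all add: finite_pairs)
  qed
  also have "(\<Prod>p\<in>?s ` S. ?g p)
      = (\<Prod>l\<in>S. (if l < k then -1 else 1) * (if \<sigma> l < \<sigma> k then -1 else 1))"
    unfolding prod.reindex[OF inj] o_def
  proof (intro prod.cong refl)
    fix l assume "l \<in> S"
    then have "l \<noteq> k" "\<sigma> l \<noteq> \<sigma> k" using assms by (auto dest: injD)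
    then show "?g (?s l) = (if l < k then -1 else 1) * (if \<sigma> l < \<sigma> k then -1 else 1)"
      by auto
  qed
  also have "\<dots> = (-1) ^ card {l\<in>S. l < k} * (-1) ^ card {l\<in>S. \<sigma> l < \<sigma> k}"
    using assms by (simp add: prod.distrib prod_sign_card)
  finally show ?thesis by (simp add: mult.assoc)
qed

lemma odds_card:
  assumes "k \<le> r" shows "odds n w k = card {l \<in> oddpos n r w. l < k}"
proof -
  have "odds n w k = (\<Sum>l<k. if par n (w ! l) = 1 then 1 else 0)"
    by (intro sum.cong) (auto simp: par_def)
  also have "\<dots> = card {l \<in> {..<k}. par n (w ! l) = 1}"
    by (simp add: sum.If_cases Collect_conj_eq lessThan_def)
  also have "{l \<in> {..<k}. par n (w ! l) = 1} = {l \<in> oddpos n r w. l < k}"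
    using assms by (auto simp: oddpos_def)
  finally show ?thesis .
qed

section \<open>The signed permutation action\<close>

lemma permutes_words:
  assumes "\<sigma> permutes {..<r}" "i < r" shows "\<sigma> i < r"
  using permutes_in_image[OF assms(1), of i] assms(2) by simp

lemma supported_permact: "supported n r (permact n r \<sigma>)"
  by (auto simp: supported_def permact_def)

text \<open>The term at position \<open>k\<close> on one side corresponds to the term at
  \<open>\<sigma> k\<close> on the other. An odd operator adds \<open>k\<close> to the odd positions
  or removes it, and the resulting change of \<open>eps\<close> cancels the discrepancy of the two
  Leibniz signs.\<close>

lemma permact_prho:
  assumes \<sigma>: "\<sigma> permutes {..<r}" and Y: "homog n q Y" and inv: "\<And>k. Y (\<sigma> k) = Y k"
  shows "mmul n r (permact n r \<sigma>) (prho n r q Y) = mmul n r (prho n r q Y) (permact n r \<sigma>)"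
proof (rule supported_eqI[of n r])
  show "supported n r (mmul n r (permact n r \<sigma>) (prho n r q Y))"
    "supported n r (mmul n r (prho n r q Y) (permact n r \<sigma>))"
    by (intro supported_mmul supported_prho supported_permact)+
  fix a b assume a: "a \<in> words n r" and b: "b \<in> words n r"
  have len: "length a = r" "length b = r" using a b by (auto simp: words_iff)
  note \<sigma>r = permutes_words[OF \<sigma>]
  have inj: "inj \<sigma>" using permutes_inj[OF \<sigma>] .
  let ?ag = "\<lambda>k. \<forall>i<r. i \<noteq> k \<longrightarrow> a ! (\<sigma> i) = b ! i"
  have L: "(\<Sum>x<2*n. (-1) ^ (q * odds n b k) * Y k x (b ! k) * permact n r \<sigma> a (b[k := x]))
     = (if ?ag k then (-1) ^ (q * odds n b k) * Y k (a ! \<sigma> k) (b ! k)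
          * eps \<sigma> (oddpos n r (b[k := a ! \<sigma> k])) else 0)" if k: "k < r" for k
  proof -
    have ak: "a ! \<sigma> k < 2 * n" using a k \<sigma>r by (auto simp: words_iff)
    have "permact n r \<sigma> a (b[k := x])
        = (if ?ag k \<and> x = a ! \<sigma> k then eps \<sigma> (oddpos n r (b[k := a ! \<sigma> k])) else 0)"
      if "x < 2 * n" for x
    proof -
      have "(\<forall>i<r. a ! (\<sigma> i) = b[k := x] ! i) \<longleftrightarrow> ?ag k \<and> x = a ! \<sigma> k"
        using k len by (auto simp: nth_list_update)
      then show ?thesis using a b that by (auto simp: permact_eps)
    qed
    then have "(\<Sum>x<2*n. (-1) ^ (q * odds n b k) * Y k x (b ! k) * permact n r \<sigma> a (b[k := x]))
      = (\<Sum>x<2*n. if x = a ! \<sigma> k then (if ?ag k then (-1) ^ (q * odds n b k) * Y k (a ! \<sigma> k) (b ! k)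
          * eps \<sigma> (oddpos n r (b[k := a ! \<sigma> k])) else 0) else 0)"
      by (intro sum.cong) auto
    also have "\<dots> = (if ?ag k then (-1) ^ (q * odds n b k) * Y k (a ! \<sigma> k) (b ! k)
          * eps \<sigma> (oddpos n r (b[k := a ! \<sigma> k])) else 0)"
      using ak by (subst sum.delta) auto
    finally show ?thesis .
  qed
  have R: "(\<Sum>x<2*n. (-1) ^ (q * odds n a (\<sigma> k)) * Y k (a ! \<sigma> k) x * permact n r \<sigma> (a[\<sigma> k := x]) b)
     = (if ?ag k then (-1) ^ (q * odds n a (\<sigma> k)) * Y k (a ! \<sigma> k) (b ! k)
          * eps \<sigma> (oddpos n r b) else 0)" if k: "k < r" for k
  proof -
    have bk: "b ! k < 2 * n" using b k by (auto simp: words_iff)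
    have "permact n r \<sigma> (a[\<sigma> k := x]) b
        = (if ?ag k \<and> x = b ! k then eps \<sigma> (oddpos n r b) else 0)"
      if "x < 2 * n" for x
    proof -
      have "a[\<sigma> k := x] ! \<sigma> i = (if i = k then x else a ! \<sigma> i)" for i
        using injD[OF inj, of k i] k \<sigma>r len by (auto simp: nth_list_update)
      then have "(\<forall>i<r. a[\<sigma> k := x] ! (\<sigma> i) = b ! i) \<longleftrightarrow> ?ag k \<and> x = b ! k"
        using k by auto
      then show ?thesis using a b that by (auto simp: permact_eps)
    qed
    then have "(\<Sum>x<2*n. (-1) ^ (q * odds n a (\<sigma> k)) * Y k (a ! \<sigma> k) x * permact n r \<sigma> (a[\<sigma> k := x]) b)
      = (\<Sum>x<2*n. if x = b ! k then (if ?ag k then (-1) ^ (q * odds n a (\<sigma> k)) * Y k (a ! \<sigma> k) (b ! k)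
          * eps \<sigma> (oddpos n r b) else 0) else 0)"
      by (intro sum.cong) auto
    also have "\<dots> = (if ?ag k then (-1) ^ (q * odds n a (\<sigma> k)) * Y k (a ! \<sigma> k) (b ! k)
          * eps \<sigma> (oddpos n r b) else 0)"
      using bk by (subst sum.delta) auto
    finally show ?thesis .
  qed
  have sign: "(-1) ^ (q * odds n b k) * eps \<sigma> (oddpos n r (b[k := a ! \<sigma> k]))
      = (-1) ^ (q * odds n a (\<sigma> k)) * eps \<sigma> (oddpos n r b)"
    if k: "k < r" and ag: "?ag k" and nz: "Y k (a ! \<sigma> k) (b ! k) \<noteq> 0" for k
  proof -
    \<comment> \<open>The odd positions away from \<open>k\<close>, unaffected by the operator;
      before and after it the odd positions are \<open>S\<close> or
      \<open>insert k S\<close>.\<close>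
    define S where "S = oddpos n r b - {k}"
    have S: "finite S" "k \<notin> S" by (auto simp: S_def)
    have op: "oddpos n r (b[k := a ! \<sigma> k]) = (if par n (a ! \<sigma> k) = 1 then insert k S else S)"
      using k len by (auto simp: oddpos_def S_def nth_list_update split: if_splits)
    have ob: "oddpos n r b = (if par n (b ! k) = 1 then insert k S else S)"
      using k by (auto simp: oddpos_def S_def)
    show ?thesis
    proof (cases "q = 0")
      case True
      then have "par n (a ! \<sigma> k) = par n (b ! k)" using Y nz by (auto simp: homog_0)
      then show ?thesis unfolding True op ob by simp
    next
      case False
      then have q: "q = 1" using Y by (simp add: homog_def)
      have p: "par n (a ! \<sigma> k) = 1 - par n (b ! k)" using Y nz unfolding q homog_1 by blast
      have ok: "odds n b k = card {l\<in>S. l < k}"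
        using odds_card[of k r n b] k by (auto simp: S_def intro!: arg_cong[where f = card])
      have "odds n a (\<sigma> k) = card {l \<in> oddpos n r a. l < \<sigma> k}"
        using \<sigma>r[OF k] by (intro odds_card) simp
      also have "{l \<in> oddpos n r a. l < \<sigma> k} = \<sigma> ` {l\<in>S. \<sigma> l < \<sigma> k}"
      proof (intro set_eqI iffI)
        fix l assume l: "l \<in> {l \<in> oddpos n r a. l < \<sigma> k}"
        then have "l \<in> {..<r}" by (auto simp: oddpos_def)
        then obtain i where i: "l = \<sigma> i" "i < r"
          using permutes_image[OF \<sigma>] by (metis imageE lessThan_iff)
        have "i \<noteq> k" using l i by auto
        then have "i \<in> S" using l i ag by (auto simp: oddpos_def S_def)
        then show "l \<in> \<sigma> ` {l\<in>S. \<sigma> l < \<sigma> k}" using l i by auto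
      next
        fix l assume "l \<in> \<sigma> ` {l\<in>S. \<sigma> l < \<sigma> k}"
        then show "l \<in> {l \<in> oddpos n r a. l < \<sigma> k}"
          using ag \<sigma>r by (auto simp: oddpos_def S_def)
      qed
      also have "card \<dots> = card {l\<in>S. \<sigma> l < \<sigma> k}"
        using inj by (intro card_image) (auto simp: inj_on_def dest: injD)
      finally have oa: "odds n a (\<sigma> k) = card {l\<in>S. \<sigma> l < \<sigma> k}" .
      have sq: "(-1::complex) ^ j * (-1) ^ j = 1" for j
        by (simp flip: power_mult_distrib)
      note ei = eps_insert[OF S inj]
      have pp: "par n (b ! k) = 0 \<or> par n (b ! k) = 1" by (auto simp: par_def)
      then show ?thesis
      proof
        assume "par n (b ! k) = 0"
        then show ?thesis unfolding q op ob p ok oa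
          using sq[of "card {l\<in>S. l < k}"] by (simp add: ei mult_ac)
      next
        assume "par n (b ! k) = 1"
        then show ?thesis unfolding q op ob p ok oa
          using sq[of "card {l\<in>S. \<sigma> l < \<sigma> k}"] by (simp add: ei mult_ac)
      qed
    qed
  qed
  have "mmul n r (permact n r \<sigma>) (prho n r q Y) a b
      = (\<Sum>k<r. if ?ag k then (-1) ^ (q * odds n b k) * Y k (a ! \<sigma> k) (b ! k)
          * eps \<sigma> (oddpos n r (b[k := a ! \<sigma> k])) else 0)"
    unfolding mmul_prho_right[OF b] by (intro sum.cong refl L) simp
  also have "\<dots> = (\<Sum>k<r. if ?ag k then (-1) ^ (q * odds n a (\<sigma> k)) * Y k (a ! \<sigma> k) (b ! k)
          * eps \<sigma> (oddpos n r b) else 0)"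
  proof (intro sum.cong refl if_cong)
    fix k assume "k \<in> {..<r}" "?ag k"
    then show "(-1) ^ (q * odds n b k) * Y k (a ! \<sigma> k) (b ! k) * eps \<sigma> (oddpos n r (b[k := a ! \<sigma> k]))
        = (-1) ^ (q * odds n a (\<sigma> k)) * Y k (a ! \<sigma> k) (b ! k) * eps \<sigma> (oddpos n r b)"
      using sign[of k] by (cases "Y k (a ! \<sigma> k) (b ! k) = 0") (simp_all add: mult_ac)
  qed
  \<comment> \<open>Invariance of the family under \<sigma> turns every index into
    \<open>\<sigma> k\<close>, so that the sum can be reindexed.\<close>
  also have "\<dots> = (\<Sum>k<r. \<Sum>x<2*n. (-1) ^ (q * odds n a (\<sigma> k)) * Y (\<sigma> k) (a ! \<sigma> k) x
        * permact n r \<sigma> (a[\<sigma> k := x]) b)"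
    unfolding inv by (intro sum.cong refl R[symmetric]) simp
  also have "\<dots> = (\<Sum>k<r. \<Sum>x<2*n. (-1) ^ (q * odds n a k) * Y k (a ! k) x
        * permact n r \<sigma> (a[k := x]) b)"
    using sum.permute[OF \<sigma>, of "\<lambda>k. \<Sum>x<2*n. (-1) ^ (q * odds n a k) * Y k (a ! k) x
        * permact n r \<sigma> (a[k := x]) b"] by (simp add: o_def)
  also have "\<dots> = mmul n r (prho n r q Y) (permact n r \<sigma>) a b"
    unfolding mmul_prho_left[OF a] ..
  finally show "mmul n r (permact n r \<sigma>) (prho n r q Y) a b
      = mmul n r (prho n r q Y) (permact n r \<sigma>) a b" .
qed

lemma supported_phi: "supported n r (phi n r c)"
  by (auto simp: supported_def phi_def permact_def)

text \<open>Invariance is demanded only on the support of \<open>c\<close>. This covers constant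
  families with arbitrary \<open>c\<close> as well as families constant on a block, with
  \<open>c\<close> supported on the permutations of that block.\<close>

lemma phi_prho:
  assumes Y: "homog n q Y" and inv: "\<And>\<sigma> k. \<sigma> permutes {..<r} \<Longrightarrow> c \<sigma> \<noteq> 0 \<Longrightarrow> Y (\<sigma> k) = Y k"
  shows "mmul n r (phi n r c) (prho n r q Y) = mmul n r (prho n r q Y) (phi n r c)"
proof (intro ext)
  fix a b
  let ?S = "{\<sigma>. \<sigma> permutes {..<r}}"
  have "mmul n r (phi n r c) (prho n r q Y) a b
     = (\<Sum>\<sigma>\<in>?S. c \<sigma> * mmul n r (permact n r \<sigma>) (prho n r q Y) a b)"
    by (simp add: mmul_def phi_def sum_distrib_right sum_distrib_left mult.assoc, rule sum.swap)
  also have "\<dots> = (\<Sum>\<sigma>\<in>?S. c \<sigma> * mmul n r (prho n r q Y) (permact n r \<sigma>) a b)"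
  proof (intro sum.cong refl)
    fix \<sigma> assume "\<sigma> \<in> ?S"
    then show "c \<sigma> * mmul n r (permact n r \<sigma>) (prho n r q Y) a b
        = c \<sigma> * mmul n r (prho n r q Y) (permact n r \<sigma>) a b"
      using permact_prho[OF _ Y, of \<sigma> r] inv[of \<sigma>] by (cases "c \<sigma> = 0") auto
  qed
  also have "\<dots> = mmul n r (prho n r q Y) (phi n r c) a b"
    by (simp add: mmul_def phi_def sum_distrib_right sum_distrib_left mult_ac, rule sum.swap)
  finally show "mmul n r (phi n r c) (prho n r q Y) a b = mmul n r (prho n r q Y) (phi n r c) a b" .
qed

lemma phi_rho:
  assumes "homog n q (\<lambda>_. X)"
  shows "mmul n r (phi n r c) (rho n r q X) = mmul n r (rho n r q X) (phi n r c)"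
  unfolding rho_prho by (rule phi_prho[OF assms]) simp

text \<open>The sign is a cocycle: a permutation of the odd positions permutes the factors of the
  product over pairs, reversing the order of exactly its own inversions.\<close>
lemma eps_comp:
  assumes "finite S" "inj \<sigma>" "\<tau> permutes S"
  shows "eps (\<sigma> \<circ> \<tau>) S = eps \<sigma> S * eps \<tau> S"
proof -
  let ?P = "{(i,j). i \<in> S \<and> j \<in> S \<and> i < j}"
  let ?g = "\<lambda>\<sigma> p. if \<sigma> (snd p) < \<sigma> (fst p) then -1 else (1::complex)"
  let ?s = "\<lambda>\<tau> p. if \<tau> (fst p) < \<tau> (snd p) then (\<tau> (fst p), \<tau> (snd p)) else (\<tau> (snd p), \<tau> (fst p))"
  have eps: "eps \<sigma> S = (\<Prod>p\<in>?P. ?g \<sigma> p)" for \<sigma>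
    unfolding eps_def by (intro prod.cong) auto
  have inj\<tau>: "\<tau> i = \<tau> j \<longleftrightarrow> i = j" for i j
    using permutes_inj[OF assms(3)] by (auto dest: injD)
  have bij: "bij_betw (?s \<tau>) ?P ?P"
  proof (rule bij_betw_byWitness[where f' = "?s (inv \<tau>)"])
    show "\<forall>p\<in>?P. ?s (inv \<tau>) (?s \<tau> p) = p"
      using permutes_inverses[OF assms(3)] by auto
    show "\<forall>p\<in>?P. ?s \<tau> (?s (inv \<tau>) p) = p"
      using permutes_inverses[OF assms(3)] by auto
    show "?s \<tau> ` ?P \<subseteq> ?P"
      using permutes_in_image[OF assms(3)] inj\<tau> by (auto simp: not_less_iff_gr_or_eq)
    have inv: "inv \<tau> i = inv \<tau> j \<longleftrightarrow> i = j" for i j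
      using permutes_inj[OF permutes_inv[OF assms(3)]] by (auto dest: injD)
    show "?s (inv \<tau>) ` ?P \<subseteq> ?P"
      using permutes_in_image[OF permutes_inv[OF assms(3)]] inv by (auto simp: not_less_iff_gr_or_eq)
  qed
  have "eps \<sigma> S = (\<Prod>p\<in>?P. ?g \<sigma> (?s \<tau> p))"
    unfolding eps by (rule prod.reindex_bij_betw[OF bij, symmetric])
  then have "eps \<sigma> S * eps \<tau> S = (\<Prod>p\<in>?P. ?g \<sigma> (?s \<tau> p) * ?g \<tau> p)"
    by (simp add: eps prod.distrib)
  also have "\<dots> = (\<Prod>p\<in>?P. ?g (\<sigma> \<circ> \<tau>) p)"
  proof (intro prod.cong refl)
    fix p assume "p \<in> ?P"
    then have "\<tau> (fst p) \<noteq> \<tau> (snd p)" using inj\<tau> by auto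
    moreover from this have "\<sigma> (\<tau> (fst p)) \<noteq> \<sigma> (\<tau> (snd p))" using assms(2) by (auto dest: injD)
    ultimately show "?g \<sigma> (?s \<tau> p) * ?g \<tau> p = ?g (\<sigma> \<circ> \<tau>) p" by auto
  qed
  finally show ?thesis by (simp add: eps)
qed

text \<open>The inverted pairs are \<open>(p, q)\<close> itself and two for each element of
  \<open>S\<close> strictly between, an odd number in total.\<close>

lemma eps_transpose:
  assumes "finite S" "p \<in> S" "q \<in> S" "p < q"
  shows "eps (transpose p q) S = -1"
proof -
  let ?P = "{(i,j). i \<in> S \<and> j \<in> S \<and> i < j}"
  let ?I = "{x\<in>?P. transpose p q (snd x) < transpose p q (fst x)}"
  let ?B = "{l\<in>S. p < l \<and> l < q}"
  have "eps (transpose p q) S = (\<Prod>x\<in>?P. if transpose p q (snd x) < transpose p q (fst x) then -1 else 1)"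
    unfolding eps_def by (intro prod.cong) auto
  also have "\<dots> = (-1) ^ card ?I"
    using assms(1) by (intro prod_sign_card finite_pairs)
  also have "?I = insert (p, q) ((\<lambda>l. (p, l)) ` ?B \<union> (\<lambda>l. (l, q)) ` ?B)"
    using assms by (auto simp: transpose_def split: if_splits)
  also have "card \<dots> = Suc (card ?B + card ?B)"
  proof -
    have "card ((\<lambda>l. (p, l)) ` ?B) = card ?B" "card ((\<lambda>l. (l, q)) ` ?B) = card ?B"
      by (auto intro!: card_image inj_onI)
    moreover have "card ((\<lambda>l. (p, l)) ` ?B \<union> (\<lambda>l. (l, q)) ` ?B)
        = card ((\<lambda>l. (p, l)) ` ?B) + card ((\<lambda>l. (l, q)) ` ?B)"
      using assms(1) by (intro card_Un_disjoint) auto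
    moreover have "(p, q) \<notin> (\<lambda>l. (p, l)) ` ?B \<union> (\<lambda>l. (l, q)) ` ?B" by auto
    ultimately show ?thesis using assms(1) by (subst card_insert_disjoint) auto
  qed
  also have "(-1::complex) ^ Suc (card ?B + card ?B) = -1" by (simp add: power_add flip: power_mult_distrib)
  finally show ?thesis .
qed

section \<open>The unnormalised supersymmetriser of the first \<open>m\<close> factors\<close>

definition blocksym :: "nat \<Rightarrow> nat \<Rightarrow> nat \<Rightarrow> mat" where
  "blocksym n r m = phi n r (\<lambda>\<sigma>. if \<sigma> permutes {..<m} then 1 else 0)"

lemma blocksym_eq:
  assumes "m \<le> r"
  shows "blocksym n r m a b = (\<Sum>\<sigma>\<in>{\<sigma>. \<sigma> permutes {..<m}}. permact n r \<sigma> a b)"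
proof -
  have sub: "{\<sigma>. \<sigma> permutes {..<m}} \<subseteq> {\<sigma>. \<sigma> permutes {..<r}}"
    using assms by (auto intro: permutes_subset)
  show ?thesis unfolding blocksym_def phi_def
    by (rule sum.mono_neutral_cong_right[OF _ sub]) (auto simp: finite_permutations)
qed

text \<open>On odd letters the supersymmetriser antisymmetrises: composing with the transposition of
  \<open>p\<close> and \<open>q\<close> permutes the summands and, by \<open>eps_transpose\<close>,
  negates each of them.\<close>

lemma blocksym_repeated_odd:
  assumes "m \<le> r" "p < q" "q < m" "b ! p = b ! q" "par n (b ! q) = 1"
  shows "blocksym n r m a b = 0"
proof -
  let ?t = "transpose p q"
  have t: "?t permutes {..<m}" using assms by (intro permutes_swap_id) auto
  have "permact n r (\<sigma> \<circ> ?t) a b = - permact n r \<sigma> a b" if "\<sigma> permutes {..<m}" for \<sigma>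
  proof -
    have S: "p \<in> oddpos n r b" "q \<in> oddpos n r b" using assms by (auto simp: oddpos_def)
    have "(\<forall>i<r. a ! (\<sigma> (?t i)) = b ! i) \<longleftrightarrow> (\<forall>i<r. a ! (\<sigma> i) = b ! i)"
    proof -
      have bt: "b ! ?t i = b ! i" for i using assms(4) by (auto simp: transpose_def)
      have tr: "?t i < r" if "i < r" for i using that assms by (auto simp: transpose_def)
      show ?thesis by (metis bt tr transpose_involutory)
    qed
    moreover have "eps (\<sigma> \<circ> ?t) (oddpos n r b) = - eps \<sigma> (oddpos n r b)"
      using eps_comp[of "oddpos n r b" \<sigma> ?t] eps_transpose[of "oddpos n r b" p q] S assms(2)
        permutes_inj[OF that] permutes_swap_id[OF S] by simp
    ultimately show ?thesis by (simp only: permact_eps o_apply minus_zero if_distrib[of uminus])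
  qed
  then have "(\<Sum>\<sigma>\<in>{\<sigma>. \<sigma> permutes {..<m}}. permact n r (\<sigma> \<circ> ?t) a b) = - blocksym n r m a b"
    unfolding blocksym_eq[OF assms(1)] sum_negf[symmetric] by (intro sum.cong) auto
  with sum_permutations_compose_right[OF t, of "\<lambda>\<sigma>. permact n r \<sigma> a b"]
  have "blocksym n r m a b = - blocksym n r m a b"
    unfolding blocksym_eq[OF assms(1)] by (rule trans)
  then show ?thesis by simp
qed

section \<open>Super brackets\<close>

text \<open>The Koszul sign between an operator of parity \<open>q\<close> at position
  \<open>k\<close> and one of parity \<open>p\<close> acting further right.\<close>

lemma odds_update_sign:
  assumes "k < length w" "k < l" "homog n q Y" "Y k (w ! k) x \<noteq> 0" "p < 2"
  shows "(-1::complex) ^ (p * odds n (w[k := x]) l) = (-1) ^ (p * q) * (-1) ^ (p * odds n w l)"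
proof -
  have "even (par n (w ! k) + par n x + q)"
    using assms by (auto simp: homog_def)
  moreover have "odds n (w[k := x]) l + par n (w ! k) = odds n w l + par n x"
    using assms by (intro odds_update) auto
  ultimately have "even (odds n (w[k := x]) l) \<longleftrightarrow> even (q + odds n w l)" by presburger
  moreover have "p = 0 \<or> p = 1" using assms(5) by auto
  ultimately show ?thesis by (auto simp: minus_one_power_iff)
qed

definition matprod :: "nat \<Rightarrow> (nat \<Rightarrow> nat \<Rightarrow> complex) \<Rightarrow> (nat \<Rightarrow> nat \<Rightarrow> complex) \<Rightarrow> nat \<Rightarrow> nat \<Rightarrow> complex" where
  "matprod n X Y = (\<lambda>i j. \<Sum>x<2*n. X i x * Y x j)"

lemma rho_rho:
  assumes "a \<in> words n r"
  shows "mmul n r (rho n r p X) (mmul n r (rho n r q Y) M) a b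
    = (\<Sum>k<r. \<Sum>x<2*n. \<Sum>l<r. \<Sum>y<2*n. (-1) ^ (p * odds n a k) * X (a ! k) x *
        ((-1) ^ (q * odds n (a[k := x]) l) * Y (a[k := x] ! l) y * M (a[k := x, l := y]) b))"
  unfolding rho_prho mmul_prho_left[OF assms]
  by (intro sum.cong refl) (use assms in \<open>simp add: mmul_prho_left sum_distrib_left\<close>)

text \<open>Terms acting at different positions cancel, those at the same position give the product.\<close>
lemma superbracket_apply:
  assumes X: "homog n p (\<lambda>_. X)" and Y: "homog n q (\<lambda>_. Y)" and a: "a \<in> words n r"
  shows "mmul n r (rho n r p X) (mmul n r (rho n r q Y) M) a b
      - (-1) ^ (p * q) * mmul n r (rho n r q Y) (mmul n r (rho n r p X) M) a b
    = mmul n r (rho n r (p + q) (\<lambda>i j. matprod n X Y i j - (-1) ^ (p * q) * matprod n Y X i j)) M a b"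
proof -
  have len: "length a = r" using a by (simp add: words_iff)
  have pq: "p < 2" "q < 2" using X Y by (auto simp: homog_def)
  define T where "T = (\<lambda>X Y p q k x l y. (-1) ^ (p * odds n a k) * X (a ! k) x *
        ((-1) ^ (q * odds n (a[k := x]) l) * Y (a[k := x] ! l) y * M (a[k := x, l := y]) b))"
  have off: "T X Y p q k x l y = (-1) ^ (p * q) * T Y X q p l y k x"
    if kl: "k < r" "l < r" "k \<noteq> l" for k l x y
  proof (cases "X (a ! k) x = 0 \<or> Y (a ! l) y = 0")
    case True
    then show ?thesis using kl len by (auto simp: T_def)
  next
    case False
    have sq: "(-1::complex) ^ (p * q) * (-1) ^ (p * q) = 1" by (simp flip: power_mult_distrib)
    have swap: "a[k := x, l := y] = a[l := y, k := x]" using kl by (simp add: list_update_swap)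
    show ?thesis
    proof (cases "k < l")
      case True
      then have "(-1::complex) ^ (q * odds n (a[k := x]) l) = (-1) ^ (q * p) * (-1) ^ (q * odds n a l)"
        using odds_update_sign[OF _ True X _ pq(2), of a x] False kl len by auto
      then show ?thesis using kl True swap by (simp add: T_def mult_ac)
    next
      case kl': False
      then have "(-1::complex) ^ (p * odds n (a[l := y]) k) = (-1) ^ (p * q) * (-1) ^ (p * odds n a k)"
        using odds_update_sign[of l a k, OF _ _ Y _ pq(1), of y] False kl len by auto
      then show ?thesis using kl kl' swap sq by (simp add: T_def mult_ac)
    qed
  qed
  have sep: "(\<Sum>k<r. \<Sum>x<2*n. \<Sum>l<r. \<Sum>y<2*n. T X Y p q k x l y)
     = (\<Sum>k<r. \<Sum>x<2*n. \<Sum>y<2*n. T X Y p q k x k y)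
     + (\<Sum>k<r. \<Sum>l\<in>{..<r} - {k}. \<Sum>x<2*n. \<Sum>y<2*n. T X Y p q k x l y)" for X Y p q
  proof -
    have "(\<Sum>k<r. \<Sum>x<2*n. \<Sum>l<r. \<Sum>y<2*n. T X Y p q k x l y)
      = (\<Sum>k<r. (\<Sum>x<2*n. \<Sum>y<2*n. T X Y p q k x k y)
         + (\<Sum>x<2*n. \<Sum>l\<in>{..<r} - {k}. \<Sum>y<2*n. T X Y p q k x l y))"
    proof (intro sum.cong refl)
      fix k assume "k \<in> {..<r}"
      then have "(\<Sum>l<r. \<Sum>y<2*n. T X Y p q k x l y) = (\<Sum>y<2*n. T X Y p q k x k y)
          + (\<Sum>l\<in>{..<r} - {k}. \<Sum>y<2*n. T X Y p q k x l y)" for x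
        by (intro sum.remove) auto
      then show "(\<Sum>x<2*n. \<Sum>l<r. \<Sum>y<2*n. T X Y p q k x l y)
          = (\<Sum>x<2*n. \<Sum>y<2*n. T X Y p q k x k y)
          + (\<Sum>x<2*n. \<Sum>l\<in>{..<r} - {k}. \<Sum>y<2*n. T X Y p q k x l y)"
        by (simp only: sum.distrib)
    qed
    also have "\<dots> = (\<Sum>k<r. (\<Sum>x<2*n. \<Sum>y<2*n. T X Y p q k x k y)
         + (\<Sum>l\<in>{..<r} - {k}. \<Sum>x<2*n. \<Sum>y<2*n. T X Y p q k x l y))"
      by (intro sum.cong refl arg_cong2[where f = "(+)"] sum.swap)
    finally show ?thesis by (simp add: sum.distrib)
  qed
  have swap: "(\<Sum>k<r. \<Sum>l\<in>{..<r} - {k}. g k l) = (\<Sum>l<r. \<Sum>k\<in>{..<r} - {l}. g k l)"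
    for g :: "nat \<Rightarrow> nat \<Rightarrow> complex"
  proof -
    have "(\<Sum>k\<in>{..<r}. \<Sum>l\<in>{l \<in> {..<r}. k \<noteq> l}. g k l) = (\<Sum>l\<in>{..<r}. \<Sum>k\<in>{k \<in> {..<r}. k \<noteq> l}. g k l)"
      by (rule sum.swap_restrict) auto
    moreover have "{l \<in> {..<r}. k \<noteq> l} = {..<r} - {k}" "{l \<in> {..<r}. l \<noteq> k} = {..<r} - {k}" for k by auto
    ultimately show ?thesis by (simp only:)
  qed
  have "(\<Sum>k<r. \<Sum>l\<in>{..<r} - {k}. \<Sum>x<2*n. \<Sum>y<2*n. T X Y p q k x l y)
      = (\<Sum>k<r. \<Sum>l\<in>{..<r} - {k}. \<Sum>x<2*n. \<Sum>y<2*n. (-1) ^ (p * q) * T Y X q p l y k x)"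
    by (intro sum.cong refl off) auto
  also have "\<dots> = (-1) ^ (p * q) * (\<Sum>k<r. \<Sum>l\<in>{..<r} - {k}. \<Sum>y<2*n. \<Sum>x<2*n. T Y X q p l y k x)"
    unfolding sum_distrib_left by (rule sum.cong[OF refl], rule sum.cong[OF refl], rule sum.swap)
  also have "(\<Sum>k<r. \<Sum>l\<in>{..<r} - {k}. \<Sum>y<2*n. \<Sum>x<2*n. T Y X q p l y k x)
      = (\<Sum>l<r. \<Sum>k\<in>{..<r} - {l}. \<Sum>y<2*n. \<Sum>x<2*n. T Y X q p l y k x)"
    by (rule swap)
  finally have offsum: "(\<Sum>k<r. \<Sum>l\<in>{..<r} - {k}. \<Sum>x<2*n. \<Sum>y<2*n. T X Y p q k x l y)
      = (-1) ^ (p * q) * (\<Sum>k<r. \<Sum>l\<in>{..<r} - {k}. \<Sum>x<2*n. \<Sum>y<2*n. T Y X q p k x l y)" .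
  have diag: "(\<Sum>k<r. \<Sum>x<2*n. \<Sum>y<2*n. T X Y p q k x k y)
      = (\<Sum>k<r. \<Sum>y<2*n. (-1) ^ ((p + q) * odds n a k) * matprod n X Y (a ! k) y * M (a[k := y]) b)"
    for X Y p q
  proof (rule sum.cong[OF refl])
    fix k assume "k \<in> {..<r}"
    then have k: "k < length a" using len by simp
    have "(\<Sum>x<2*n. \<Sum>y<2*n. T X Y p q k x k y) = (\<Sum>y<2*n. \<Sum>x<2*n. T X Y p q k x k y)"
      by (rule sum.swap)
    also have "\<dots> = (\<Sum>y<2*n. (-1) ^ ((p + q) * odds n a k) * matprod n X Y (a ! k) y * M (a[k := y]) b)"
    proof (rule sum.cong[OF refl])
      fix y
      have "c * (\<Sum>x<2*n. g x) * m = (\<Sum>x<2*n. c * g x * m)" for c m and g :: "nat \<Rightarrow> complex"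
        by (simp add: sum_distrib_left sum_distrib_right)
      note d = this
      have e: "(-1::complex) ^ ((p + q) * j) = (-1) ^ (p * j) * (-1) ^ (q * j)" for j
        by (simp add: power_add distrib_right)
      show "(\<Sum>x<2*n. T X Y p q k x k y)
          = (-1) ^ ((p + q) * odds n a k) * matprod n X Y (a ! k) y * M (a[k := y]) b"
        using k unfolding matprod_def d e by (intro sum.cong refl) (simp add: T_def)
    qed
    finally show "(\<Sum>x<2*n. \<Sum>y<2*n. T X Y p q k x k y)
      = (\<Sum>y<2*n. (-1) ^ ((p + q) * odds n a k) * matprod n X Y (a ! k) y * M (a[k := y]) b)" .
  qed
  have expand: "mmul n r (rho n r p X) (mmul n r (rho n r q Y) M) a b
      = (\<Sum>k<r. \<Sum>y<2*n. (-1) ^ ((p + q) * odds n a k) * matprod n X Y (a ! k) y * M (a[k := y]) b)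
        + (\<Sum>k<r. \<Sum>l\<in>{..<r} - {k}. \<Sum>x<2*n. \<Sum>y<2*n. T X Y p q k x l y)" for X Y p q
  proof -
    have "mmul n r (rho n r p X) (mmul n r (rho n r q Y) M) a b
      = (\<Sum>k<r. \<Sum>x<2*n. \<Sum>l<r. \<Sum>y<2*n. T X Y p q k x l y)"
      unfolding rho_rho[OF a] T_def ..
    then show ?thesis unfolding sep diag .
  qed
  show ?thesis
    unfolding expand offsum unfolding rho_prho mmul_prho_left[OF a]
    by (simp add: add.commute[of q p] left_diff_distrib right_diff_distrib distrib_left
        sum_distrib_left sum_subtractf mult_ac)
qed

lemma prho_cong:
  assumes "\<And>k x y. k < r \<Longrightarrow> x < 2 * n \<Longrightarrow> y < 2 * n \<Longrightarrow> Y k x y = Y' k x y"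
  shows "prho n r q Y = prho n r q Y'"
  unfolding prho_def using assms by (intro ext) (auto simp: words_iff intro!: sum.cong)

lemma rho_cong:
  "(\<And>x y. x < 2 * n \<Longrightarrow> y < 2 * n \<Longrightarrow> X x y = X' x y) \<Longrightarrow> rho n r q X = rho n r q X'"
  unfolding rho_prho by (rule prho_cong)

lemma rho_zero: "rho n r q (\<lambda>_ _. 0) = 0"
  by (intro ext) (auto simp: rho_def intro!: sum.neutral)

lemma supported_rho: "supported n r (rho n r q X)"
  by (simp add: rho_prho supported_prho)

lemma prho_add: "prho n r q (\<lambda>k x y. Y k x y + Y' k x y) = prho n r q Y + prho n r q Y'"
  by (intro ext) (auto simp: prho_def distrib_left sum.distrib[symmetric] intro!: sum.cong)

lemma prho_scale: "prho n r q (\<lambda>k x y. c * Y k x y) = (\<lambda>a b. c * prho n r q Y a b)"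
  by (intro ext) (auto simp: prho_def sum_distrib_left intro!: sum.cong)

lemma mmul_ident:
  assumes "supported n r A" shows "mmul n r A (ident n r) = A"
proof (intro ext)
  fix a b
  have "mmul n r A (ident n r) a b = (\<Sum>u\<in>words n r. if u = b then A a u else 0)"
    unfolding mmul_def by (intro sum.cong) (auto simp: ident_def)
  also have "\<dots> = A a b" using assms by (auto simp: supported_def)
  finally show "mmul n r A (ident n r) a b = A a b" .
qed

lemma superbracket:
  assumes "homog n p (\<lambda>_. X)" "homog n q (\<lambda>_. Y)"
  shows "mmul n r (rho n r p X) (rho n r q Y) a b
      - (-1) ^ (p * q) * mmul n r (rho n r q Y) (rho n r p X) a b
    = rho n r (p + q) (\<lambda>i j. matprod n X Y i j - (-1) ^ (p * q) * matprod n Y X i j) a b"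
proof (cases "a \<in> words n r")
  case True
  show ?thesis
    using superbracket_apply[OF assms True, of "ident n r" b] by (simp add: mmul_ident supported_rho)
next
  case False
  then show ?thesis by (simp add: mmul_def rho_def)
qed

section \<open>Endomorphisms killing a generating word\<close>

definition eunit :: "nat \<Rightarrow> nat \<Rightarrow> nat \<Rightarrow> nat \<Rightarrow> complex" where
  "eunit i j = (\<lambda>k l. if k = i \<and> l = j then 1 else 0)"

definition ediff :: "nat \<Rightarrow> nat \<Rightarrow> nat \<Rightarrow> nat \<Rightarrow> complex" where
  "ediff i j = (\<lambda>k l. if k = l then (if k = i then 1 else if k = j then -1 else 0) else 0)"

lemma tr_eunit: "i \<noteq> j \<Longrightarrow> tr n (eunit i j) = 0"
  by (auto simp: tr_def eunit_def intro!: sum.neutral)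

lemma tr_zmat [simp]: "tr n zmat = 0"
  by (simp add: tr_def zmat_def)

lemma tr_ediff:
  assumes "i < n" "j < n" "i \<noteq> j" shows "tr n (ediff i j) = 0"
proof -
  have "tr n (ediff i j) = (\<Sum>k<n. (if k = i then 1 else 0) + (if k = j then -1 else 0))"
    using assms by (auto simp: tr_def ediff_def intro!: sum.cong)
  then show ?thesis using assms by (simp add: sum.distrib)
qed

lemma gmat_eunit_even:
  "i < n \<Longrightarrow> j < n \<Longrightarrow> x < 2 * n \<Longrightarrow> y < 2 * n \<Longrightarrow> gmat n (eunit i j) zmat 0 0 x y
    = (if x = i \<and> y = j \<or> x = n + i \<and> y = n + j then 1 else 0)"
  by (auto simp: gmat_def eunit_def zmat_def)

lemma gmat_eunit_odd:
  "i < n \<Longrightarrow> j < n \<Longrightarrow> x < 2 * n \<Longrightarrow> y < 2 * n \<Longrightarrow> gmat n zmat (eunit i j) 0 0 x y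
    = (if x = n + i \<and> y = j then 1 else 0)"
  by (auto simp: gmat_def eunit_def zmat_def)

lemma gmat_ediff_odd:
  "i < n \<Longrightarrow> j < n \<Longrightarrow> i \<noteq> j \<Longrightarrow> x < 2 * n \<Longrightarrow> y < 2 * n \<Longrightarrow> gmat n zmat (ediff i j) 0 0 x y
    = (if x = n + i \<and> y = i then 1 else if x = n + j \<and> y = j then -1 else 0)"
  by (auto simp: gmat_def ediff_def zmat_def)

text \<open>Forgets the parity: \<open>x\<close> and \<open>n + x\<close> lie over the same basis
  vector of C^n, and sl(n) treats them alike.\<close>

definition base :: "nat \<Rightarrow> nat \<Rightarrow> nat" where
  "base n x = (if x < n then x else x - n)"

lemma base_less: "x < 2 * n \<Longrightarrow> base n x < n"
  by (auto simp: base_def)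

lemma base_par: "x < 2 * n \<Longrightarrow> par n x = 1 \<Longrightarrow> x = n + base n x"
  by (auto simp: base_def par_def split: if_splits)

lemma odds_oddpos: "odds n w r = card (oddpos n r w)"
  unfolding odds_card[OF order_refl] by (auto simp: oddpos_def intro!: arg_cong[where f = card])

section \<open>Preservation of degree and weight\<close>

lemma mmul_diag_left:
  assumes "\<And>x y. x \<noteq> y \<Longrightarrow> X x y = 0" "a \<in> words n r"
  shows "mmul n r (rho n r 0 X) f a b = (\<Sum>k<r. X (a ! k) (a ! k)) * f a b"
proof -
  have sel: "(\<Sum>x<2*n. (if x = y then g x else 0)) = g y" if "y < 2 * n" for y and g :: "nat \<Rightarrow> complex"
    using that by simp
  have "mmul n r (rho n r 0 X) f a b = (\<Sum>k<r. \<Sum>x<2*n. if x = a ! k then X x x * f (a[k := x]) b else 0)"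
    unfolding rho_prho mmul_prho_left[OF assms(2)] by (intro sum.cong refl) (auto simp: assms(1))
  also have "\<dots> = (\<Sum>k<r. X (a ! k) (a ! k) * f a b)"
    using assms(2) by (intro sum.cong refl, subst sel) (auto simp: words_iff)
  finally show ?thesis by (simp add: sum_distrib_right)
qed

lemma mmul_diag_right:
  assumes "\<And>x y. x \<noteq> y \<Longrightarrow> X x y = 0" "b \<in> words n r"
  shows "mmul n r f (rho n r 0 X) a b = (\<Sum>k<r. X (b ! k) (b ! k)) * f a b"
proof -
  have sel: "(\<Sum>x<2*n. (if x = y then g x else 0)) = g y" if "y < 2 * n" for y and g :: "nat \<Rightarrow> complex"
    using that by simp
  have "mmul n r f (rho n r 0 X) a b = (\<Sum>k<r. \<Sum>x<2*n. if x = b ! k then X x x * f a (b[k := x]) else 0)"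
    unfolding rho_prho mmul_prho_right[OF assms(2)] by (intro sum.cong refl) (auto simp: assms(1))
  also have "\<dots> = (\<Sum>k<r. X (b ! k) (b ! k) * f a b)"
    using assms(2) by (intro sum.cong refl, subst sel) (auto simp: words_iff)
  finally show ?thesis by (simp add: sum_distrib_right)
qed

lemma diag_weight:
  assumes "mmul n r f (rho n r 0 X) = mmul n r (rho n r 0 X) f"
    and "\<And>x y. x \<noteq> y \<Longrightarrow> X x y = 0"
    and "a \<in> words n r" "b \<in> words n r" "f a b \<noteq> 0"
  shows "(\<Sum>k<r. X (a ! k) (a ! k)) = (\<Sum>k<r. X (b ! k) (b ! k))"
  using mmul_diag_left[where X = X, OF assms(2,3), where f = f and b = b] mmul_diag_right[where X = X, OF assms(2,4), where f = f and a = a] assms(1,5)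
  by simp

lemma degree_weight:
  assumes "w \<in> words n r"
  shows "(\<Sum>k<r. gmat n zmat zmat 0 d (w ! k) (w ! k)) = d * of_nat (odds n w r)"
  unfolding of_nat_sum sum_distrib_left using assms
  by (intro sum.cong refl) (auto simp: gmat_def zmat_def par_def words_iff)

lemma odds_preserved:
  assumes comm: "mmul n r f (rho n r 0 (gmat n zmat zmat 0 1)) = mmul n r (rho n r 0 (gmat n zmat zmat 0 1)) f"
    and ab: "a \<in> words n r" "b \<in> words n r" "f a b \<noteq> 0"
  shows "odds n a r = odds n b r"
proof -
  let ?X = "gmat n zmat zmat 0 1"
  have X: "(\<Sum>k<r. ?X (w ! k) (w ! k)) = of_nat (odds n w r)" if "w \<in> words n r" for w
    using degree_weight[OF that, of 1] by simp
  have "(\<Sum>k<r. ?X (a ! k) (a ! k)) = (\<Sum>k<r. ?X (b ! k) (b ! k))"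
    by (rule diag_weight[OF comm _ ab]) (auto simp: gmat_def zmat_def)
  then show ?thesis unfolding X[OF ab(1)] X[OF ab(2)] of_nat_eq_iff .
qed

definition mult_of :: "nat \<Rightarrow> nat \<Rightarrow> nat list \<Rightarrow> nat \<Rightarrow> nat" where
  "mult_of n r w i = (\<Sum>k<r. if base n (w ! k) = i then 1 else 0)"

text \<open>Traceless diagonal matrices detect only differences of multiplicities. Since the
  multiplicities of every word add up to \<open>r\<close>, summing the differences over
  \<open>j\<close> recovers \<open>n\<close> times each of them.\<close>

lemma mult_of_preserved:
  assumes comm: "\<And>A. tr n A = 0 \<Longrightarrow>
      mmul n r f (rho n r 0 (gmat n A zmat 0 0)) = mmul n r (rho n r 0 (gmat n A zmat 0 0)) f"
    and ab: "a \<in> words n r" "b \<in> words n r" "f a b \<noteq> 0" and i: "i < n"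
  shows "mult_of n r a i = mult_of n r b i"
proof -
  let ?m = "\<lambda>w i. of_nat (mult_of n r w i) :: complex"
  have "?m a i - ?m a j = ?m b i - ?m b j" if j: "j < n" for j
  proof (cases "i = j")
    case False
    let ?X = "gmat n (ediff i j) zmat 0 0"
    have X: "(\<Sum>k<r. ?X (w ! k) (w ! k)) = ?m w i - ?m w j" if "w \<in> words n r" for w
      unfolding mult_of_def of_nat_sum sum_subtractf[symmetric]
    proof (intro sum.cong refl)
      fix k assume "k \<in> {..<r}"
      then have "w ! k < 2 * n" using that by (auto simp: words_iff)
      then show "?X (w ! k) (w ! k) = of_nat (if base n (w ! k) = i then 1 else 0)
          - of_nat (if base n (w ! k) = j then 1 else 0)"
        using i j False by (auto simp: gmat_def ediff_def base_def)
    qed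
    have "(\<Sum>k<r. ?X (a ! k) (a ! k)) = (\<Sum>k<r. ?X (b ! k) (b ! k))"
      by (rule diag_weight[OF comm[OF tr_ediff[OF i j False]] _ ab])
        (auto simp: gmat_def ediff_def zmat_def)
    then show ?thesis unfolding X[OF ab(1)] X[OF ab(2)] .
  qed simp
  then have "(\<Sum>j<n. ?m a i - ?m a j) = (\<Sum>j<n. ?m b i - ?m b j)"
    by (intro sum.cong) auto
  moreover have "(\<Sum>j<n. ?m w j) = of_nat r" if w: "w \<in> words n r" for w
  proof -
    have "(\<Sum>j<n. mult_of n r w j) = (\<Sum>k<r. \<Sum>j<n. if base n (w ! k) = j then 1 else 0)"
      unfolding mult_of_def by (rule sum.swap)
    also have "\<dots> = (\<Sum>k<r. 1)"
      using w by (intro sum.cong refl) (auto simp: words_iff base_less)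
    finally show ?thesis by (simp flip: of_nat_sum)
  qed
  ultimately have "of_nat n * ?m a i = of_nat n * ?m b i"
    using ab by (simp add: sum_subtractf)
  then show ?thesis using i by simp
qed

text \<open>There are no super signs because all endomorphisms turn out to be even: an odd one would
  have to preserve the degree and yet change its parity.\<close>

locale commuting =
  fixes n r :: nat and h :: mat
  assumes supp: "supported n r h"
    and even_comm: "\<And>A d. tr n A = 0 \<Longrightarrow>
      mmul n r h (rho n r 0 (gmat n A zmat 0 d)) = mmul n r (rho n r 0 (gmat n A zmat 0 d)) h"
    and odd_comm: "\<And>C b. tr n C = 0 \<Longrightarrow>
      mmul n r h (rho n r 1 (gmat n zmat C b 0)) = mmul n r (rho n r 1 (gmat n zmat C b 0)) h"
begin

section \<open>Spreading the vanishing from one column to others\<close>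

definition kills :: "nat list \<Rightarrow> bool" where
  "kills b \<longleftrightarrow> (\<forall>a. h a b = 0)"

text \<open>If \<open>h\<close> annihilates a basis vector, it annihilates the image of that vector
  under every operator commuting with \<open>h\<close>; the sum is this image, expanded.\<close>

lemma kills_prho:
  assumes "mmul n r h (rho n r q X) = mmul n r (rho n r q X) h" "b \<in> words n r" "kills b"
  shows "(\<Sum>k<r. \<Sum>x<2*n. (-1) ^ (q * odds n b k) * X x (b ! k) * h a (b[k := x])) = 0"
proof -
  have "mmul n r (rho n r q X) h a b = 0"
    using assms(3) by (simp add: mmul_def kills_def)
  then show ?thesis using assms(1,2) mmul_prho_right[OF assms(2), of h q "\<lambda>_. X" a]
    by (simp add: rho_prho)
qed

lemma kills_even:
  assumes "i < n" "j < n" "i \<noteq> j" and b: "b \<in> words n r" "kills b"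
  shows "(\<Sum>k<r. if b ! k = j then h a (b[k := i])
      else if b ! k = n + j then h a (b[k := n + i]) else 0) = 0"
proof -
  have "(\<Sum>x<2*n. (-1) ^ (0 * odds n b k) * gmat n (eunit i j) zmat 0 0 x (b ! k) * h a (b[k := x]))
      = (if b ! k = j then h a (b[k := i]) else if b ! k = n + j then h a (b[k := n + i]) else 0)"
    if "k < r" for k
  proof -
    have bk: "b ! k < 2 * n" using b(1) that by (auto simp: words_iff)
    have "(\<Sum>x<2*n. (-1) ^ (0 * odds n b k) * gmat n (eunit i j) zmat 0 0 x (b ! k) * h a (b[k := x]))
      = (\<Sum>x<2*n. if x = (if b ! k = j then i else n + i) then
          (if b ! k = j \<or> b ! k = n + j then h a (b[k := x]) else 0) else 0)"
      using assms bk by (intro sum.cong refl) (auto simp: gmat_eunit_even)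
    also have "\<dots> = (if b ! k = j then h a (b[k := i]) else if b ! k = n + j then h a (b[k := n + i]) else 0)"
      using assms by (subst sum.delta) auto
    finally show ?thesis .
  qed
  then show ?thesis
    using kills_prho[OF even_comm[OF tr_eunit[OF assms(3)], of 0] b, of a] by simp
qed

lemma kills_odd:
  assumes "i < n" "j < n" "i \<noteq> j" and b: "b \<in> words n r" "kills b"
  shows "(\<Sum>k<r. if b ! k = j then (-1) ^ odds n b k * h a (b[k := n + i]) else 0) = 0"
proof -
  have "(\<Sum>x<2*n. (-1) ^ (1 * odds n b k) * gmat n zmat (eunit i j) 0 0 x (b ! k) * h a (b[k := x]))
      = (if b ! k = j then (-1) ^ odds n b k * h a (b[k := n + i]) else 0)"
    if "k < r" for k
  proof -
    have bk: "b ! k < 2 * n" using b(1) that by (auto simp: words_iff)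
    have "(\<Sum>x<2*n. (-1) ^ (1 * odds n b k) * gmat n zmat (eunit i j) 0 0 x (b ! k) * h a (b[k := x]))
      = (\<Sum>x<2*n. if x = n + i then
          (if b ! k = j then (-1) ^ odds n b k * h a (b[k := x]) else 0) else 0)"
      using assms bk by (intro sum.cong refl) (auto simp: gmat_eunit_odd)
    also have "\<dots> = (if b ! k = j then (-1) ^ odds n b k * h a (b[k := n + i]) else 0)"
      using assms by (subst sum.delta) auto
    finally show ?thesis .
  qed
  then show ?thesis
    using kills_prho[OF odd_comm[OF tr_eunit[OF assms(3)], of 0] b, of a] by simp
qed

text \<open>The identity is not traceless, so diagonal odd elements come only as differences; every
  use has to dispose of the second term or exploit it.\<close>

lemma kills_odd_diag:
  assumes "i < n" "j < n" "i \<noteq> j" and b: "b \<in> words n r" "kills b"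
  shows "(\<Sum>k<r. if b ! k = i then (-1) ^ odds n b k * h a (b[k := n + i])
    else if b ! k = j then - ((-1) ^ odds n b k * h a (b[k := n + j])) else 0) = 0"
proof -
  have "(\<Sum>x<2*n. (-1) ^ (1 * odds n b k) * gmat n zmat (ediff i j) 0 0 x (b ! k) * h a (b[k := x]))
      = (if b ! k = i then (-1) ^ odds n b k * h a (b[k := n + i])
    else if b ! k = j then - ((-1) ^ odds n b k * h a (b[k := n + j])) else 0)"
    if "k < r" for k
  proof -
    have bk: "b ! k < 2 * n" using b(1) that by (auto simp: words_iff)
    have "(\<Sum>x<2*n. (-1) ^ (1 * odds n b k) * gmat n zmat (ediff i j) 0 0 x (b ! k) * h a (b[k := x]))
      = (\<Sum>x<2*n. if x = (if b ! k = i then n + i else n + j) then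
          (if b ! k = i then (-1) ^ odds n b k * h a (b[k := x])
           else if b ! k = j then - ((-1) ^ odds n b k * h a (b[k := x])) else 0) else 0)"
      using assms bk by (intro sum.cong refl) (auto simp: gmat_ediff_odd)
    also have "\<dots> = (if b ! k = i then (-1) ^ odds n b k * h a (b[k := n + i])
    else if b ! k = j then - ((-1) ^ odds n b k * h a (b[k := n + j])) else 0)"
      using assms by (subst sum.delta) auto
    finally show ?thesis .
  qed
  then show ?thesis
    using kills_prho[OF odd_comm[OF tr_ediff[OF assms(1-3)], of 0] b, of a] by simp
qed

text \<open>As the letter at \<open>p\<close> occurs only once, the matrix unit replacing it by
  \<open>j\<close> acts at this single position and produces one word.\<close>

lemma kills_replace:
  assumes w: "w \<in> words n r" "kills w" and low: "\<And>k. k < r \<Longrightarrow> w ! k < n"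
    and p: "p < r" "\<And>k. k < r \<Longrightarrow> w ! k = w ! p \<Longrightarrow> k = p" and j: "j < n" "j \<noteq> w ! p"
  shows "kills (w[p := j])"
  unfolding kills_def
proof
  fix a
  have "(\<Sum>k<r. if w ! k = w ! p then h a (w[k := j])
      else if w ! k = n + w ! p then h a (w[k := n + j]) else 0) = 0"
    by (rule kills_even) (use j w low p in auto)
  also have "(\<Sum>k<r. if w ! k = w ! p then h a (w[k := j])
      else if w ! k = n + w ! p then h a (w[k := n + j]) else 0)
    = (\<Sum>k<r. if k = p then h a (w[k := j]) else 0)"
  proof (intro sum.cong refl)
    fix k assume "k \<in> {..<r}"
    then show "(if w ! k = w ! p then h a (w[k := j])
      else if w ! k = n + w ! p then h a (w[k := n + j]) else 0) = (if k = p then h a (w[k := j]) else 0)"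
      using p low[of k] by auto
  qed
  also have "\<dots> = h a (w[p := j])" using p by simp
  finally show "h a (w[p := j]) = 0" .
qed

text \<open>First the letter at \<open>q\<close> is copied to position \<open>p\<close>. The matrix
  unit sending that letter to \<open>w ! p\<close> then yields a sum of two words, the original
  \<open>w\<close> and the swapped one, and \<open>w\<close> is already killed.\<close>

lemma kills_swap:
  assumes w: "w \<in> words n r" "kills w" and low: "\<And>k. k < r \<Longrightarrow> w ! k < n"
    and dist: "distinct w" and pq: "p < r" "q < r" "p \<noteq> q"
  shows "kills (w[p := w ! q, q := w ! p])"
  unfolding kills_def
proof
  fix a
  have len: "length w = r" using w by (simp add: words_iff)
  have inj: "w ! k = w ! l \<longleftrightarrow> k = l" if "k < r" "l < r" for k l
    using dist len that by (simp add: nth_eq_iff_index_eq)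
  let ?u = "w[p := w ! q]"
  have u: "?u \<in> words n r" "kills ?u"
  proof -
    have "w ! q < 2 * n" using low[OF pq(2)] by simp
    then show "?u \<in> words n r" using w by simp
    show "kills ?u" using w low pq inj by (intro kills_replace) auto
  qed
  have "(\<Sum>k<r. if ?u ! k = w ! q then h a (?u[k := w ! p])
      else if ?u ! k = n + w ! q then h a (?u[k := n + w ! p]) else 0) = 0"
    by (rule kills_even) (use u low pq inj in auto)
  also have "(\<Sum>k<r. if ?u ! k = w ! q then h a (?u[k := w ! p])
      else if ?u ! k = n + w ! q then h a (?u[k := n + w ! p]) else 0)
    = (\<Sum>k<r. (if k = p then h a (?u[k := w ! p]) else 0) + (if k = q then h a (?u[k := w ! p]) else 0))"
  proof (intro sum.cong refl)
    fix k assume "k \<in> {..<r}"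
    then show "(if ?u ! k = w ! q then h a (?u[k := w ! p])
      else if ?u ! k = n + w ! q then h a (?u[k := n + w ! p]) else 0)
      = (if k = p then h a (?u[k := w ! p]) else 0) + (if k = q then h a (?u[k := w ! p]) else 0)"
      using pq low[of k] inj len by (auto simp: nth_list_update)
  qed
  also have "\<dots> = h a (?u[p := w ! p]) + h a (?u[q := w ! p])"
    using pq by (simp add: sum.distrib)
  also have "?u[p := w ! p] = w" by simp
  finally show "h a (w[p := w ! q, q := w ! p]) = 0" using w(2) by (simp add: kills_def)
qed

text \<open>Induction on the number of positions where \<open>w\<close> differs from
  \<open>[0..<r]\<close>. One swap or one replacement brings \<open>w\<close> closer; both moves are
  reversible by the preceding lemmas.\<close>

lemma kills_distinct:
  assumes start: "kills [0..<r]" and rn: "r \<le> n"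
    and "w \<in> words n r" "\<And>k. k < r \<Longrightarrow> w ! k < n" "distinct w"
  shows "kills w"
  using assms(3-)
proof (induction "card {k. k < r \<and> w ! k \<noteq> k}" arbitrary: w rule: less_induct)
  case less
  have len: "length w = r" using less.prems by (simp add: words_iff)
  have inj: "w ! k = w ! l \<longleftrightarrow> k = l" if "k < r" "l < r" for k l
    using less.prems(3) len that by (simp add: nth_eq_iff_index_eq)
  show ?case
  proof (cases "\<exists>k<r. w ! k \<noteq> k")
    case False
    then have "w = [0..<r]" using len by (intro nth_equalityI) auto
    then show ?thesis using start by simp
  next
    case True
    then obtain k where k: "k < r" "w ! k \<noteq> k" by auto
    show ?thesis
    proof (cases "\<exists>q<r. w ! q = k")
      case True
      then obtain q where q: "q < r" "w ! q = k" by auto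
      then have kq: "k \<noteq> q" using k by auto
      let ?v = "w[k := w ! q, q := w ! k]"
      have "card {l. l < r \<and> ?v ! l \<noteq> l} < card {k. k < r \<and> w ! k \<noteq> k}"
        using k q kq len by (intro psubset_card_mono) (auto simp: nth_list_update)
      moreover have v: "?v \<in> words n r" "\<And>l. l < r \<Longrightarrow> ?v ! l < n"
        using less.prems(1,2) k q len by (auto simp: words_iff nth_list_update)
      moreover have dv: "distinct ?v" using less.prems(3) k q len by (intro distinct_swap[THEN iffD2]) auto
      ultimately have kv: "kills ?v" by (intro less.hyps) auto
      have "kills (?v[k := ?v ! q, q := ?v ! k])"
        by (rule kills_swap[OF v(1) kv v(2) dv k(1) q(1) kq])
      also have "?v[k := ?v ! q, q := ?v ! k] = w"
        using k q kq len by (intro nth_equalityI) (auto simp: nth_list_update)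
      finally show ?thesis .
    next
      case False
      let ?v = "w[k := k]"
      have "card {l. l < r \<and> ?v ! l \<noteq> l} < card {k. k < r \<and> w ! k \<noteq> k}"
        using k len by (intro psubset_card_mono) (auto simp: nth_list_update)
      moreover have v: "?v \<in> words n r" "\<And>l. l < r \<Longrightarrow> ?v ! l < n"
        using less.prems(1,2) k len rn by (auto simp: words_iff nth_list_update)
      moreover have dv: "distinct ?v"
        using less.prems(3) False len by (intro distinct_list_update) (auto simp: in_set_conv_nth)
      ultimately have kv: "kills ?v" by (intro less.hyps) auto
      have "kills (?v[k := w ! k])"
      proof (rule kills_replace[OF v(1) kv v(2) k(1)])
        show "l = k" if "l < r" "?v ! l = ?v ! k" for l
          using that False k len by (auto simp: nth_list_update split: if_splits)
        show "w ! k < n" "w ! k \<noteq> ?v ! k" using less.prems(2) k len by auto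
      qed
      then show ?thesis by simp
    qed
  qed
qed

text \<open>Induction on the number of absent letters. In a word with a repetition, one copy is
  replaced by an absent letter \<open>j\<close>; as \<open>j\<close> then occurs once,
  \<open>kills_replace\<close> leads back.\<close>

lemma kills_low:
  assumes start: "kills [0..<r]" and rn: "r \<le> n"
    and "w \<in> words n r" "\<And>k. k < r \<Longrightarrow> w ! k < n"
  shows "kills w"
  using assms(3-)
proof (induction "n - card (set w)" arbitrary: w rule: less_induct)
  case less
  have len: "length w = r" using less.prems by (simp add: words_iff)
  have sub: "set w \<subseteq> {..<n}" using less.prems len by (auto simp: in_set_conv_nth)
  show ?case
  proof (cases "distinct w")
    case True
    then show ?thesis using kills_distinct[OF start rn] less.prems by blast
  next
    case False
    then obtain p q where pq: "p < r" "q < r" "p \<noteq> q" "w ! p = w ! q"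
      using len by (auto simp: distinct_conv_nth)
    \<comment> \<open>Here \<open>r \<le> n\<close> enters: a repetition leaves some letter below
      \<open>n\<close> absent.\<close>
    have "card (set w) < n"
      using False len rn card_length[of w] by (metis card_distinct le_neq_implies_less order_less_le_trans)
    then obtain j where j: "j < n" "j \<notin> set w"
      using sub by (metis card_lessThan lessThan_iff less_irrefl subsetI subset_antisym)
    let ?v = "w[p := j]"
    have sv: "set ?v = insert j (set w)"
    proof
      show "set ?v \<subseteq> insert j (set w)" by (rule set_update_subset_insert)
      have "w ! i \<in> set ?v" if "i < r" for i
      proof (cases "i = p")
        case True
        then have "?v ! q = w ! i" using pq by simp
        then show ?thesis using pq len by (metis length_list_update nth_mem)
      next
        case False
        then have "?v ! i = w ! i" by simp
        then show ?thesis using that len by (metis length_list_update nth_mem)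
      qed
      moreover have "j \<in> set ?v" using pq len by (simp add: set_update_memI)
      ultimately show "insert j (set w) \<subseteq> set ?v" using len by (auto simp: in_set_conv_nth)
    qed
    have v: "?v \<in> words n r" "\<And>l. l < r \<Longrightarrow> ?v ! l < n"
      using less.prems j len pq(1) by (auto simp: words_iff nth_list_update)
    have "n - card (set ?v) < n - card (set w)"
      using \<open>card (set w) < n\<close> j by (simp add: sv)
    then have kv: "kills ?v" using v by (intro less.hyps) auto
    have "kills (?v[p := w ! p])"
    proof (rule kills_replace[OF v(1) kv v(2) pq(1)])
      show "l = p" if "l < r" "?v ! l = ?v ! p" for l
        using that pq j len by (auto simp: nth_list_update split: if_splits)
      show "w ! p < n" using less.prems pq by auto
      show "w ! p \<noteq> ?v ! p" using pq j len by auto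
    qed
    then show ?thesis by simp
  qed
qed

text \<open>An absent basis vector \<open>j\<close> serves as a marker: with an even
  \<open>j\<close> at position \<open>k\<close>, the odd matrix unit acts only there and returns
  \<open>b\<close>.\<close>

lemma kills_missing:
  assumes b: "b \<in> words n r" and j: "j < n" "\<And>l. l < r \<Longrightarrow> base n (b ! l) \<noteq> j"
    and k: "k < r" "par n (b ! k) = 1" and "kills (b[k := j])"
  shows "kills b"
  unfolding kills_def
proof
  fix a
  have len: "length b = r" using b by (simp add: words_iff)
  let ?u = "b[k := j]" and ?i = "base n (b ! k)"
  have bk: "b ! k < 2 * n" using b k by (auto simp: words_iff)
  have i: "?i < n" "?i \<noteq> j" "n + ?i = b ! k"
    using base_less[OF bk] base_par[OF bk] j k by auto
  have "(\<Sum>l<r. if ?u ! l = j then (-1) ^ odds n ?u l * h a (?u[l := n + ?i]) else 0) = 0"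
    by (rule kills_odd) (use assms i in auto)
  also have "(\<Sum>l<r. if ?u ! l = j then (-1) ^ odds n ?u l * h a (?u[l := n + ?i]) else 0)
      = (\<Sum>l<r. if l = k then (-1) ^ odds n ?u l * h a b else 0)"
  proof (intro sum.cong refl)
    fix l assume "l \<in> {..<r}"
    moreover have "b ! l \<noteq> j" if "l < r" using j(2)[OF that] j(1) by (auto simp: base_def)
    ultimately show "(if ?u ! l = j then (-1) ^ odds n ?u l * h a (?u[l := n + ?i]) else 0)
      = (if l = k then (-1) ^ odds n ?u l * h a b else 0)"
      using i k len by (auto simp: nth_list_update)
  qed
  finally show "h a b = 0" using k by simp
qed

text \<open>The second term of the diagonal difference would need an even letter over the base of
  \<open>b ! q\<close>. The only letter over it is the one at \<open>q\<close>, which is odd and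
  annihilated by lower left blocks.\<close>

lemma kills_two_odd:
  assumes b: "b \<in> words n r" and inj: "inj_on (\<lambda>k. base n (b ! k)) {..<r}"
    and pq: "p < r" "q < r" "p \<noteq> q" "par n (b ! p) = 1" "par n (b ! q) = 1"
    and "kills (b[p := base n (b ! p)])"
  shows "kills b"
  unfolding kills_def
proof
  fix a
  have len: "length b = r" using b by (simp add: words_iff)
  let ?i = "base n (b ! p)" and ?j = "base n (b ! q)"
  let ?u = "b[p := ?i]"
  have bp: "b ! p < 2 * n" "b ! q < 2 * n" using b pq by (auto simp: words_iff)
  have i: "?i < n" "?j < n" "n + ?i = b ! p" "n + ?j = b ! q"
    using base_less base_par bp pq by metis+
  have ij: "?i \<noteq> ?j" using inj pq by (auto simp: inj_on_def)
  have "(\<Sum>l<r. if ?u ! l = ?i then (-1) ^ odds n ?u l * h a (?u[l := n + ?i])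
      else if ?u ! l = ?j then - ((-1) ^ odds n ?u l * h a (?u[l := n + ?j])) else 0) = 0"
    by (rule kills_odd_diag[OF i(1,2) ij _ assms(8)]) (use b i(1) in simp)
  also have "(\<Sum>l<r. if ?u ! l = ?i then (-1) ^ odds n ?u l * h a (?u[l := n + ?i])
      else if ?u ! l = ?j then - ((-1) ^ odds n ?u l * h a (?u[l := n + ?j])) else 0)
      = (\<Sum>l<r. if l = p then (-1) ^ odds n ?u l * h a b else 0)"
  proof (intro sum.cong refl)
    fix l assume l: "l \<in> {..<r}"
    have "b ! l \<noteq> ?i"
    proof
      assume eq: "b ! l = ?i"
      then have "base n (b ! l) = ?i" using i(1) by (simp add: base_def)
      then have "l = p" using inj l pq(1) by (auto simp: inj_on_def)
      then show False using eq i(1,3) by simp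
    qed
    moreover have "b ! l \<noteq> ?j"
    proof
      assume eq: "b ! l = ?j"
      then have "base n (b ! l) = ?j" using i(2) by (simp add: base_def)
      then have "l = q" using inj l pq(2) by (auto simp: inj_on_def)
      then show False using eq i(2,4) by simp
    qed
    ultimately show "(if ?u ! l = ?i then (-1) ^ odds n ?u l * h a (?u[l := n + ?i])
      else if ?u ! l = ?j then - ((-1) ^ odds n ?u l * h a (?u[l := n + ?j])) else 0)
      = (if l = p then (-1) ^ odds n ?u l * h a b else 0)"
      using i(3) ij pq(1) len by (cases "l = p") (simp_all only: nth_list_update_neq nth_list_update_eq
        if_True if_False simp_thms list_update_overwrite list_update_id)
  qed
  finally show "h a b = 0" using pq by simp
qed

lemma mult_of_h:
  "a \<in> words n r \<Longrightarrow> b \<in> words n r \<Longrightarrow> h a b \<noteq> 0 \<Longrightarrow> i < n \<Longrightarrow> mult_of n r a i = mult_of n r b i"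
  by (rule mult_of_preserved[OF even_comm])

lemma odds_h:
  "a \<in> words n r \<Longrightarrow> b \<in> words n r \<Longrightarrow> h a b \<noteq> 0 \<Longrightarrow> odds n a r = odds n b r"
  by (rule odds_preserved[OF even_comm]) auto

text \<open>The degree one words whose underlying word is a permutation are not reached from degree
  zero, so here the rows of h are used as well: h takes the same value on all such words with the
  same underlying word, hence this value is annihilated by every odd matrix unit.\<close>
lemma kills_one_odd:
  assumes n3: "3 \<le> n" and rn: "r = n" and b: "b \<in> words n r"
    and inj: "inj_on (\<lambda>k. base n (b ! k)) {..<r}"
    and k: "oddpos n r b = {k}" and kw: "kills (b[k := base n (b ! k)])"
  shows "kills b"
  unfolding kills_def
proof (rule allI, rule ccontr)
  fix a assume nz: "h a b \<noteq> 0"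
  then have a: "a \<in> words n r" using supp b by (auto simp: supported_def)
  have len: "length a = r" "length b = r" using a b by (auto simp: words_iff)
  have mb: "mult_of n r b i = 1" if "i < n" for i
  proof -
    have im: "(\<lambda>k. base n (b ! k)) ` {..<r} = {..<n}"
      using inj b rn by (intro card_subset_eq) (auto simp: card_image words_iff base_less)
    have "i \<in> (\<lambda>k. base n (b ! k)) ` {..<r}" unfolding im using that by simp
    then obtain l where l: "l < r" "base n (b ! l) = i" by blast
    have "mult_of n r b i = (\<Sum>k<r. if k = l then 1 else 0)"
      unfolding mult_of_def using inj l by (intro sum.cong) (auto simp: inj_on_def)
    then show ?thesis using l by simp
  qed
  then have ma: "mult_of n r a i = 1" if "i < n" for i
    using mult_of_h[OF a b nz that] that by simp
  have basea: "\<exists>!l. l < r \<and> base n (a ! l) = i" if iN: "i < n" for i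
  proof -
    have "mult_of n r a i = card {l. l < r \<and> base n (a ! l) = i}"
      by (simp add: mult_of_def sum.If_cases Collect_conj_eq lessThan_def)
    then have "card {l. l < r \<and> base n (a ! l) = i} = 1" using ma[OF iN] by simp
    then obtain l where "{l. l < r \<and> base n (a ! l) = i} = {l}" by (rule card_1_singletonE)
    then show ?thesis by (intro ex1I[of _ l]) auto
  qed
  have "card (oddpos n r a) = 1"
    using odds_h[OF a b nz] k by (simp add: odds_oddpos)
  then obtain t where t: "oddpos n r a = {t}" by (rule card_1_singletonE)
  then have "t \<in> oddpos n r a" by simp
  then have tr: "t < r" "par n (a ! t) = 1" by (auto simp: oddpos_def)
  \<comment> \<open>This choice is what requires \<open>3 \<le> n\<close>: two distinct indices that
    both avoid the odd letter of \<open>a\<close>.\<close>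
  obtain i j where ij: "i < n" "j < n" "i \<noteq> j" "i \<noteq> base n (a ! t)" "j \<noteq> base n (a ! t)"
  proof (cases "base n (a ! t) = 0")
    case True
    then show ?thesis using that[of 1 2] n3 by auto
  next
    case nz: False
    then show ?thesis using that[of 0 1] that[of 0 2] n3 by (cases "base n (a ! t) = 1") auto
  qed
  obtain p where p: "p < r" "base n (a ! p) = j" using basea[OF ij(2)] by blast
  have "p \<noteq> t" using p ij by auto
  then have "p \<notin> oddpos n r a" using t by auto
  then have ap: "a ! p = j" using p by (auto simp: oddpos_def base_def par_def split: if_splits)
  have kr: "k < r" "par n (b ! k) = 1" using k by (auto simp: oddpos_def)
  define w where "w = b[k := base n (b ! k)]"
  have bk: "b ! k < 2 * n" using b kr by (auto simp: words_iff)
  have basew: "base n (w ! l) = base n (b ! l)" if "l < r" for l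
    using base_less[OF bk] len kr by (cases "l = k") (auto simp: w_def base_def)
  have low: "w ! l < n" if "l < r" for l
  proof (cases "l = k")
    case True
    then show ?thesis using base_less[OF bk] len kr by (simp add: w_def)
  next
    case False
    then have "l \<notin> oddpos n r b" using k by auto
    then show ?thesis using False that by (auto simp: w_def oddpos_def par_def split: if_splits)
  qed
  have w: "w \<in> words n r" using b base_less[OF bk] by (simp add: w_def)
  have injw: "w ! l = w ! l' \<Longrightarrow> l = l'" if "l < r" "l' < r" for l l'
    using inj basew that by (metis (mono_tags, lifting) inj_on_def lessThan_iff)
  have lenw: "length w = r" by (simp add: w_def len)
  have sgn: "odds n w l = 0" if "l < r" for l
    using low that by (auto simp: par_def)
  obtain q where q: "q < r" "w ! q = j"
  proof -
    have im: "(\<lambda>k. w ! k) ` {..<r} = {..<n}"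
      using injw low rn by (intro card_subset_eq) (auto simp: card_image inj_on_def)
    have "j \<in> (\<lambda>k. w ! k) ` {..<r}" unfolding im using ij(2) by simp
    then show ?thesis using that by blast
  qed
  \<comment> \<open>The word of degree one over \<open>w\<close> whose odd letter lies over
    \<open>j\<close>. It contains no even \<open>j\<close>, so the odd matrix unit with column
    \<open>j\<close> annihilates it.\<close>
  define c where "c = w[q := n + j]"
  have c: "c \<in> words n r" using w ij by (simp add: c_def)
  have bw: "b = w[k := n + w ! k]"
    using base_par[OF bk kr(2)] len kr by (simp add: w_def)
  have hc: "h a c = h a b"
  proof (cases "q = k")
    case True
    then show ?thesis using q bw by (simp add: c_def)
  next
    case False
    then have wkj: "w ! k \<noteq> j" using injw q kr by auto
    have "(\<Sum>l<r. if w ! l = w ! k then (-1) ^ odds n w l * h a (w[l := n + w ! k])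
      else if w ! l = j then - ((-1) ^ odds n w l * h a (w[l := n + j])) else 0) = 0"
      by (rule kills_odd_diag) (use w kw low kr ij wkj in \<open>auto simp: w_def\<close>)
    also have "(\<Sum>l<r. if w ! l = w ! k then (-1) ^ odds n w l * h a (w[l := n + w ! k])
      else if w ! l = j then - ((-1) ^ odds n w l * h a (w[l := n + j])) else 0)
      = (\<Sum>l<r. (if l = k then h a b else 0) + (if l = q then - h a c else 0))"
    proof (intro sum.cong refl)
      fix l assume "l \<in> {..<r}"
      then have l: "l < r" by simp
      have "w ! l = w ! k \<longleftrightarrow> l = k" "w ! l = j \<longleftrightarrow> l = q"
        using injw[OF l kr(1)] injw[OF l q(1)] q(2) by auto
      then show "(if w ! l = w ! k then (-1) ^ odds n w l * h a (w[l := n + w ! k])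
      else if w ! l = j then - ((-1) ^ odds n w l * h a (w[l := n + j])) else 0)
      = (if l = k then h a b else 0) + (if l = q then - h a c else 0)"
        unfolding sgn[OF l] using False bw by (auto simp: c_def)
    qed
    also have "\<dots> = h a b - h a c" using kr q by (simp add: sum.distrib)
    finally show ?thesis by simp
  qed
  \<comment> \<open>Commutation with \<open>?C\<close> is compared in row \<open>?u\<close> and
    column \<open>c\<close>. On the column side everything vanishes; on the row side only position
    \<open>p\<close> carries \<open>n + i\<close>, and undoing it gives \<open>a\<close>, leaving a
    signed \<open>h a c\<close>.\<close>
  let ?C = "gmat n zmat (eunit i j) 0 0" and ?u = "a[p := n + i]"
  have u: "?u \<in> words n r" using a ij by simp
  have "mmul n r h (rho n r 1 ?C) ?u c = 0"
    unfolding rho_prho mmul_prho_right[OF c]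
  proof (intro sum.neutral ballI)
    fix l x assume "l \<in> {..<r}" "x \<in> {..<2*n}"
    then have l: "l < r" "x < 2 * n" by auto
    have "c ! l \<noteq> j" using injw[OF l(1) q(1)] q lenw ij l by (auto simp: c_def nth_list_update)
    moreover have "c ! l < 2 * n" using c l by (auto simp: words_iff)
    ultimately show "(-1) ^ (1 * odds n c l) * ?C x (c ! l) * h ?u (c[l := x]) = 0"
      using l ij by (simp add: gmat_eunit_odd)
  qed
  moreover have "mmul n r (rho n r 1 ?C) h ?u c = (-1) ^ odds n ?u p * h a c"
  proof -
    have "mmul n r (rho n r 1 ?C) h ?u c
      = (\<Sum>l<r. if l = p then (\<Sum>x<2*n. if x = j then (-1) ^ odds n ?u p * h a c else 0) else 0)"
      unfolding rho_prho mmul_prho_left[OF u]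
    proof (intro sum.cong[OF refl])
      fix l assume "l \<in> {..<r}"
      then have l: "l < r" by simp
      have ul: "?u ! l < 2 * n" using u l by (auto simp: words_iff)
      have iff: "?u ! l = n + i \<longleftrightarrow> l = p"
      proof
        assume e: "?u ! l = n + i"
        show "l = p"
        proof (rule ccontr)
          assume "l \<noteq> p"
          then have al: "a ! l = n + i" using e by simp
          then have "l \<in> oddpos n r a" using l by (simp add: oddpos_def par_def)
          then have "l = t" using t by simp
          then show False using al ij by (simp add: base_def)
        qed
      qed (use p len in simp)
      show "(\<Sum>x<2*n. (-1) ^ (1 * odds n ?u l) * ?C (?u ! l) x * h (?u[l := x]) c)
        = (if l = p then (\<Sum>x<2*n. if x = j then (-1) ^ odds n ?u p * h a c else 0) else 0)"
      proof (cases "l = p")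
        case True
        have "a[p := j] = a" using ap by (metis list_update_id)
        then have "(-1) ^ (1 * odds n ?u l) * ?C (?u ! l) x * h (?u[l := x]) c
            = (if x = j then (-1) ^ odds n ?u p * h a c else 0)" if "x < 2 * n" for x
          using True iff ul ij p len that by (simp add: gmat_eunit_odd)
        then show ?thesis unfolding if_P[OF True] by (intro sum.cong[OF refl]) simp
      next
        case False
        then have "?C (?u ! l) x = 0" if "x < 2 * n" for x
          using iff ul ij that by (simp add: gmat_eunit_odd)
        then show ?thesis using False by simp
      qed
    qed
    also have "\<dots> = (-1) ^ odds n ?u p * h a c" using p ij by simp
    finally show ?thesis .
  qed
  ultimately have "h a c = 0"
    using odd_comm[OF tr_eunit[OF ij(3)], of 0] by simp
  then show False using hc nz by simp
qed

text \<open>Induction on the degree: making an odd letter even gives a killed word, from which an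
  odd element should recover \<open>b\<close>. An off-diagonal unit does so if some basis vector is
  absent, a diagonal difference if there is a second odd letter; degree one is the remaining
  case.\<close>

lemma commuting_zero:
  assumes start: "kills [0..<r]" and rn: "r < n \<or> r = n \<and> 3 \<le> n"
  shows "h = 0"
proof -
  have "kills b" if "b \<in> words n r" for b
    using that
  proof (induction "odds n b r" arbitrary: b rule: less_induct)
    case less
    note b = less.prems
    have len: "length b = r" using b by (auto simp: words_iff)
    show ?case
    proof (cases "oddpos n r b = {}")
      case True
      then have "b ! k < n" if "k < r" for k
        using that by (auto simp: oddpos_def par_def split: if_splits)
      then show ?thesis using kills_low[OF start _ b] rn by auto
    next
      case False
      then obtain k where "k \<in> oddpos n r b" by blast
      then have k: "k < r" "par n (b ! k) = 1" by (auto simp: oddpos_def)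
      have IH: "kills (b[l := j])" if "l < r" "par n (b ! l) = 1" "j < n" for l j
      proof (rule less.hyps)
        have "odds n (b[l := j]) r + par n (b ! l) = odds n b r + par n j"
          using that len by (intro odds_update) auto
        then show "odds n (b[l := j]) r < odds n b r" using that by (simp add: par_def)
        show "b[l := j] \<in> words n r" using b that by simp
      qed
      show ?thesis
      proof (cases "\<exists>j<n. \<forall>l<r. base n (b ! l) \<noteq> j")
        case True
        then obtain j where "j < n" "\<forall>l<r. base n (b ! l) \<noteq> j" by blast
        then show ?thesis using kills_missing[OF b _ _ k] IH[OF k] by blast
      next
        case False
        \<comment> \<open>All of C^n occurs in a word of length at most \<open>n\<close>, so
          \<open>r = n\<close> and there is one letter over each basis vector.\<close>
        then have sub: "{..<n} \<subseteq> (\<lambda>l. base n (b ! l)) ` {..<r}" by blast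
        have "n \<le> card ((\<lambda>l. base n (b ! l)) ` {..<r})"
          using card_mono[OF _ sub] by simp
        moreover have "card ((\<lambda>l. base n (b ! l)) ` {..<r}) \<le> r"
          using card_image_le[of "{..<r}"] by simp
        ultimately have r: "r = n" "3 \<le> n" and "card ((\<lambda>l. base n (b ! l)) ` {..<r}) = card {..<r}"
          using rn by auto
        then have inj: "inj_on (\<lambda>l. base n (b ! l)) {..<r}"
          by (intro eq_card_imp_inj_on) auto
        have bk: "base n (b ! k) < n" using b k by (auto simp: words_iff base_less)
        show ?thesis
        proof (cases "oddpos n r b = {k}")
          case True
          then show ?thesis using kills_one_odd[OF r(2,1) b inj True] IH[OF k bk] by blast
        next
          case False
          then obtain q where "q \<in> oddpos n r b" "q \<noteq> k"
            using \<open>k \<in> oddpos n r b\<close> by blast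
          then show ?thesis
            using kills_two_odd[OF b inj k(1) _ _ k(2)] IH[OF k bk] by (auto simp: oddpos_def)
        qed
      qed
    qed
  qed
  then have "h a b = 0" for a b
    using supp by (cases "b \<in> words n r") (auto simp: kills_def supported_def)
  then show ?thesis by (intro ext) simp
qed

end

section \<open>The range r at most n\<close>

lemma wpar_eq_iff: "a \<in> words n r \<Longrightarrow> b \<in> words n r \<Longrightarrow> odds n a r = odds n b r \<Longrightarrow> wpar n a = wpar n b"
  by (simp add: wpar_odds)

lemma homg_0_iff: "homg n r 0 f \<longleftrightarrow> commuting n r f"
proof
  show "homg n r 0 f \<Longrightarrow> commuting n r f"
    unfolding homg_def by unfold_locales auto
next
  assume "commuting n r f"
  then interpret commuting n r f .
  have "wpar n a = (wpar n b + 0) mod 2" if nz: "f a b \<noteq> 0" for a b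
  proof -
    have ab: "a \<in> words n r" "b \<in> words n r" using nz supp by (auto simp: supported_def)
    have "wpar n a = wpar n b" by (rule wpar_eq_iff[OF ab odds_h[OF ab nz]])
    then show ?thesis by (simp add: wpar_def)
  qed
  then show "homg n r 0 f"
    unfolding homg_def using supp even_comm odd_comm by simp
qed

text \<open>The relation for even elements carries no sign even for odd \<open>f\<close>, so
  \<open>f\<close> preserves the degree.\<close>

lemma homg_1_zero:
  assumes f: "homg n r 1 f" shows "f = 0"
proof (intro ext, rule ccontr)
  fix a b assume "f a b \<noteq> (0::mat) a b"
  then have nz: "f a b \<noteq> 0" by simp
  then have ab: "a \<in> words n r" "b \<in> words n r"
    using f by (auto simp: homg_def supported_def)
  have "odds n a r = odds n b r"
    by (rule odds_preserved[where f = f, OF _ ab nz]) (use f in \<open>simp add: homg_def\<close>)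
  then have "wpar n a = wpar n b" by (rule wpar_eq_iff[OF ab])
  moreover have "wpar n a = (wpar n b + 1) mod 2" using f nz by (simp add: homg_def)
  ultimately show False by presburger
qed

lemma homg_1_0: "homg n r 1 0"
proof -
  have "(\<lambda>x y. (- 1) ^ 1 * (0::mat) x y) = 0" by (intro ext) simp
  then show ?thesis by (simp add: homg_def supported_def)
qed

lemma Endg_eq: "Endg n r = {f. commuting n r f}"
proof -
  have "Endg n r = {f0 + f1 | f0 f1. homg n r 0 f0 \<and> homg n r 1 f1}"
    by (simp add: Endg_def plus_fun_def)
  also have "\<dots> = {f. commuting n r f}"
  proof -
    have "homg n r 1 f1 \<longleftrightarrow> f1 = 0" for f1 using homg_1_zero homg_1_0 by blast
    then show ?thesis by (simp add: homg_0_iff)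
  qed
  finally show ?thesis .
qed

lemma phi_commuting: "commuting n r (phi n r c)"
  by unfold_locales (simp_all only: supported_phi phi_rho homog_gmat_0 homog_gmat_1)

lemma commuting_diff: "commuting n r f \<Longrightarrow> commuting n r g \<Longrightarrow> commuting n r (f - g)"
  by (simp add: commuting_def mmul_diff_left mmul_diff_right supported_def)

section \<open>Evaluation at the word \<open>[0..<r]\<close>\<close>

lemma map_inv_words:
  assumes "\<sigma> permutes {..<r}" "r \<le> 2 * n" shows "map (inv \<sigma>) [0..<r] \<in> words n r"
  using permutes_words[OF permutes_inv[OF assms(1)]] assms(2)
  by (auto simp: words_iff intro: order_less_le_trans)

lemma upt_words: "r \<le> 2 * n \<Longrightarrow> [0..<r] \<in> words n r"
  by (simp add: words_iff)

text \<open>For \<open>r \<le> n\<close> the letters of \<open>[0..<r]\<close> are distinct and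
  even: no signs arise and different permutations yield different words, so coefficients can be read
  off from this column.\<close>

lemma phi_upt:
  assumes rn: "r \<le> n" and \<sigma>: "\<sigma> permutes {..<r}"
  shows "phi n r c (map (inv \<sigma>) [0..<r]) [0..<r] = c \<sigma>"
proof -
  let ?a = "map (inv \<sigma>) [0..<r]"
  have "oddpos n r [0..<r] = {}" using rn by (auto simp: oddpos_def par_def)
  then have e: "eps \<tau> (oddpos n r [0..<r]) = 1" for \<tau> by (simp add: eps_def)
  have "permact n r \<tau> ?a [0..<r] = (if \<tau> = \<sigma> then 1 else 0)" if \<tau>: "\<tau> permutes {..<r}" for \<tau>
  proof -
    have "(\<forall>i<r. ?a ! \<tau> i = [0..<r] ! i) \<longleftrightarrow> (\<forall>i<r. \<tau> i = \<sigma> i)"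
      using permutes_words[OF \<tau>] by (auto simp: permutes_inv_eq[OF \<sigma>])
    also have "\<dots> \<longleftrightarrow> \<tau> = \<sigma>"
      using permutes_not_in[OF \<tau>] permutes_not_in[OF \<sigma>]
      by (metis ext lessThan_iff)
    finally show ?thesis
      using map_inv_words[OF \<sigma>] upt_words rn by (simp add: permact_eps e)
  qed
  then have "phi n r c ?a [0..<r] = (\<Sum>\<tau>\<in>{\<tau>. \<tau> permutes {..<r}}. if \<tau> = \<sigma> then c \<tau> else 0)"
    unfolding phi_def by (intro sum.cong) auto
  then show ?thesis using \<sigma> by (simp add: finite_permutations)
qed

lemma (in commuting) row_of_upt:
  assumes rn: "r \<le> n" and nz: "h a [0..<r] \<noteq> 0"
  shows "\<exists>\<sigma>. \<sigma> permutes {..<r} \<and> a = map (inv \<sigma>) [0..<r]"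
proof -
  have v: "[0..<r] \<in> words n r" using rn by (intro upt_words) simp
  have a: "a \<in> words n r" using supp nz by (auto simp: supported_def)
  have len: "length a = r" using a by (simp add: words_iff)
  have "odds n [0..<r] r = 0" using rn by (auto simp: par_def)
  then have "odds n a r = 0" using odds_h[OF a v nz] by simp
  then have low: "a ! k < n" if "k < r" for k using that by (auto simp: par_def split: if_splits)
  have "mult_of n r a i = (if i < r then 1 else 0)" if "i < n" for i
  proof -
    have "mult_of n r [0..<r] i = (\<Sum>k<r. if k = i then 1 else 0)"
      unfolding mult_of_def using rn by (intro sum.cong) (auto simp: base_def)
    then show ?thesis using mult_of_h[OF a v nz that] by simp
  qed
  then have m: "(\<Sum>k<r. if a ! k = i then 1 else 0) = (if i < r then 1 else (0::nat))" if "i < n" for i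
    using that low by (simp add: mult_of_def base_def)
  have lt: "a ! k < r" if "k < r" for k
    using m[OF low[OF that]] that by (auto split: if_splits)
  have "\<exists>k<r. a ! k = i" if "i < r" for i
  proof (rule ccontr)
    assume "\<not> (\<exists>k<r. a ! k = i)"
    then have "(\<Sum>k<r. if a ! k = i then 1 else 0) = (0::nat)" by (intro sum.neutral) auto
    then show False using m[of i] that rn by simp
  qed
  then have im: "(!) a ` {..<r} = {..<r}" using lt by (auto simp: image_iff)
  then have "inj_on ((!) a) {..<r}" by (intro eq_card_imp_inj_on) auto
  then have "bij_betw ((!) a) {..<r} {..<r}" using im by (simp add: bij_betw_def)
  \<comment> \<open>The word is read as a map on positions and extended by the identity, as
    \<open>permutes\<close> demands outside its set.\<close>
  then have "bij_betw (\<lambda>i. if i < r then a ! i else i) {..<r} {..<r}"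
    by (rule bij_betw_cong[THEN iffD1, rotated]) simp
  then have \<tau>: "(\<lambda>i. if i < r then a ! i else i) permutes {..<r}" (is "?\<tau> permutes _")
    by (rule bij_imp_permutes) simp
  have "a = map (inv (inv ?\<tau>)) [0..<r]"
    unfolding permutes_inv_inv[OF \<tau>] using len by (intro nth_equalityI) auto
  then show ?thesis using permutes_inv[OF \<tau>] by blast
qed

lemma phi_bij:
  assumes rn: "r < n \<or> r = n \<and> 3 \<le> n"
  shows "bij_betw (phi n r) (CS r) (Endg n r)"
  unfolding bij_betw_def
proof
  have rn': "r \<le> n" using rn by auto
  show "inj_on (phi n r) (CS r)"
  proof (rule inj_onI)
    fix c d assume cd: "c \<in> CS r" "d \<in> CS r" "phi n r c = phi n r d"
    show "c = d"
    proof
      fix \<sigma> show "c \<sigma> = d \<sigma>"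
        using phi_upt[OF rn', of \<sigma> c] phi_upt[OF rn', of \<sigma> d] cd
        by (cases "\<sigma> permutes {..<r}") (auto simp: CS_def)
    qed
  qed
  show "phi n r ` CS r = Endg n r"
  proof
    show "phi n r ` CS r \<subseteq> Endg n r" by (auto simp: Endg_eq phi_commuting)
    show "Endg n r \<subseteq> phi n r ` CS r"
    proof
      fix f assume "f \<in> Endg n r"
      then have f: "commuting n r f" by (simp add: Endg_eq)
      define c where "c = (\<lambda>\<sigma>. if \<sigma> permutes {..<r} then f (map (inv \<sigma>) [0..<r]) [0..<r] else 0)"
      interpret h: commuting n r "f - phi n r c" by (intro commuting_diff f phi_commuting)
      have "h.kills [0..<r]"
        unfolding h.kills_def
      proof (rule allI, rule ccontr)
        fix a assume nz: "(f - phi n r c) a [0..<r] \<noteq> 0"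
        then obtain \<sigma> where "\<sigma> permutes {..<r}" "a = map (inv \<sigma>) [0..<r]"
          using h.row_of_upt[OF rn'] by blast
        then show False using nz phi_upt[OF rn', of \<sigma> c] by (simp add: c_def)
      qed
      then have "f = phi n r c" using h.commuting_zero[OF _ rn] by simp
      moreover have "c \<in> CS r" by (simp add: c_def CS_def)
      ultimately show "f \<in> phi n r ` CS r" by blast
    qed
  qed
qed

text \<open>An sl(2)-invariant vector and an sl(2)-invariant covector on the second tensor power, both of degree
  one and annihilated by all odd elements; their product is the additional endomorphism.\<close>
definition vec22 :: "nat list \<Rightarrow> complex" where
  "vec22 a = (if a = [2,1] \<or> a = [1,2] then 1 else if a = [0,3] \<or> a = [3,0] then -1 else 0)"

definition covec22 :: "nat list \<Rightarrow> complex" where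
  "covec22 b = (if b = [2,1] \<or> b = [0,3] then 1 else if b = [1,2] \<or> b = [3,0] then -1 else 0)"

lemma words22_cases:
  assumes "b \<in> words 2 2"
  obtains y z where "b = [y, z]" "y \<in> {0,1,2,3}" "z \<in> {0,1,2,3}"
proof -
  obtain y z where b: "b = [y, z]" using assms by (auto simp: words_def length_Suc_conv numeral_2_eq_2)
  have "y < 4" "z < 4" using assms b by (auto simp: words_def)
  moreover have "x \<in> {0,1,2,3}" if "x < 4" for x :: nat using that by auto
  ultimately show ?thesis using that[OF b] by blast
qed

lemma sum_less_2: "(\<Sum>k<2. g k) = g 0 + g (1::nat)"
  by (simp add: numeral_2_eq_2)

lemma sum_less_4: "(\<Sum>k<2*2. g k) = g 0 + g 1 + g 2 + g (3::nat)"
  by (simp add: numeral_eq_Suc)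

lemma vec22_even:
  assumes "tr 2 A = 0" "a \<in> words 2 2"
  shows "mmul 2 2 (rho 2 2 0 (gmat 2 A zmat 0 d)) (\<lambda>u _. vec22 u) a b = d * vec22 a"
proof -
  have A: "A (Suc 0) (Suc 0) = - A 0 0"
    using assms(1) by (simp add: tr_def numeral_2_eq_2 lessThan_Suc eq_neg_iff_add_eq_0)
  from assms(2) show ?thesis
    unfolding rho_prho mmul_prho_left[OF assms(2)] sum_less_2 sum_less_4
    by (cases rule: words22_cases) (auto simp: vec22_def gmat_def zmat_def A)
qed

lemma covec22_even:
  assumes "tr 2 A = 0" "b \<in> words 2 2"
  shows "mmul 2 2 (\<lambda>_. covec22) (rho 2 2 0 (gmat 2 A zmat 0 d)) a b = d * covec22 b"
proof -
  have A: "A (Suc 0) (Suc 0) = - A 0 0"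
    using assms(1) by (simp add: tr_def numeral_2_eq_2 lessThan_Suc eq_neg_iff_add_eq_0)
  from assms(2) show ?thesis
    unfolding rho_prho mmul_prho_right[OF assms(2)] sum_less_2 sum_less_4
    by (cases rule: words22_cases) (auto simp: covec22_def gmat_def zmat_def A)
qed

lemma vec22_odd:
  assumes "tr 2 C = 0" "a \<in> words 2 2"
  shows "mmul 2 2 (rho 2 2 1 (gmat 2 zmat C c 0)) (\<lambda>u _. vec22 u) a b = 0"
proof -
  have A: "C (Suc 0) (Suc 0) = - C 0 0"
    using assms(1) by (simp add: tr_def numeral_2_eq_2 lessThan_Suc eq_neg_iff_add_eq_0)
  from assms(2) show ?thesis
    unfolding rho_prho mmul_prho_left[OF assms(2)] sum_less_2 sum_less_4
    by (cases rule: words22_cases) (auto simp: vec22_def gmat_def zmat_def A par_def)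
qed

lemma covec22_odd:
  assumes "tr 2 C = 0" "b \<in> words 2 2"
  shows "mmul 2 2 (\<lambda>_. covec22) (rho 2 2 1 (gmat 2 zmat C c 0)) a b = 0"
proof -
  have A: "C (Suc 0) (Suc 0) = - C 0 0"
    using assms(1) by (simp add: tr_def numeral_2_eq_2 lessThan_Suc eq_neg_iff_add_eq_0)
  from assms(2) show ?thesis
    unfolding rho_prho mmul_prho_right[OF assms(2)] sum_less_2 sum_less_4
    by (cases rule: words22_cases) (auto simp: covec22_def gmat_def zmat_def A par_def)
qed

definition extra22 :: mat where
  "extra22 = (\<lambda>a b. vec22 a * covec22 b)"

text \<open>An operator of rank one commutes with \<open>g\<close> once its vector and its covector
  have the same eigenvalues: both have \<open>d\<close> under even elements, by being of degree one,
  and zero under odd ones.\<close>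

lemma commuting_extra22: "commuting 2 2 extra22"
proof -
  have supp: "supported 2 2 extra22"
    by (auto simp: supported_def extra22_def vec22_def covec22_def words_def)
  have L: "mmul 2 2 R extra22 a b = mmul 2 2 R (\<lambda>u _. vec22 u) a b * covec22 b"
    and R: "mmul 2 2 extra22 R a b = vec22 a * mmul 2 2 (\<lambda>_. covec22) R a b" for R a b
    by (simp_all add: mmul_def extra22_def sum_distrib_left sum_distrib_right mult.assoc)
  show ?thesis
  proof (unfold_locales, rule supp)
    fix A d assume "tr 2 A = 0"
    then show "mmul 2 2 extra22 (rho 2 2 0 (gmat 2 A zmat 0 d)) = mmul 2 2 (rho 2 2 0 (gmat 2 A zmat 0 d)) extra22"
      by (intro supported_eqI[of 2 2] supported_mmul supp)
        (simp_all add: L R vec22_even covec22_even supported_rho)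
  next
    fix C c assume "tr 2 C = 0"
    then show "mmul 2 2 extra22 (rho 2 2 1 (gmat 2 zmat C c 0)) = mmul 2 2 (rho 2 2 1 (gmat 2 zmat C c 0)) extra22"
      by (intro supported_eqI[of 2 2] supported_mmul supp)
        (simp_all add: L R vec22_odd[simplified] covec22_odd[simplified] supported_rho)
  qed
qed

text \<open>The column of \<open>[0,1]\<close> in \<open>extra22\<close> vanishes, its degree being
  zero. This column determines all coefficients of a preimage, so the preimage would be
  zero.\<close>

lemma not_surjective_22: "\<not> Endg 2 2 \<subseteq> phi 2 2 ` CS 2"
proof
  assume "Endg 2 2 \<subseteq> phi 2 2 ` CS 2"
  then obtain c where c: "c \<in> CS 2" "extra22 = phi 2 2 c"
    using commuting_extra22 by (auto simp: Endg_eq)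
  have "c \<sigma> = 0" for \<sigma>
  proof (cases "\<sigma> permutes {..<2}")
    case True
    have "phi 2 2 c (map (inv \<sigma>) [0..<2]) [0..<2] = c \<sigma>"
      by (rule phi_upt[OF order_refl True])
    then have "c \<sigma> = extra22 (map (inv \<sigma>) [0..<2]) [0..<2]" by (simp add: c(2))
    then show ?thesis by (simp add: extra22_def covec22_def upt_rec)
  qed (use c in \<open>auto simp: CS_def\<close>)
  then have "extra22 [2,1] [2,1] = 0" by (simp add: c phi_def)
  then show False by (simp add: extra22_def vec22_def covec22_def)
qed

section \<open>Parity reversal\<close>

definition flip :: "nat \<Rightarrow> nat \<Rightarrow> nat" where
  "flip n x = (if x < n then x + n else x - n)"

lemma flip_less: "x < 2 * n \<Longrightarrow> flip n x < 2 * n"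
  by (auto simp: flip_def)

lemma flip_flip [simp]: "x < 2 * n \<Longrightarrow> flip n (flip n x) = x"
  by (auto simp: flip_def)

lemma par_flip: "x < 2 * n \<Longrightarrow> par n (flip n x) = 1 - par n x"
  by (auto simp: flip_def par_def)

definition flipw :: "nat \<Rightarrow> nat \<Rightarrow> nat list \<Rightarrow> nat list" where
  "flipw n m w = map (\<lambda>k. if k < m then flip n (w ! k) else w ! k) [0..<length w]"

text \<open>For odd \<open>m\<close> this is the Koszul sign of the \<open>m\<close>-fold tensor
  power of an odd map: the letter at \<open>k\<close> is passed by \<open>m - 1 - k\<close> of its
  factors, a number of the same parity as \<open>k\<close>.\<close>

definition flipsign :: "nat \<Rightarrow> nat \<Rightarrow> nat list \<Rightarrow> complex" where
  "flipsign n m w = (-1) ^ (\<Sum>k<m. k * par n (w ! k))"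

text \<open>Parity reversal on the first m tensor factors. The sign makes it supercommute with odd
  elements up to conjugation by flip.\<close>
definition flipmat :: "nat \<Rightarrow> nat \<Rightarrow> nat \<Rightarrow> mat" where
  "flipmat n r m = (\<lambda>a b. if b \<in> words n r \<and> a = flipw n m b then flipsign n m b else 0)"

definition projmat :: "nat \<Rightarrow> nat \<Rightarrow> nat \<Rightarrow> nat \<Rightarrow> mat" where
  "projmat n r m j = (\<lambda>a b. if b \<in> words n r \<and> a = b \<and> odds n b m = j then 1 else 0)"

text \<open>The family to the left of the reversal after exchanging the two, for odd
  \<open>m\<close>. Inside the block it is conjugated by \<open>flip\<close>, and passing the other
  \<open>m - 1\<close> reversals costs no sign; beyond the block all \<open>m\<close> of them are
  passed.\<close>

definition flipY :: "nat \<Rightarrow> nat \<Rightarrow> nat \<Rightarrow> (nat \<Rightarrow> nat \<Rightarrow> nat \<Rightarrow> complex) \<Rightarrow> nat \<Rightarrow> nat \<Rightarrow> nat \<Rightarrow> complex" where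
  "flipY n m q Y = (\<lambda>k x y. if k < m then Y k (flip n x) (flip n y) else (-1) ^ q * Y k x y)"

lemma length_flipw [simp]: "length (flipw n m w) = length w"
  by (simp add: flipw_def)

lemma nth_flipw: "k < length w \<Longrightarrow> flipw n m w ! k = (if k < m then flip n (w ! k) else w ! k)"
  by (simp add: flipw_def)

lemma flipw_words: "w \<in> words n r \<Longrightarrow> flipw n m w \<in> words n r"
  by (auto simp: words_iff nth_flipw flip_less)

lemma flipw_flipw: "w \<in> words n r \<Longrightarrow> flipw n m (flipw n m w) = w"
  by (auto simp: words_iff nth_flipw intro: nth_equalityI)

lemma flipw_eq_iff: "a \<in> words n r \<Longrightarrow> b \<in> words n r \<Longrightarrow> a = flipw n m b \<longleftrightarrow> flipw n m a = b"
  using flipw_flipw by metis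

lemma mmul_flipmat_right:
  "mmul n r M (flipmat n r m) a b = (if b \<in> words n r then M a (flipw n m b) * flipsign n m b else 0)"
proof -
  have "mmul n r M (flipmat n r m) a b
      = (\<Sum>u\<in>words n r. if u = flipw n m b then (if b \<in> words n r then M a u * flipsign n m b else 0) else 0)"
    unfolding mmul_def flipmat_def by (intro sum.cong) auto
  then show ?thesis using flipw_words by (auto simp: sum.delta)
qed

lemma mmul_flipmat_left:
  assumes "a \<in> words n r"
  shows "mmul n r (flipmat n r m) M a b = flipsign n m (flipw n m a) * M (flipw n m a) b"
proof -
  have "mmul n r (flipmat n r m) M a b
      = (\<Sum>u\<in>words n r. if u = flipw n m a then flipsign n m u * M u b else 0)"
    unfolding mmul_def flipmat_def using flipw_eq_iff[OF assms] by (intro sum.cong) auto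
  then show ?thesis using flipw_words[OF assms] by (auto simp: sum.delta)
qed

lemma mmul_projmat_right:
  "mmul n r M (projmat n r m j) a b = (if b \<in> words n r \<and> odds n b m = j then M a b else 0)"
proof -
  have "mmul n r M (projmat n r m j) a b
      = (\<Sum>u\<in>words n r. if u = b then (if b \<in> words n r \<and> odds n b m = j then M a u else 0) else 0)"
    unfolding mmul_def projmat_def by (intro sum.cong) auto
  then show ?thesis by (auto simp: sum.delta)
qed

lemma mmul_projmat_left:
  "mmul n r (projmat n r m j) M a b = (if a \<in> words n r \<and> odds n a m = j then M a b else 0)"
proof -
  have "mmul n r (projmat n r m j) M a b
      = (\<Sum>u\<in>words n r. if u = a then (if odds n a m = j then M u b else 0) else 0)"
    unfolding mmul_def projmat_def by (intro sum.cong) auto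
  then show ?thesis by (auto simp: sum.delta)
qed

lemma supported_flipmat: "supported n r (flipmat n r m)"
  using flipw_words by (auto simp: supported_def flipmat_def)

lemma supported_projmat: "supported n r (projmat n r m j)"
  by (auto simp: supported_def projmat_def)

lemma odds_flipw:
  assumes "w \<in> words n r" "k \<le> m" "m \<le> r"
  shows "odds n (flipw n m w) k + odds n w k = k"
proof -
  have "odds n (flipw n m w) k + odds n w k = (\<Sum>l<k. 1)"
    unfolding sum.distrib[symmetric] using assms
    by (intro sum.cong refl) (auto simp: nth_flipw words_iff par_flip par_le_1[simplified])
  then show ?thesis by simp
qed

lemma odds_flipw_high:
  assumes "w \<in> words n r" "m \<le> k" "k \<le> r"
  shows "odds n (flipw n m w) k + 2 * odds n w m = m + odds n w k"
proof -
  have split: "odds n v k = odds n v m + (\<Sum>l\<in>{m..<k}. par n (v ! l))" for v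
    using assms by (simp add: lessThan_atLeast0 sum.atLeastLessThan_concat)
  have "(\<Sum>l\<in>{m..<k}. par n (flipw n m w ! l)) = (\<Sum>l\<in>{m..<k}. par n (w ! l))"
    using assms by (intro sum.cong) (auto simp: nth_flipw words_iff)
  moreover have "odds n (flipw n m w) m + odds n w m = m"
    by (rule odds_flipw[OF assms(1) order_refl]) (use assms in auto)
  ultimately show ?thesis unfolding split by simp
qed

lemma odds_cong_off:
  assumes "\<And>l. l < m \<Longrightarrow> l \<noteq> k \<Longrightarrow> c ! l = b ! l" "k < m"
  shows "(\<Sum>l<m. g l * par n (c ! l)) + g k * par n (b ! k) = (\<Sum>l<m. g l * par n (b ! l)) + g k * par n (c ! k)"
proof -
  have "(\<Sum>l<m. g l * par n (v ! l)) = g k * par n (v ! k) + (\<Sum>l\<in>{..<m} - {k}. g l * par n (v ! l))" for v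
    using assms(2) by (intro sum.remove) auto
  moreover have "(\<Sum>l\<in>{..<m} - {k}. g l * par n (c ! l)) = (\<Sum>l\<in>{..<m} - {k}. g l * par n (b ! l))"
    using assms(1) by (intro sum.cong) auto
  ultimately show ?thesis by simp
qed

lemma minus_one_power_cong: "(even i \<longleftrightarrow> even j) \<Longrightarrow> (-1::complex) ^ i = (-1) ^ j"
  by (simp add: minus_one_power_iff)

text \<open>For odd \<open>q\<close>, changing the parity at \<open>k\<close> inside the block
  changes the exponent of \<open>flipsign\<close> by \<open>k\<close> modulo 2. The odd letters left
  of \<open>k\<close> before and after reversal also add up to \<open>k\<close>, so the signs agree.
  Beyond the block the count changes by \<open>m\<close> modulo 2.\<close>

lemma flipmat_prho:
  assumes Y: "homog n q Y" and m: "m \<le> r" "odd m"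
  shows "mmul n r (flipmat n r m) (prho n r q Y) = mmul n r (prho n r q (flipY n m q Y)) (flipmat n r m)"
proof (rule supported_eqI[of n r])
  fix a b assume a: "a \<in> words n r" and b: "b \<in> words n r"
  define c where "c = flipw n m a"
  have c: "c \<in> words n r" and fb: "flipw n m b \<in> words n r" using a b flipw_words by (auto simp: c_def)
  have len: "length a = r" "length b = r" "length c = r" using a b c by (auto simp: words_iff)
  have lt: "a ! k < 2 * n" "b ! k < 2 * n" "c ! k < 2 * n" if "k < r" for k
    using a b c that by (auto simp: words_iff)
  have ag: "a ! l = flipw n m b ! l \<longleftrightarrow> c ! l = b ! l" if "l < r" for l
    using lt[OF that] that len by (auto simp: c_def nth_flipw) (metis flip_flip)+
  have summand: "flipsign n m c * ((-1) ^ (q * odds n b k) * Y k (c ! k) (b ! k))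
      = (-1) ^ (q * odds n (flipw n m b) k) * flipY n m q Y k (a ! k) (flipw n m b ! k) * flipsign n m b"
    if k: "k < r" and off: "\<forall>l<r. l \<noteq> k \<longrightarrow> c ! l = b ! l" for k
  proof -
    have YY: "flipY n m q Y k (a ! k) (flipw n m b ! k) = (if k < m then 1 else (-1) ^ q) * Y k (c ! k) (b ! k)"
      using k len lt[OF k] by (auto simp: flipY_def nth_flipw c_def)
    show ?thesis
    proof (cases "Y k (c ! k) (b ! k) = 0")
      case True
      then show ?thesis by (simp add: YY)
    next
      case nz: False
      have "flipsign n m c * (-1) ^ (q * odds n b k)
          = (-1) ^ (q * odds n (flipw n m b) k) * (if k < m then 1 else (-1) ^ q) * flipsign n m b"
      proof (cases "k < m")
        case True
        have s: "(\<Sum>l<m. l * par n (c ! l)) + k * par n (b ! k) = (\<Sum>l<m. l * par n (b ! l)) + k * par n (c ! k)"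
          using off True m by (intro odds_cong_off) auto
        have o: "odds n (flipw n m b) k + odds n b k = k"
          by (rule odds_flipw[OF b _ m(1)]) (use True in auto)
        show ?thesis
        proof (cases "q = 0")
          case q: True
          then have "par n (c ! k) = par n (b ! k)" using Y nz by (auto simp: homog_0)
          then show ?thesis using q True s by (simp add: flipsign_def)
        next
          case False
          then have q: "q = 1" using Y by (simp add: homog_def)
          then have "par n (c ! k) = 1 - par n (b ! k)" using Y nz unfolding q homog_1 by blast
          then have "k * par n (c ! k) + k * par n (b ! k) = k"
            using par_le_1[of n "b ! k"] by (simp flip: distrib_left)
          then have "even ((\<Sum>l<m. l * par n (c ! l)) + odds n b k)
              \<longleftrightarrow> even (odds n (flipw n m b) k + (\<Sum>l<m. l * par n (b ! l)))"
            using s o by presburger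
          then have "(-1::complex) ^ ((\<Sum>l<m. l * par n (c ! l)) + odds n b k)
              = (-1) ^ (odds n (flipw n m b) k + (\<Sum>l<m. l * par n (b ! l)))"
            by (rule minus_one_power_cong)
          then show ?thesis
            unfolding flipsign_def q power_add mult_1 if_P[OF True] by simp
        qed
      next
        case False
        have s: "(\<Sum>l<m. l * par n (c ! l)) = (\<Sum>l<m. l * par n (b ! l))"
          using off False m by (intro sum.cong) auto
        have "odds n (flipw n m b) k + 2 * odds n b m = m + odds n b k"
          by (rule odds_flipw_high[OF b]) (use False k in auto)
        then have "even (odds n b k) \<longleftrightarrow> even (odds n (flipw n m b) k + 1)"
          using m(2) by presburger
        then have "(-1::complex) ^ (q * odds n b k) = (-1) ^ (q * (odds n (flipw n m b) k + 1))"
          by (intro minus_one_power_cong) auto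
        then show ?thesis using False s by (simp add: flipsign_def distrib_left power_add mult_ac)
      qed
      then show ?thesis unfolding YY by (simp add: mult_ac)
    qed
  qed
  have "mmul n r (flipmat n r m) (prho n r q Y) a b = flipsign n m c * prho n r q Y c b"
    unfolding mmul_flipmat_left[OF a] c_def ..
  also have "\<dots> = (\<Sum>k<r. if (\<forall>l<r. l \<noteq> k \<longrightarrow> c ! l = b ! l)
      then flipsign n m c * ((-1) ^ (q * odds n b k) * Y k (c ! k) (b ! k)) else 0)"
    using b c by (auto simp: prho_def sum_distrib_left intro!: sum.cong)
  also have "\<dots> = (\<Sum>k<r. if (\<forall>l<r. l \<noteq> k \<longrightarrow> a ! l = flipw n m b ! l)
      then (-1) ^ (q * odds n (flipw n m b) k) * flipY n m q Y k (a ! k) (flipw n m b ! k) * flipsign n m b else 0)"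
    by (intro sum.cong refl if_cong summand) (auto simp: ag)
  also have "\<dots> = prho n r q (flipY n m q Y) a (flipw n m b) * flipsign n m b"
    using a fb by (auto simp: prho_def sum_distrib_right intro!: sum.cong)
  also have "\<dots> = mmul n r (prho n r q (flipY n m q Y)) (flipmat n r m) a b"
    unfolding mmul_flipmat_right using b by simp
  finally show "mmul n r (flipmat n r m) (prho n r q Y) a b
      = mmul n r (prho n r q (flipY n m q Y)) (flipmat n r m) a b" .
qed (intro supported_mmul supported_flipmat supported_prho)+

text \<open>Each term changes a single letter, so the shift of the block degree can be tested on
  nonzero entries of \<open>Y\<close>. If \<open>i\<close> and \<open>j\<close> differ, the
  condition confines \<open>Y\<close> to the block.\<close>

lemma projmat_prho:
  assumes "m \<le> r" "\<And>k x y. k < r \<Longrightarrow> Y k x y \<noteq> 0 \<Longrightarrow>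
    (if k < m then par n x + j = par n y + i else i = j)"
  shows "mmul n r (projmat n r m i) (prho n r q Y) = mmul n r (prho n r q Y) (projmat n r m j)"
proof (rule supported_eqI[of n r])
  fix a b assume a: "a \<in> words n r" and b: "b \<in> words n r"
  have "odds n a m = i \<longleftrightarrow> odds n b m = j" if nz: "prho n r q Y a b \<noteq> 0"
  proof -
    obtain k where k: "k < r" "\<forall>l<r. l \<noteq> k \<longrightarrow> a ! l = b ! l" "Y k (a ! k) (b ! k) \<noteq> 0"
      using nz a b by (auto simp: prho_def elim!: sum.not_neutral_contains_not_neutral split: if_splits)
    show ?thesis
    proof (cases "k < m")
      case True
      have "(\<Sum>l<m. 1 * par n (a ! l)) + 1 * par n (b ! k) = (\<Sum>l<m. 1 * par n (b ! l)) + 1 * par n (a ! k)"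
        using k assms(1) True by (intro odds_cong_off) auto
      then show ?thesis using assms(2)[OF k(1,3)] True by auto
    next
      case False
      then have "odds n a m = odds n b m" using k assms(1) by (intro sum.cong) auto
      then show ?thesis using assms(2)[OF k(1,3)] False by auto
    qed
  qed
  then show "mmul n r (projmat n r m i) (prho n r q Y) a b = mmul n r (prho n r q Y) (projmat n r m j) a b"
    using a b by (auto simp: mmul_projmat_left mmul_projmat_right)
qed (intro supported_mmul supported_projmat supported_prho)+

section \<open>An endomorphism outside the group algebra\<close>

definition lowY :: "nat \<Rightarrow> (nat \<Rightarrow> nat \<Rightarrow> complex) \<Rightarrow> nat \<Rightarrow> nat \<Rightarrow> nat \<Rightarrow> complex" where
  "lowY m X = (\<lambda>k. if k < m then X else (\<lambda>_ _. 0))"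

definition highY :: "nat \<Rightarrow> (nat \<Rightarrow> nat \<Rightarrow> complex) \<Rightarrow> nat \<Rightarrow> nat \<Rightarrow> nat \<Rightarrow> complex" where
  "highY m X = (\<lambda>k. if k < m then (\<lambda>_ _. 0) else X)"

text \<open>The lower left block \<open>C\<close> conjugated by parity reversal. In general it lies
  outside \<open>g\<close>, but it still commutes with permutations.\<close>

definition upmat :: "nat \<Rightarrow> (nat \<Rightarrow> nat \<Rightarrow> complex) \<Rightarrow> nat \<Rightarrow> nat \<Rightarrow> complex" where
  "upmat n C = (\<lambda>x y. if x < n \<and> n \<le> y \<and> y < 2 * n then C x (y - n) else 0)"

lemma rho_split_low_high:
  "rho n r q X = prho n r q (lowY m X) + prho n r q (highY m X)"
  unfolding rho_prho prho_add[symmetric]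
  by (intro arg_cong[where f = "prho n r q"] ext) (auto simp: lowY_def highY_def)

lemma blocksym_prho:
  assumes "homog n q Y" "\<And>\<sigma> k. \<sigma> permutes {..<m} \<Longrightarrow> Y (\<sigma> k) = Y k"
  shows "mmul n r (blocksym n r m) (prho n r q Y) = mmul n r (prho n r q Y) (blocksym n r m)"
  unfolding blocksym_def by (rule phi_prho) (use assms in \<open>auto split: if_splits\<close>)

lemma permutes_lt_iff: "\<sigma> permutes {..<m} \<Longrightarrow> \<sigma> k < m \<longleftrightarrow> k < (m::nat)"
  using permutes_in_image[of \<sigma> "{..<m}" k] by simp

text \<open>The odd map h symmetrises the first m = 2n - 1 factors after a parity reversal of the part
  of degree n - 1. It factors through superexterior and supersymmetric powers of V, and it
  supercommutes with sl(n) and its odd copy because the neighbouring degrees would require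
  an exterior power of C^n beyond the n-th.\<close>
locale odd_map =
  fixes n r m :: nat
  assumes n: "2 \<le> n" and m: "m = 2 * n - 1" and mr: "m \<le> r"
begin

abbreviation mm (infixl "**" 70) where "A ** B \<equiv> mmul n r A B"

definition P :: mat where "P = blocksym n r m"
definition F :: mat where "F = flipmat n r m"
definition h :: mat where "h = P ** F ** projmat n r m (n - 1)"
definition D :: mat where "D = rho n r 1 (gmat n zmat zmat 1 0)"
definition f :: mat where "f = D ** h + h ** D"

abbreviation even_op :: "(nat \<Rightarrow> nat \<Rightarrow> complex) \<Rightarrow> mat" where
  "even_op A \<equiv> rho n r 0 (gmat n A zmat 0 0)"
abbreviation odd_op :: "(nat \<Rightarrow> nat \<Rightarrow> complex) \<Rightarrow> mat" where
  "odd_op C \<equiv> rho n r 1 (gmat n zmat C 0 0)"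

lemma odd_m: "odd m" using m n by simp

lemma m_bounds: "n < m" "m < 2 * n" "m - n = n - 1" using m n by auto

text \<open>Reversal turns \<open>n - 2\<close> odd letters among \<open>2n - 1\<close> into
  \<open>n + 1\<close>. Only \<open>n\<close> odd letters exist, so one repeats and the
  supersymmetriser kills the word.\<close>

lemma PF_proj_zero: "P ** F ** projmat n r m (n - 2) = 0"
proof (intro ext)
  fix a b
  have "P a (flipw n m b) = 0" if b: "b \<in> words n r" and o: "odds n b m = n - 2"
  proof -
    let ?u = "flipw n m b"
    have u: "?u \<in> words n r" using b by (rule flipw_words)
    have "odds n ?u m + odds n b m = m" by (rule odds_flipw[OF b order_refl mr])
    then have "odds n ?u m = n + 1" using o m n by simp
    then have c: "card {l \<in> oddpos n r ?u. l < m} = n + 1" using odds_card[OF mr, of n ?u] by simp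
    have "(!) ?u ` {l \<in> oddpos n r ?u. l < m} \<subseteq> {n..<2*n}"
      using u by (auto simp: oddpos_def words_iff par_def split: if_splits)
    then have "card ((!) ?u ` {l \<in> oddpos n r ?u. l < m}) \<le> n"
      using card_mono[of "{n..<2*n}"] by fastforce
    then have "\<not> inj_on ((!) ?u) {l \<in> oddpos n r ?u. l < m}"
      using card_image[of "(!) ?u"] c by fastforce
    then obtain p q where pq: "p \<in> oddpos n r ?u" "q \<in> oddpos n r ?u" "p < m" "q < m" "?u ! p = ?u ! q" "p \<noteq> q"
      by (auto simp: inj_on_def)
    then have odd: "par n (?u ! p) = 1" "par n (?u ! q) = 1" by (auto simp: oddpos_def)
    show ?thesis
    proof (cases "p < q")
      case True
      then show ?thesis unfolding P_def by (rule blocksym_repeated_odd[OF mr _ pq(4,5) odd(2)])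
    next
      case False
      then have "q < p" using pq(6) by simp
      then show ?thesis unfolding P_def by (rule blocksym_repeated_odd[OF mr _ pq(3) pq(5)[symmetric] odd(1)])
    qed
  qed
  then show "(P ** F ** projmat n r m (n - 2)) a b = (0::mat) a b"
    by (simp add: mmul_projmat_right F_def mmul_flipmat_right)
qed

lemma homog_C: "homog n 1 (\<lambda>_. gmat n zmat C 0 0)"
  by (rule homog_gmat_1)

lemma homog_lowY: "homog n q (\<lambda>_. X) \<Longrightarrow> homog n q (lowY k X)"
  by (auto simp: homog_def lowY_def split: if_splits)

lemma homog_highY: "homog n q (\<lambda>_. X) \<Longrightarrow> homog n q (highY k X)"
  by (auto simp: homog_def highY_def split: if_splits)

lemma homog_upmat: "homog n 1 (\<lambda>_. upmat n C)"
  unfolding homog_1 by (auto simp: upmat_def par_def)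

lemma P_low:
  "homog n q (\<lambda>_. X) \<Longrightarrow> P ** prho n r q (lowY m X) = prho n r q (lowY m X) ** P"
  unfolding P_def by (rule blocksym_prho[OF homog_lowY]) (auto simp: lowY_def permutes_lt_iff)

lemma P_high:
  "homog n q (\<lambda>_. X) \<Longrightarrow> P ** prho n r q (highY m X) = prho n r q (highY m X) ** P"
  unfolding P_def by (rule blocksym_prho[OF homog_highY]) (auto simp: highY_def permutes_lt_iff)

lemma P_rho: "homog n q (\<lambda>_. X) \<Longrightarrow> P ** rho n r q X = rho n r q X ** P"
  unfolding P_def blocksym_def by (rule phi_rho)

lemma flipY_low:
  "x < 2 * n \<Longrightarrow> y < 2 * n \<Longrightarrow> flipY n m 1 (lowY m (gmat n zmat C 0 0)) k x y = lowY m (upmat n C) k x y"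
  by (auto simp: flipY_def lowY_def gmat_def zmat_def upmat_def flip_def)

lemma flipY_up:
  "x < 2 * n \<Longrightarrow> y < 2 * n \<Longrightarrow> flipY n m 1 (lowY m (upmat n C)) k x y = lowY m (gmat n zmat C 0 0) k x y"
  by (auto simp: flipY_def lowY_def gmat_def zmat_def upmat_def flip_def)

lemma flipY_high:
  "flipY n m 1 (highY m X) k x y = (-1) * highY m X k x y"
  by (auto simp: flipY_def highY_def)

lemma F_low: "F ** prho n r 1 (lowY m (gmat n zmat C 0 0)) = prho n r 1 (lowY m (upmat n C)) ** F"
  unfolding F_def flipmat_prho[OF homog_lowY[OF homog_C] mr odd_m]
  by (subst prho_cong[OF flipY_low]) auto

lemma F_up: "F ** prho n r 1 (lowY m (upmat n C)) = prho n r 1 (lowY m (gmat n zmat C 0 0)) ** F"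
  unfolding F_def flipmat_prho[OF homog_lowY[OF homog_upmat] mr odd_m]
  by (subst prho_cong[OF flipY_up]) auto

lemma F_high:
  "F ** prho n r 1 (highY m (gmat n zmat C 0 0)) = - (prho n r 1 (highY m (gmat n zmat C 0 0)) ** F)"
proof -
  have "prho n r 1 (flipY n m 1 (highY m (gmat n zmat C 0 0))) = - prho n r 1 (highY m (gmat n zmat C 0 0))"
    unfolding prho_cong[OF flipY_high] prho_scale by (intro ext) simp
  then show ?thesis
    unfolding F_def flipmat_prho[OF homog_highY[OF homog_C] mr odd_m] by (simp add: mmul_minus_left)
qed

lemma proj_low:
  "projmat n r m (n - 1) ** prho n r 1 (lowY m (gmat n zmat C 0 0))
    = prho n r 1 (lowY m (gmat n zmat C 0 0)) ** projmat n r m (n - 2)"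
  by (rule projmat_prho[OF mr])
    (use n in \<open>auto simp: lowY_def gmat_def zmat_def par_def split: if_splits\<close>)

lemma proj_up:
  "projmat n r m (n - 2) ** prho n r 1 (lowY m (upmat n C))
    = prho n r 1 (lowY m (upmat n C)) ** projmat n r m (n - 1)"
  by (rule projmat_prho[OF mr])
    (use n in \<open>auto simp: lowY_def upmat_def par_def split: if_splits\<close>)

lemma proj_high:
  "projmat n r m j ** prho n r q (highY m X) = prho n r q (highY m X) ** projmat n r m j"
  by (rule projmat_prho[OF mr]) (auto simp: highY_def split: if_splits)

text \<open>Moving \<open>C\<close> to the left past the projection changes its degree to
  \<open>n - 2\<close>. Past the reversal it becomes an upper right block, which commutes with
  \<open>P\<close>, and \<open>PF_proj_zero\<close> remains.\<close>

lemma h_low: "h ** prho n r 1 (lowY m (gmat n zmat C 0 0)) = 0"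
proof -
  let ?C = "prho n r 1 (lowY m (gmat n zmat C 0 0))" and ?U = "prho n r 1 (lowY m (upmat n C))"
  have "h ** ?C = P ** (F ** ?C) ** projmat n r m (n - 2)"
    by (simp only: h_def mmul_assoc proj_low)
  also have "\<dots> = P ** ?U ** F ** projmat n r m (n - 2)"
    by (simp only: F_low mmul_assoc)
  also have "\<dots> = ?U ** (P ** F ** projmat n r m (n - 2))"
    by (simp only: P_low[OF homog_upmat] mmul_assoc)
  finally show ?thesis by (simp only: PF_proj_zero mmul_zero_left mmul_zero_right)
qed

text \<open>The same from the other side: \<open>C\<close> passes \<open>P\<close>, becomes upper
  right under the reversal and lowers the degree, again leaving \<open>PF_proj_zero\<close>.\<close>

lemma low_h: "prho n r 1 (lowY m (gmat n zmat C 0 0)) ** h = 0"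
proof -
  let ?C = "prho n r 1 (lowY m (gmat n zmat C 0 0))" and ?U = "prho n r 1 (lowY m (upmat n C))"
  have "?C ** h = (?C ** P) ** F ** projmat n r m (n - 1)"
    by (simp only: h_def mmul_assoc)
  also have "\<dots> = P ** (?C ** F) ** projmat n r m (n - 1)"
    by (simp only: P_low[OF homog_C, symmetric] mmul_assoc)
  also have "\<dots> = P ** F ** (?U ** projmat n r m (n - 1))"
    by (simp only: F_up[symmetric] mmul_assoc)
  also have "\<dots> = (P ** F ** projmat n r m (n - 2)) ** ?U"
    by (simp only: proj_up[symmetric] mmul_assoc)
  finally show ?thesis by (simp only: PF_proj_zero mmul_zero_left mmul_zero_right)
qed

text \<open>Only the reversal contributes a sign, one for each of its \<open>m\<close> factors;
  \<open>m\<close> is odd.\<close>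

lemma h_high:
  "h ** prho n r 1 (highY m (gmat n zmat C 0 0)) = - (prho n r 1 (highY m (gmat n zmat C 0 0)) ** h)"
proof -
  let ?C = "prho n r 1 (highY m (gmat n zmat C 0 0))"
  have "h ** ?C = P ** (F ** ?C) ** projmat n r m (n - 1)"
    by (simp only: h_def mmul_assoc proj_high)
  also have "\<dots> = - ((P ** ?C) ** F ** projmat n r m (n - 1))"
    by (simp only: F_high mmul_assoc mmul_minus_left mmul_minus_right)
  also have "\<dots> = - (?C ** h)"
    by (simp only: P_high[OF homog_C] mmul_assoc h_def)
  finally show ?thesis .
qed

lemma h_odd: "h ** odd_op C = - (odd_op C ** h)"
  unfolding rho_split_low_high[of n r 1 _ m] mmul_add_left mmul_add_right h_low low_h h_high by simp

lemma h_even: "h ** even_op A = even_op A ** h"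
proof -
  \<comment> \<open>Both diagonal blocks equal \<open>A\<close>, so conjugation by
    \<open>flip\<close> changes nothing. The degree part \<open>d\<close> lacks this symmetry and is
    treated separately for \<open>f\<close>.\<close>
  have F: "F ** even_op A = even_op A ** F"
    unfolding F_def rho_prho flipmat_prho[OF homog_gmat_0 mr odd_m]
    by (subst prho_cong[where Y' = "\<lambda>_. gmat n A zmat 0 0"])
      (auto simp: flipY_def gmat_def zmat_def flip_def)
  have "projmat n r m (n - 1) ** even_op A = even_op A ** projmat n r m (n - 1)"
    unfolding rho_prho
    by (rule projmat_prho[OF mr]) (auto simp: gmat_def zmat_def par_def split: if_splits)
  then have "h ** even_op A = P ** (F ** even_op A) ** projmat n r m (n - 1)"
    by (simp only: h_def mmul_assoc)
  also have "\<dots> = (P ** even_op A) ** F ** projmat n r m (n - 1)"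
    by (simp only: F mmul_assoc)
  finally show ?thesis by (simp only: P_rho[OF homog_gmat_0] mmul_assoc h_def)
qed

section \<open>The anticommutator of the odd map with the derivation\<close>

lemma D_D: "D ** D = 0"
proof (intro ext)
  fix a b
  have z: "matprod n (gmat n zmat zmat 1 0) (gmat n zmat zmat 1 0) i j = 0" for i j
    unfolding matprod_def by (rule sum.neutral) (auto simp: gmat_def zmat_def)
  \<comment> \<open>The superbracket of an odd element with itself is twice its square.\<close>
  have "(D ** D) a b + (D ** D) a b = 0"
    using superbracket[OF homog_gmat_1 homog_gmat_1, of n r zmat 1 zmat 1 a b]
    by (simp add: D_def z rho_zero)
  then show "(D ** D) a b = (0::mat) a b" by simp
qed

text \<open>The relation that the derivation by \<xi> sends \<open>C\<close> times \<xi> to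
  \<open>C\<close>, now read in the tensor power.\<close>

lemma D_odd: "D ** odd_op C + odd_op C ** D = even_op C"
proof (intro ext)
  fix a b
  let ?B = "gmat n zmat zmat 1 0" and ?C = "gmat n zmat C 0 0"
  have BC: "matprod n ?B ?C x y = (if x < n then ?C (x + n) y else 0)" if "x < 2 * n" for x y
  proof -
    have "matprod n ?B ?C x y = (\<Sum>z<2*n. if z = x + n then (if x < n then ?C z y else 0) else 0)"
      unfolding matprod_def using that by (intro sum.cong) (auto simp: gmat_def zmat_def)
    then show ?thesis by auto
  qed
  have CB: "matprod n ?C ?B x y = (if n \<le> y then ?C x (y - n) else 0)" if "y < 2 * n" for x y
  proof -
    have "matprod n ?C ?B x y = (\<Sum>z<2*n. if z = y - n then (if n \<le> y then ?C x z else 0) else 0)"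
      unfolding matprod_def using that by (intro sum.cong) (auto simp: gmat_def zmat_def)
    then show ?thesis using that by auto
  qed
  have "rho n r (1 + 1) (\<lambda>i j. matprod n ?B ?C i j - (-1) ^ (1 * 1) * matprod n ?C ?B i j)
      = rho n r (1 + 1) (gmat n C zmat 0 0)"
    by (rule rho_cong) (simp only: BC CB, auto simp: gmat_def zmat_def)
  also have "\<dots> = even_op C"
  proof -
    \<comment> \<open>The superbracket comes out with parity \<open>1 + 1\<close> instead of
      \<open>0\<close>; the Leibniz signs are the same.\<close>
    have "(-1::complex) ^ ((1 + 1) * k) = 1" for k by (simp flip: mult_2)
    then show ?thesis by (simp only: rho_def mult_0 power_0)
  qed
  finally show "(D ** odd_op C + odd_op C ** D) a b = even_op C a b"
    using superbracket[OF homog_gmat_1 homog_gmat_1, of n r zmat 1 C 0 a b]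
    by (simp add: D_def)
qed

lemma even_D: "even_op A ** D = D ** even_op A"
proof (intro ext)
  fix a b
  let ?B = "gmat n zmat zmat 1 0" and ?A = "gmat n A zmat 0 0"
  have BA: "matprod n ?B ?A x y = (if x < n then ?A (x + n) y else 0)" if "x < 2 * n" for x y
  proof -
    have "matprod n ?B ?A x y = (\<Sum>z<2*n. if z = x + n then (if x < n then ?A z y else 0) else 0)"
      unfolding matprod_def using that by (intro sum.cong) (auto simp: gmat_def zmat_def)
    then show ?thesis by auto
  qed
  have AB: "matprod n ?A ?B x y = (if n \<le> y then ?A x (y - n) else 0)" if "y < 2 * n" for x y
  proof -
    have "matprod n ?A ?B x y = (\<Sum>z<2*n. if z = y - n then (if n \<le> y then ?A x z else 0) else 0)"
      unfolding matprod_def using that by (intro sum.cong) (auto simp: gmat_def zmat_def)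
    then show ?thesis using that by auto
  qed
  have "rho n r (0 + 1) (\<lambda>i j. matprod n ?A ?B i j - (-1) ^ (0 * 1) * matprod n ?B ?A i j)
      = rho n r (0 + 1) (\<lambda>_ _. 0)"
    by (rule rho_cong) (simp only: BA AB, auto simp: gmat_def zmat_def)
  also have "\<dots> = 0" by (rule rho_zero)
  finally show "(even_op A ** D) a b = (D ** even_op A) a b"
    using superbracket[OF homog_gmat_0 homog_gmat_1, of n r A 0 zmat 1 a b]
    by (simp add: D_def)
qed

lemma f_D: "f ** D = D ** f"
proof -
  have "f ** D = D ** h ** D + h ** (D ** D)" by (simp only: f_def mmul_add_left mmul_assoc)
  also have "\<dots> = (D ** D) ** h + D ** h ** D" by (simp add: D_D)
  also have "\<dots> = D ** f" by (simp only: f_def mmul_add_right mmul_assoc)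
  finally show ?thesis .
qed

text \<open>Super Jacobi: \<open>f\<close> is the bracket of \<open>D\<close> and \<open>h\<close>.
  Since \<open>h\<close> supercommutes with \<open>C\<close> and also with the bracket of
  \<open>D\<close> and \<open>C\<close>, which is the even \<open>C\<close>, so does
  \<open>f\<close> with \<open>C\<close>.\<close>

lemma f_odd: "f ** odd_op C = odd_op C ** f"
proof -
  let ?C = "odd_op C"
  have CD: "?C ** D = even_op C - D ** ?C" and DC: "D ** ?C = even_op C - ?C ** D"
    using D_odd[of C] by (simp_all add: algebra_simps)
  have "f ** ?C = D ** (h ** ?C) + h ** (D ** ?C)"
    by (simp only: f_def mmul_add_left mmul_assoc)
  also have "h ** (D ** ?C) = h ** even_op C - (h ** ?C) ** D"
    by (simp only: DC mmul_diff_right mmul_assoc)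
  also have "D ** (h ** ?C) + (h ** even_op C - (h ** ?C) ** D)
      = (even_op C ** h - D ** ?C ** h) + ?C ** h ** D"
    by (simp only: h_odd h_even mmul_minus_left mmul_minus_right mmul_assoc) simp
  also have "\<dots> = (even_op C - D ** ?C) ** h + ?C ** h ** D"
    by (simp only: mmul_diff_left)
  also have "\<dots> = ?C ** f"
    by (simp only: CD[symmetric] f_def mmul_add_right mmul_assoc)
  finally show ?thesis .
qed

lemma f_even: "f ** even_op A = even_op A ** f"
proof -
  have "D ** (h ** even_op A) = even_op A ** (D ** h)"
    by (metis h_even even_D mmul_assoc)
  moreover have "h ** (D ** even_op A) = even_op A ** (h ** D)"
    by (metis h_even even_D mmul_assoc)
  ultimately show ?thesis
    by (simp only: f_def mmul_add_left mmul_add_right mmul_assoc)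
qed

lemma supported_h: "supported n r h"
  unfolding h_def P_def F_def blocksym_def
  by (intro supported_mmul supported_phi supported_flipmat supported_projmat)

lemma supported_f: "supported n r f"
  using supported_mmul[OF supported_h supported_rho] supported_mmul[OF supported_rho supported_h]
  by (simp add: f_def D_def supported_def)

lemma h_entry: "h a b = (if b \<in> words n r \<and> odds n b m = n - 1
    then P a (flipw n m b) * flipsign n m b else 0)"
  by (simp add: h_def mmul_projmat_right F_def mmul_flipmat_right)


text \<open>The supersymmetriser preserves the degree, and reversal turns \<open>n - 1\<close> odd
  letters of the block into \<open>n\<close>.\<close>

lemma odds_h:
  assumes nz: "h a b \<noteq> 0"
  shows "odds n a r = odds n b r + 1"
proof -
  have b: "b \<in> words n r" "odds n b m = n - 1" and "P a (flipw n m b) \<noteq> 0"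
    using nz by (auto simp: h_entry split: if_splits)
  moreover from this have "a \<in> words n r"
    using supported_phi unfolding P_def blocksym_def supported_def by blast
  moreover have "flipw n m b \<in> words n r" using b(1) by (rule flipw_words)
  ultimately have "odds n a r = odds n (flipw n m b) r"
    using commuting.odds_h[OF phi_commuting] by (simp add: P_def blocksym_def)
  moreover have "odds n (flipw n m b) r + 2 * odds n b m = m + odds n b r"
    by (rule odds_flipw_high[OF b(1) mr order_refl])
  ultimately show ?thesis using b(2) m n by simp
qed

lemma odds_D:
  assumes nz: "D a b \<noteq> 0" shows "odds n b r = odds n a r + 1"
proof -
  have ab: "a \<in> words n r" "b \<in> words n r" using nz supported_rho unfolding D_def supported_def by blast+
  have "\<exists>k<r. (\<forall>l<r. l \<noteq> k \<longrightarrow> a ! l = b ! l) \<and> gmat n zmat zmat 1 0 (a ! k) (b ! k) \<noteq> 0"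
    using nz ab by (auto simp: D_def rho_def elim!: sum.not_neutral_contains_not_neutral split: if_splits)
  then obtain k where k: "k < r" "\<forall>l<r. l \<noteq> k \<longrightarrow> a ! l = b ! l" "gmat n zmat zmat 1 0 (a ! k) (b ! k) \<noteq> 0"
    by blast
  have "(\<Sum>l<r. 1 * par n (a ! l)) + 1 * par n (b ! k) = (\<Sum>l<r. 1 * par n (b ! l)) + 1 * par n (a ! k)"
    using k by (intro odds_cong_off) auto
  moreover have "par n (b ! k) = 1" "par n (a ! k) = 0"
    using k(3) by (auto simp: gmat_def zmat_def par_def split: if_splits)
  ultimately show ?thesis by simp
qed

lemma odds_f:
  assumes nz: "f a b \<noteq> 0" shows "odds n a r = odds n b r"
proof -
  have "(D ** h) a b \<noteq> 0 \<or> (h ** D) a b \<noteq> 0" using nz by (auto simp: f_def)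
  then show ?thesis
  proof
    assume "(D ** h) a b \<noteq> 0"
    then obtain u where "D a u * h u b \<noteq> 0"
      unfolding mmul_def by (rule sum.not_neutral_contains_not_neutral)
    then show ?thesis using odds_D[of a u] odds_h[of u b] by simp
  next
    assume "(h ** D) a b \<noteq> 0"
    then obtain u where "h a u * D u b \<noteq> 0"
      unfolding mmul_def by (rule sum.not_neutral_contains_not_neutral)
    then show ?thesis using odds_D[of u b] odds_h[of a u] by simp
  qed
qed

text \<open>The part with \<open>d\<close> is split off because \<open>h\<close> alone does not
  commute with the degree. For \<open>f\<close> it does hold, as \<open>D\<close> lowers the degree
  by the one that \<open>h\<close> adds.\<close>

lemma f_commuting: "commuting n r f"
proof
  show "supported n r f" by (rule supported_f)
next
  fix A d
  let ?N = "rho n r 0 (gmat n zmat zmat 0 d)"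
  have "gmat n A zmat 0 d = (\<lambda>x y. gmat n A zmat 0 0 x y + gmat n zmat zmat 0 d x y)"
    by (intro ext) (auto simp: gmat_def zmat_def)
  then have split: "rho n r 0 (gmat n A zmat 0 d) = even_op A + ?N"
    unfolding rho_prho by (simp only: prho_add)
  have "f ** ?N = ?N ** f"
  proof (rule supported_eqI[of n r])
    fix a b assume ab: "a \<in> words n r" "b \<in> words n r"
    have diag: "x \<noteq> y \<Longrightarrow> gmat n zmat zmat 0 d x y = 0" for x y by (auto simp: gmat_def zmat_def)
    have "(f ** ?N) a b = d * of_nat (odds n b r) * f a b"
      by (rule trans[OF mmul_diag_right[OF _ ab(2)]], erule diag, simp only: degree_weight[OF ab(2)])
    moreover have "(?N ** f) a b = d * of_nat (odds n a r) * f a b"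
      by (rule trans[OF mmul_diag_left[OF _ ab(1)]], erule diag, simp only: degree_weight[OF ab(1)])
    ultimately show "(f ** ?N) a b = (?N ** f) a b"
      using odds_f[of a b] by (cases "f a b = 0") simp_all
  qed (intro supported_mmul supported_f supported_rho)+
  then show "f ** rho n r 0 (gmat n A zmat 0 d) = rho n r 0 (gmat n A zmat 0 d) ** f"
    unfolding split by (simp only: mmul_add_left mmul_add_right f_even)
next
  fix C b
  have "gmat n zmat C b 0 = (\<lambda>x y. gmat n zmat C 0 0 x y + b * gmat n zmat zmat 1 0 x y)"
    by (intro ext) (auto simp: gmat_def zmat_def)
  then have split: "rho n r 1 (gmat n zmat C b 0) = odd_op C + (\<lambda>x y. b * D x y)"
    unfolding rho_prho D_def by (simp only: prho_add prho_scale)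
  have "f ** (\<lambda>x y. b * D x y) = (\<lambda>x y. b * (f ** D) x y)" "(\<lambda>x y. b * D x y) ** f = (\<lambda>x y. b * (D ** f) x y)"
    by (simp_all add: mmul_def sum_distrib_left mult_ac)
  then show "f ** rho n r 1 (gmat n zmat C b 0) = rho n r 1 (gmat n zmat C b 0) ** f"
    unfolding split by (simp only: mmul_add_left mmul_add_right f_odd f_D)
qed

section \<open>A nonzero entry of \<open>f\<close> that changes the letters\<close>

definition src :: "nat list" where
  "src = map (\<lambda>k. if k < m then k else 0) [0..<r]"

text \<open>On the block \<open>src\<close> is \<open>0, ..., 2n - 2\<close>, of degree
  \<open>n - 1\<close>, and its reversal is \<open>n, ..., 2n - 1, 0, ..., n - 2\<close>. Lowering
  the first letter by \<open>D\<close> removes the only \<open>n\<close>, a letter that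
  \<open>src\<close> does contain.\<close>

definition tgt :: "nat list" where
  "tgt = (flipw n m src)[0 := 0]"

lemma src_words: "src \<in> words n r"
  using m_bounds by (auto simp: words_iff src_def)

lemma flip_src: "k < r \<Longrightarrow> flipw n m src ! k = (if k < n then n + k else if k < m then k - n else 0)"
  using m_bounds by (auto simp: nth_flipw src_def flip_def)

lemma tgt_nth: "k < r \<Longrightarrow> tgt ! k = (if k = 0 then 0 else if k < n then n + k else if k < m then k - n else 0)"
  using flip_src[of k] m_bounds n src_words by (auto simp: tgt_def words_iff nth_list_update)

lemma tgt_words: "tgt \<in> words n r"
  unfolding tgt_def using flipw_words[OF src_words] n by simp

lemma tgt_no_n: "k < r \<Longrightarrow> tgt ! k \<noteq> n"
  using n m_bounds by (auto simp: tgt_nth)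

lemma phi_letters:
  assumes "phi n r c a b \<noteq> 0" "k < r" shows "\<exists>l<r. a ! l = b ! k"
proof -
  obtain \<sigma> where \<sigma>: "\<sigma> permutes {..<r}" "permact n r \<sigma> a b \<noteq> 0"
    using assms(1) by (auto simp: phi_def elim!: sum.not_neutral_contains_not_neutral)
  then have "a ! \<sigma> k = b ! k" using assms(2) by (auto simp: permact_eps split: if_splits)
  then show ?thesis using permutes_words[OF \<sigma>(1) assms(2)] by blast
qed

text \<open>The odd letters of \<open>tgt\<close> are distinct, so a permutation preserving
  \<open>tgt\<close> fixes all odd positions and has sign one. The entry counts such permutations,
  among them the identity.\<close>

lemma P_tgt: "P tgt tgt \<noteq> 0"
proof -
  have e: "permact n r \<sigma> tgt tgt = (if \<forall>i<r. tgt ! \<sigma> i = tgt ! i then 1 else 0)"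
    if \<sigma>: "\<sigma> permutes {..<m}" for \<sigma>
  proof (cases "\<forall>i<r. tgt ! \<sigma> i = tgt ! i")
    case True
    have "\<sigma> i = i" if "i \<in> oddpos n r tgt" for i
    proof -
      have i: "i < r" "n \<le> tgt ! i" using that by (auto simp: oddpos_def par_def split: if_splits)
      then have "tgt ! i = n + i" "i < m" using n m_bounds by (auto simp: tgt_nth split: if_splits)
      moreover have "\<sigma> i < m" using \<open>i < m\<close> permutes_lt_iff[OF \<sigma>] by simp
      moreover have "tgt ! \<sigma> i = tgt ! i" using True i by blast
      ultimately show ?thesis using tgt_nth[of "\<sigma> i"] mr n m_bounds by (auto split: if_splits)
    qed
    then have "eps \<sigma> (oddpos n r tgt) = 1" by (auto simp: eps_def intro!: prod.neutral)
    then show ?thesis using True tgt_words by (simp add: permact_eps)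
  next
    case False
    then show ?thesis by (simp only: permact_eps if_False simp_thms)
  qed
  let ?S = "{\<sigma>. \<sigma> permutes {..<m}}"
  have "P tgt tgt = (\<Sum>\<sigma>\<in>?S. if \<forall>i<r. tgt ! \<sigma> i = tgt ! i then 1 else 0)"
    unfolding P_def blocksym_eq[OF mr] using e by (intro sum.cong) auto
  also have "\<dots> = of_nat (card {\<sigma>\<in>?S. \<forall>i<r. tgt ! \<sigma> i = tgt ! i})"
    by (simp add: sum.If_cases finite_permutations Collect_conj_eq)
  finally have P: "P tgt tgt = of_nat (card {\<sigma>\<in>?S. \<forall>i<r. tgt ! \<sigma> i = tgt ! i})" .
  have "id \<in> {\<sigma>\<in>?S. \<forall>i<r. tgt ! \<sigma> i = tgt ! i}" by (simp add: permutes_id)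
  then have "{\<sigma>\<in>?S. \<forall>i<r. tgt ! \<sigma> i = tgt ! i} \<noteq> {}" by blast
  moreover have "finite {\<sigma>\<in>?S. \<forall>i<r. tgt ! \<sigma> i = tgt ! i}" by (simp add: finite_permutations)
  ultimately have "card {\<sigma>\<in>?S. \<forall>i<r. tgt ! \<sigma> i = tgt ! i} \<noteq> 0" by (simp only: card_eq_0_iff simp_thms)
  then show ?thesis unfolding P of_nat_eq_0_iff .
qed

text \<open>Applying \<open>D\<close> first lowers the block degree of \<open>src\<close> below
  \<open>n - 1\<close>, where \<open>h\<close> vanishes. In the other order, only \<open>D\<close>
  at position \<open>0\<close> removes the letter \<open>n\<close>, so a single term reaches
  \<open>tgt\<close>.\<close>

lemma f_src_tgt: "f tgt src \<noteq> 0"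
proof -
  let ?B = "gmat n zmat zmat 1 0" and ?u = "flipw n m src"
  have u: "?u \<in> words n r" by (rule flipw_words[OF src_words])
  have os: "odds n src m = n - 1"
  proof -
    have "odds n src m = (\<Sum>l<m. if l < n then 0 else 1)"
      using mr by (intro sum.cong) (auto simp: src_def par_def)
    also have "\<dots> = card ({..<m} \<inter> - {l. l < n})" by (simp add: sum.If_cases)
    also have "{..<m} \<inter> - {l. l < n} = {n..<m}" by auto
    finally show ?thesis using m_bounds by simp
  qed
  have "(h ** D) tgt src = 0"
    unfolding D_def rho_prho mmul_prho_right[OF src_words]
  proof (intro sum.neutral ballI)
    fix k x assume "k \<in> {..<r}" "x \<in> {..<2*n}"
    then have k: "k < r" by simp
    show "(-1) ^ (1 * odds n src k) * ?B x (src ! k) * h tgt (src[k := x]) = 0"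
    proof (cases "?B x (src ! k) = 0")
      case False
      then have x: "x < n" "src ! k = n + x" by (auto simp: gmat_def zmat_def split: if_splits)
      then have km: "k < m" using k n by (auto simp: src_def split: if_splits)
      \<comment> \<open>Beyond the block \<open>src\<close> is constantly \<open>0\<close>, so the
        lowered odd letter lies inside and the block degree drops.\<close>
      have "odds n (src[k := x]) m + par n (src ! k) = odds n src m + par n x"
        using km k src_words by (intro odds_update) (auto simp: words_iff)
      then have "odds n (src[k := x]) m \<noteq> n - 1" using os x n by (simp add: par_def)
      then show ?thesis by (simp add: h_entry)
    qed simp
  qed
  moreover have "(D ** h) tgt src = P tgt tgt * flipsign n m src"
  proof -
    have "D ** h = (P ** D) ** F ** projmat n r m (n - 1)"
      unfolding h_def D_def P_rho[OF homog_gmat_1] by (simp only: mmul_assoc)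
    then have "(D ** h) tgt src = (P ** D) tgt ?u * flipsign n m src"
      using os src_words by (simp add: mmul_projmat_right F_def mmul_flipmat_right)
    also have "(P ** D) tgt ?u = (\<Sum>k<r. \<Sum>x<2*n. (-1) ^ (1 * odds n ?u k) * ?B x (?u ! k) * P tgt (?u[k := x]))"
      unfolding D_def rho_prho mmul_prho_right[OF u] ..
    also have "\<dots> = (\<Sum>k<r. \<Sum>x<2*n. if k = 0 then if x = 0 then P tgt tgt else 0 else 0)"
    proof (intro sum.cong refl)
      fix k x assume "k \<in> {..<r}" "x \<in> {..<2*n}"
      then have k: "k < r" by simp
      show "(-1) ^ (1 * odds n ?u k) * ?B x (?u ! k) * P tgt (?u[k := x])
          = (if k = 0 then if x = 0 then P tgt tgt else 0 else 0)"
      proof (cases "k = 0")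
        case True
        then show ?thesis using flip_src[OF k] n by (auto simp: gmat_def zmat_def tgt_def)
      next
        case False
        have "P tgt (?u[k := x]) = 0"
        proof (rule ccontr)
          assume "P tgt (?u[k := x]) \<noteq> 0"
          then obtain l where l: "l < r" "tgt ! l = ?u[k := x] ! 0"
            unfolding P_def blocksym_def using phi_letters[of _ tgt "?u[k := x]" 0] k by auto
          have "?u[k := x] ! 0 = n" using False flip_src[of 0] k n by simp
          then show False using tgt_no_n[OF l(1)] l(2) by simp
        qed
        then show ?thesis using False by simp
      qed
    qed
    also have "\<dots> = P tgt tgt"
    proof -
      have "(\<Sum>x<2*n. if k = 0 then if x = 0 then P tgt tgt else 0 else 0)
          = (if k = 0 then P tgt tgt else 0)" for k :: nat
        using n by auto
      moreover have "0 < r" using mr m_bounds by simp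
      ultimately show ?thesis by simp
    qed
    finally show ?thesis .
  qed
  ultimately show ?thesis using P_tgt by (simp add: f_def flipsign_def)
qed

lemma not_surjective: "\<not> Endg n r \<subseteq> phi n r ` CS r"
proof
  assume "Endg n r \<subseteq> phi n r ` CS r"
  then obtain c where "f = phi n r c" using f_commuting by (auto simp: Endg_eq)
  then have "phi n r c tgt src \<noteq> 0" using f_src_tgt by simp
  moreover have nr: "n < m" "n < r" using m_bounds mr by auto
  ultimately obtain l where "l < r" "tgt ! l = src ! n" using phi_letters by blast
  then show False using tgt_no_n nr by (simp add: src_def)
qed

end

section \<open>A proper submodule\<close>

definition topword :: "nat \<Rightarrow> nat \<Rightarrow> nat list \<Rightarrow> bool" where
  "topword n r u \<longleftrightarrow> u \<in> words n r \<and> (\<forall>i<r. n \<le> u ! i)"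

definition lower :: "nat \<Rightarrow> nat \<Rightarrow> nat list \<Rightarrow> nat list" where
  "lower n k u = u[k := u ! k - n]"

text \<open>The submodule generated by the top degree part: in degree r - 1 it is one copy of the
  tensor power of C^n, embedded by the derivative of the product of the odd generators.\<close>
definition submod :: "nat \<Rightarrow> nat \<Rightarrow> (nat list \<Rightarrow> complex) \<Rightarrow> bool" where
  "submod n r v \<longleftrightarrow> (\<forall>a\<in>words n r. v a \<noteq> 0 \<longrightarrow> r \<le> odds n a r + 1)
    \<and> (\<forall>u k. topword n r u \<longrightarrow> k < r \<longrightarrow> v (lower n k u) = (-1) ^ k * v (lower n 0 u))"

lemma submod_degree_ge: "submod n r v \<Longrightarrow> a \<in> words n r \<Longrightarrow> v a \<noteq> 0 \<Longrightarrow> r \<le> odds n a r + 1"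
  by (simp add: submod_def)

lemma submod_lower: "submod n r v \<Longrightarrow> topword n r u \<Longrightarrow> k < r \<Longrightarrow> v (lower n k u) = (-1) ^ k * v (lower n 0 u)"
  unfolding submod_def by blast

lemma submodI:
  assumes "\<And>a. a \<in> words n r \<Longrightarrow> v a \<noteq> 0 \<Longrightarrow> r \<le> odds n a r + 1"
    and "\<And>u k. topword n r u \<Longrightarrow> k < r \<Longrightarrow> v (lower n k u) = (-1) ^ k * v (lower n 0 u)"
  shows "submod n r v"
  unfolding submod_def using assms by blast

lemma submod_add:
  assumes "submod n r v" "submod n r w" shows "submod n r (\<lambda>a. v a + w a)"
proof (rule submodI)
  show "r \<le> odds n a r + 1" if "a \<in> words n r" "v a + w a \<noteq> 0" for a
    using that submod_degree_ge[OF assms(1), of a] submod_degree_ge[OF assms(2), of a]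
    by (cases "v a = 0") auto
  show "v (lower n k u) + w (lower n k u) = (-1) ^ k * (v (lower n 0 u) + w (lower n 0 u))"
    if "topword n r u" "k < r" for u k
    by (simp only: submod_lower[OF assms(1) that] submod_lower[OF assms(2) that] distrib_left)
qed

lemma submod_scale:
  assumes "submod n r v" shows "submod n r (\<lambda>a. c * v a)"
proof (rule submodI)
  show "r \<le> odds n a r + 1" if "a \<in> words n r" "c * v a \<noteq> 0" for a
    using that submod_degree_ge[OF assms, of a] by simp
  show "c * v (lower n k u) = (-1) ^ k * (c * v (lower n 0 u))" if "topword n r u" "k < r" for u k
    by (simp only: submod_lower[OF assms that] mult.left_commute)
qed

lemma submod_sum: "(\<And>i. i < k \<Longrightarrow> submod n r (v i)) \<Longrightarrow> submod n r (\<lambda>a. \<Sum>i<k. v i a)" for k :: nat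
proof (induction k)
  case 0
  then show ?case by (simp add: submod_def)
next
  case (Suc k)
  then show ?case using submod_add[of n r "\<lambda>a. \<Sum>i<k. v i a" "v k"] by simp
qed

lemma topword_words: "topword n r u \<Longrightarrow> u \<in> words n r"
  by (simp add: topword_def)

lemma topword_letter: "topword n r u \<Longrightarrow> k < r \<Longrightarrow> n \<le> u ! k \<and> u ! k < 2 * n"
  by (auto simp: topword_def words_iff)

lemma topword_update: "topword n r u \<Longrightarrow> z < n \<Longrightarrow> topword n r (u[l := z + n])"
  by (cases "l < r") (auto simp: topword_def words_iff nth_list_update)

lemma lower_words: "topword n r u \<Longrightarrow> k < r \<Longrightarrow> lower n k u \<in> words n r"
  using topword_letter[of n r u k] by (auto simp: lower_def topword_def)

lemma odds_topword: "topword n r u \<Longrightarrow> k \<le> r \<Longrightarrow> odds n u k = k"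
proof -
  assume "topword n r u" "k \<le> r"
  then have "odds n u k = (\<Sum>l<k. 1)"
    by (intro sum.cong) (auto simp: topword_def par_def dest: order.strict_trans2)
  then show ?thesis by simp
qed

lemma odds_lower:
  assumes u: "topword n r u" and k: "k < r" shows "odds n (lower n k u) r + 1 = r"
proof -
  have "odds n (lower n k u) r + par n (u ! k) = odds n u r + par n (u ! k - n)"
    unfolding lower_def using u k by (intro odds_update) (auto simp: topword_def words_iff)
  moreover have "par n (u ! k) = 1" "par n (u ! k - n) = 0"
    using topword_letter[OF u k] by (auto simp: par_def)
  ultimately show ?thesis using odds_topword[OF u order_refl] by simp
qed

section \<open>Stability under the parts of \<open>g\<close>\<close>

lemma sum_less_double: "(\<Sum>x<2*n. g x) = (\<Sum>z<n. g z) + (\<Sum>z<n. g (z + n))"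
  for g :: "nat \<Rightarrow> complex"
proof -
  have "(\<Sum>x<2*n. g x) = (\<Sum>x<n. g x) + (\<Sum>x\<in>{n..<n+n}. g x)"
    by (simp add: lessThan_atLeast0 mult_2 sum.atLeastLessThan_concat)
  also have "(\<Sum>x\<in>{n..<n+n}. g x) = (\<Sum>z<n. g (z + n))"
    using sum.shift_bounds_nat_ivl[of g 0 n n] by (simp add: lessThan_atLeast0)
  finally show ?thesis .
qed

lemma mmul_rho_nonzero:
  assumes "a \<in> words n r" "mmul n r (rho n r q X) M a b \<noteq> 0"
  obtains k x where "k < r" "x < 2 * n" "X (a ! k) x \<noteq> 0" "M (a[k := x]) b \<noteq> 0"
proof -
  have "\<exists>k<r. \<exists>x<2*n. X (a ! k) x \<noteq> 0 \<and> M (a[k := x]) b \<noteq> 0"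
  proof (rule ccontr)
    assume "\<not> ?thesis"
    then have "mmul n r (rho n r q X) M a b = 0"
      unfolding rho_prho mmul_prho_left[OF assms(1)] by (intro sum.neutral ballI) auto
    then show False using assms(2) by simp
  qed
  then show ?thesis using that by blast
qed

lemma submod_even:
  assumes v: "submod n r (\<lambda>a. M a b)"
  shows "submod n r (\<lambda>a. mmul n r (rho n r 0 (gmat n A zmat 0 0)) M a b)"
proof (rule submodI)
  fix a assume a: "a \<in> words n r" and nz: "mmul n r (rho n r 0 (gmat n A zmat 0 0)) M a b \<noteq> 0"
  obtain k x where k: "k < r" "x < 2 * n" "gmat n A zmat 0 0 (a ! k) x \<noteq> 0" "M (a[k := x]) b \<noteq> 0"
    using mmul_rho_nonzero[OF a nz] .
  have "par n (a ! k) = par n x" using k(3) by (auto simp: gmat_def zmat_def par_def split: if_splits)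
  moreover have "odds n (a[k := x]) r + par n (a ! k) = odds n a r + par n x"
    using k a by (intro odds_update) (auto simp: words_iff)
  moreover have "r \<le> odds n (a[k := x]) r + 1" using k a by (intro submod_degree_ge[OF v]) auto
  ultimately show "r \<le> odds n a r + 1" by simp
next
  fix u k assume u: "topword n r u" and k: "k < r"
  \<comment> \<open>The vector in the copy of the tensor power of C^n: up to
    \<open>(-1) ^ k\<close>, every lowered entry is a value of \<open>w\<close>. The action of
    \<open>A\<close> on these values does not see \<open>k\<close>.\<close>
  define w where "w = (\<lambda>u. M (lower n 0 u) b)"
  have vw: "M (lower n k u) b = (-1) ^ k * w u" if "topword n r u" "k < r" for u k
    unfolding w_def by (rule submod_lower[OF v that])
  let ?X = "gmat n A zmat 0 0"
  have len: "length u = r" using u by (auto simp: topword_def words_iff)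
  have "mmul n r (rho n r 0 ?X) M (lower n k u) b
      = (-1) ^ k * (\<Sum>l<r. \<Sum>z<n. A (u ! l - n) z * w (u[l := z + n]))" if k: "k < r" for k
  proof -
    have "(\<Sum>x<2*n. (-1) ^ (0 * odds n (lower n k u) l) * ?X (lower n k u ! l) x * M ((lower n k u)[l := x]) b)
        = (-1) ^ k * (\<Sum>z<n. A (u ! l - n) z * w (u[l := z + n]))" if l: "l < r" for l
    proof (cases "l = k")
      case True
      have "M ((lower n k u)[k := z]) b = (-1) ^ k * w (u[k := z + n])" if "z < n" for z
      proof -
        have "(lower n k u)[k := z] = lower n k (u[k := z + n])"
          using k len by (simp add: lower_def)
        then show ?thesis using vw[OF topword_update[OF u that] k] by simp
      qed
      moreover have "?X (lower n k u ! k) z = A (u ! k - n) z" "?X (lower n k u ! k) (z + n) = 0"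
        if "z < n" for z
        using that topword_letter[OF u k] k len by (auto simp: lower_def gmat_def)
      ultimately show ?thesis unfolding True sum_less_double
        by (simp add: sum_distrib_left mult_ac)
    next
      case False
      have "M ((lower n k u)[l := z + n]) b = (-1) ^ k * w (u[l := z + n])" if "z < n" for z
      proof -
        have "(lower n k u)[l := z + n] = lower n k (u[l := z + n])"
          using False by (simp add: lower_def list_update_swap)
        then show ?thesis using vw[OF topword_update[OF u that] k] by simp
      qed
      moreover have "?X (lower n k u ! l) z = 0" "?X (lower n k u ! l) (z + n) = A (u ! l - n) z"
        if "z < n" for z
        using that topword_letter[OF u l] l False len by (auto simp: lower_def gmat_def zmat_def)
      ultimately show ?thesis unfolding sum_less_double
        by (simp add: sum_distrib_left mult_ac)
    qed
    then show ?thesis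
      unfolding rho_prho mmul_prho_left[OF lower_words[OF u k]] sum_distrib_left[of "(-1) ^ k" _ "{..<r}"]
      by (intro sum.cong) auto
  qed
  from this[OF k] this[of 0] show "mmul n r (rho n r 0 ?X) M (lower n k u) b
      = (-1) ^ k * mmul n r (rho n r 0 ?X) M (lower n 0 u) b"
    using k by simp
qed

lemma submod_degree:
  assumes v: "submod n r (\<lambda>a. M a b)"
  shows "submod n r (\<lambda>a. mmul n r (rho n r 0 (gmat n zmat zmat 0 d)) M a b)"
proof -
  have e: "mmul n r (rho n r 0 (gmat n zmat zmat 0 d)) M a b = d * of_nat (odds n a r) * M a b"
    if "a \<in> words n r" for a
  proof -
    have diag: "x \<noteq> y \<Longrightarrow> gmat n zmat zmat 0 d x y = 0" for x y by (auto simp: gmat_def zmat_def)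
    show ?thesis
      by (rule trans[OF mmul_diag_left[OF _ that]], erule diag, simp only: degree_weight[OF that])
  qed
  show ?thesis
  proof (rule submodI)
    show "r \<le> odds n a r + 1"
      if "a \<in> words n r" "mmul n r (rho n r 0 (gmat n zmat zmat 0 d)) M a b \<noteq> 0" for a
      using that submod_degree_ge[OF v, of a] by (simp add: e)
    fix u k assume u: "topword n r u" "k < r"
    have 0: "0 < r" using u(2) by simp
    have "odds n (lower n k u) r = odds n (lower n 0 u) r"
      using odds_lower[OF u] odds_lower[OF u(1) 0] by simp
    then show "mmul n r (rho n r 0 (gmat n zmat zmat 0 d)) M (lower n k u) b
        = (-1) ^ k * mmul n r (rho n r 0 (gmat n zmat zmat 0 d)) M (lower n 0 u) b"
      by (simp only: e[OF lower_words[OF u]] e[OF lower_words[OF u(1) 0]] submod_lower[OF v u] mult_ac)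
  qed
qed

text \<open>A lower left block raises the degree by one, so the image lies in top degree and both
  sides of the sign relation are zero.\<close>

lemma submod_odd:
  assumes v: "submod n r (\<lambda>a. M a b)"
  shows "submod n r (\<lambda>a. mmul n r (rho n r 1 (gmat n zmat C 0 0)) M a b)"
proof (rule submodI)
  let ?X = "gmat n zmat C 0 0"
  have up: "odds n (a[k := x]) r + 1 = odds n a r"
    if "a \<in> words n r" "k < r" "?X (a ! k) x \<noteq> 0" for a k x
  proof -
    have "par n (a ! k) = 1" "par n x = 0"
      using that(3) by (auto simp: gmat_def zmat_def par_def split: if_splits)
    moreover have "odds n (a[k := x]) r + par n (a ! k) = odds n a r + par n x"
      using that by (intro odds_update) (auto simp: words_iff)
    ultimately show ?thesis by simp
  qed
  {
    fix a assume a: "a \<in> words n r" and nz: "mmul n r (rho n r 1 ?X) M a b \<noteq> 0"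
    obtain k x where k: "k < r" "x < 2 * n" "?X (a ! k) x \<noteq> 0" "M (a[k := x]) b \<noteq> 0"
      using mmul_rho_nonzero[OF a nz] .
    then have "r \<le> odds n (a[k := x]) r + 1" using a by (intro submod_degree_ge[OF v]) auto
    then have "r \<le> odds n a r" using up[OF a k(1,3)] by simp
  } note deg = this
  show "r \<le> odds n a r + 1" if "a \<in> words n r" "mmul n r (rho n r 1 ?X) M a b \<noteq> 0" for a
    using deg[OF that] by simp
  fix u k assume u: "topword n r u" and k: "k < r"
  have "mmul n r (rho n r 1 ?X) M (lower n k u) b = 0" if "k < r" for k
    using deg[OF lower_words[OF u that]] odds_lower[OF u that] by fastforce
  then show "mmul n r (rho n r 1 ?X) M (lower n k u) b
      = (-1) ^ k * mmul n r (rho n r 1 ?X) M (lower n 0 u) b"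
    using k by simp
qed

lemma mmul_shift:
  assumes a: "a \<in> words n r"
  shows "mmul n r (rho n r 1 (gmat n zmat zmat 1 0)) M a b
    = (\<Sum>p<r. if a ! p < n then (-1) ^ odds n a p * M (a[p := a ! p + n]) b else 0)"
  unfolding rho_prho mmul_prho_left[OF a]
proof (intro sum.cong[OF refl])
  fix p assume "p \<in> {..<r}"
  have "(\<Sum>x<2*n. (-1) ^ (1 * odds n a p) * gmat n zmat zmat 1 0 (a ! p) x * M (a[p := x]) b)
    = (\<Sum>x<2*n. if x = a ! p + n then
        (if a ! p < n then (-1) ^ odds n a p * M (a[p := x]) b else 0) else 0)"
    by (intro sum.cong) (auto simp: gmat_def zmat_def)
  then show "(\<Sum>x<2*n. (-1) ^ (1 * odds n a p) * gmat n zmat zmat 1 0 (a ! p) x * M (a[p := x]) b)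
    = (if a ! p < n then (-1) ^ odds n a p * M (a[p := a ! p + n]) b else 0)"
    by auto
qed

text \<open>The signs \<open>(-1) ^ k\<close> are those of the derivation applied to a top word,
  which settles degree \<open>r - 1\<close>. In degree \<open>r - 2\<close> the two ways to reach a
  word with two even letters cancel, reflecting that the derivation squares to zero.\<close>

lemma submod_shift:
  assumes v: "submod n r (\<lambda>a. M a b)"
  shows "submod n r (\<lambda>a. mmul n r (rho n r 1 (gmat n zmat zmat 1 0)) M a b)"
proof (rule submodI)
  let ?D = "rho n r 1 (gmat n zmat zmat 1 0)"
  fix u k assume u: "topword n r u" and k: "k < r"
  have len: "length u = r" using u by (auto simp: topword_def words_iff)
  have "mmul n r ?D M (lower n k u) b = (-1) ^ k * M u b" if k: "k < r" for k
  proof -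
    have "mmul n r ?D M (lower n k u) b = (\<Sum>p<r. if p = k then (-1) ^ k * M u b else 0)"
      unfolding mmul_shift[OF lower_words[OF u k]]
    proof (intro sum.cong refl)
      fix p assume "p \<in> {..<r}"
      then have p: "p < r" by simp
      have "odds n (lower n k u) k = k"
        using odds_topword[OF u, of k] k by (simp add: lower_def)
      then show "(if lower n k u ! p < n then (-1) ^ odds n (lower n k u) p *
            M ((lower n k u)[p := lower n k u ! p + n]) b else 0)
          = (if p = k then (-1) ^ k * M u b else 0)"
        using topword_letter[OF u p] len p by (cases "p = k") (auto simp: lower_def)
    qed
    then show ?thesis using k by simp
  qed
  from this[OF k] this[of 0] show "mmul n r ?D M (lower n k u) b = (-1) ^ k * mmul n r ?D M (lower n 0 u) b"
    using k by simp
next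
  let ?D = "rho n r 1 (gmat n zmat zmat 1 0)"
  fix a assume a: "a \<in> words n r" and nz: "mmul n r ?D M a b \<noteq> 0"
  show "r \<le> odds n a r + 1"
  proof (rule ccontr)
    assume small: "\<not> r \<le> odds n a r + 1"
    have len: "length a = r" using a by (simp add: words_iff)
    obtain k x where k: "k < r" "x < 2 * n" "gmat n zmat zmat 1 0 (a ! k) x \<noteq> 0" "M (a[k := x]) b \<noteq> 0"
      using mmul_rho_nonzero[OF a nz] .
    have "par n (a ! k) = 0" "par n x = 1"
      using k(3) by (auto simp: gmat_def zmat_def par_def split: if_splits)
    moreover have "odds n (a[k := x]) r + par n (a ! k) = odds n a r + par n x"
      using k a by (intro odds_update) (auto simp: words_iff)
    moreover have "r \<le> odds n (a[k := x]) r + 1" using k a by (intro submod_degree_ge[OF v]) auto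
    ultimately have o: "odds n a r + 2 = r" using small by simp
    define E where "E = {p. p < r \<and> a ! p < n}"
    have "card E = 2"
    proof -
      have "E = {..<r} - oddpos n r a" by (auto simp: E_def oddpos_def par_def)
      then have "card E = r - odds n a r"
        by (simp add: odds_oddpos card_Diff_subset oddpos_def subset_iff)
      then show ?thesis using o by simp
    qed
    then obtain i j where "E = {i, j}" "i \<noteq> j" by (auto simp: card_2_iff)
    then obtain p q where pq: "E = {p, q}" "p < q" by (metis insert_commute linorder_neqE_nat)
    have "p \<in> E" "q \<in> E" using pq by auto
    then have P: "p < r" "a ! p < n" and Q: "q < r" "a ! q < n" by (auto simp: E_def)
    define u where "u = a[p := a ! p + n, q := a ! q + n]"
    have u: "topword n r u"
    proof -
      have "n \<le> u ! i" if "i < r" for i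
      proof (cases "i = p \<or> i = q")
        case True
        then show ?thesis using len P Q pq(2) by (auto simp: u_def nth_list_update)
      next
        case False
        then have "i \<notin> E" using pq(1) by simp
        then show ?thesis using False that by (simp add: u_def E_def)
      qed
      moreover have "u \<in> words n r" using a P Q by (simp add: u_def)
      ultimately show ?thesis by (simp add: topword_def)
    qed
    have ap: "a[p := a ! p + n] = lower n q u" and aq: "a[q := a ! q + n] = lower n p u"
      using pq(2) P Q len by (auto simp: u_def lower_def list_update_swap)
    have au: "a = u[p := a ! p, q := a ! q]"
      using pq(2) by (simp add: u_def list_update_swap[of p q])
    \<comment> \<open>The even letter at \<open>p\<close> makes the count at \<open>q\<close> one
      smaller than the position; this is the relative sign behind the cancellation.\<close>
    have op: "odds n a p = p" "odds n a q + 1 = q"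
    proof -
      have "odds n a p = odds n u p" using pq(2) by (simp add: u_def)
      then show "odds n a p = p" using odds_topword[OF u, of p] P by simp
      have "odds n u q = odds n (a[p := a ! p + n]) q" by (simp add: u_def)
      then have "odds n (a[p := a ! p + n]) q = q" using odds_topword[OF u, of q] Q by simp
      moreover have "odds n (a[p := a ! p + n]) q + par n (a ! p) = odds n a q + par n (a ! p + n)"
        using pq(2) P len by (intro odds_update) auto
      ultimately show "odds n a q + 1 = q" using P by (simp add: par_def)
    qed
    have "mmul n r ?D M a b = (\<Sum>i\<in>{..<r}. if i \<in> E then (-1) ^ odds n a i * M (a[i := a ! i + n]) b else 0)"
      unfolding mmul_shift[OF a] by (intro sum.cong) (auto simp: E_def)
    also have "\<dots> = (\<Sum>i\<in>E. (-1) ^ odds n a i * M (a[i := a ! i + n]) b)"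
    proof -
      have "{..<r} \<inter> E = E" by (auto simp: E_def)
      then show ?thesis by (simp only: finite_lessThan flip: sum.inter_restrict)
    qed
    also have "\<dots> = (-1) ^ odds n a p * M (lower n q u) b + (-1) ^ odds n a q * M (lower n p u) b"
      using pq ap aq by simp
    also have "M (lower n q u) b = (-1) ^ q * M (lower n 0 u) b"
      by (rule submod_lower[OF v u Q(1)])
    also have "M (lower n p u) b = (-1) ^ p * M (lower n 0 u) b"
      by (rule submod_lower[OF v u P(1)])
    also have "(-1) ^ odds n a p * ((-1) ^ q * M (lower n 0 u) b)
        + (-1) ^ odds n a q * ((-1) ^ p * M (lower n 0 u) b) = 0"
    proof -
      have "(-1::complex) ^ q = (-1) ^ (odds n a q + 1)" by (simp only: op(2))
      then have "(-1::complex) ^ q = - ((-1) ^ odds n a q)" by simp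
      then show ?thesis unfolding op(1) by simp
    qed
    finally show False using nz by simp
  qed
qed

lemma submod_gact:
  assumes "x \<in> gact n r" "submod n r (\<lambda>a. M a b)"
  shows "submod n r (\<lambda>a. mmul n r x M a b)"
proof -
  obtain A C c d where x: "x = rhoG n r A C c d" using assms(1) by (auto simp: gact_def)
  have 1: "gmat n A zmat 0 d = (\<lambda>x y. gmat n A zmat 0 0 x y + gmat n zmat zmat 0 d x y)"
    by (intro ext) (auto simp: gmat_def zmat_def)
  have 2: "gmat n zmat C c 0 = (\<lambda>x y. gmat n zmat C 0 0 x y + c * gmat n zmat zmat 1 0 x y)"
    by (intro ext) (auto simp: gmat_def zmat_def)
  have "x = (rho n r 0 (gmat n A zmat 0 0) + rho n r 0 (gmat n zmat zmat 0 d))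
      + (rho n r 1 (gmat n zmat C 0 0) + (\<lambda>a b. c * rho n r 1 (gmat n zmat zmat 1 0) a b))"
    unfolding x rhoG_def rho_prho 1 2 prho_add prho_scale by (intro ext) simp
  then have "mmul n r x M a b = (mmul n r (rho n r 0 (gmat n A zmat 0 0)) M a b
      + mmul n r (rho n r 0 (gmat n zmat zmat 0 d)) M a b)
      + (mmul n r (rho n r 1 (gmat n zmat C 0 0)) M a b
      + c * mmul n r (rho n r 1 (gmat n zmat zmat 1 0)) M a b)" for a
    by (simp add: mmul_add_left) (simp add: mmul_def sum_distrib_left mult.assoc)
  then show ?thesis
    using assms(2) by (simp only: submod_add submod_scale submod_even submod_degree submod_odd submod_shift)
qed

text \<open>Column \<open>b\<close> of a product is the product applied to the basis vector of
  \<open>b\<close>, which lies in the submodule because its degree is \<open>r\<close>.\<close>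

lemma submod_gmonos:
  assumes "M \<in> gmonos n r" "topword n r b"
  shows "submod n r (\<lambda>a. M a b)"
proof -
  obtain xs where xs: "M = foldr (mmul n r) xs (ident n r)" "set xs \<subseteq> gact n r"
    using assms(1) by (auto simp: gmonos_def)
  from xs(2) have "submod n r (\<lambda>a. foldr (mmul n r) xs (ident n r) a b)"
  proof (induction xs)
    case Nil
    have z: "ident n r (lower n k u) b = 0" if "topword n r u" "k < r" for u k
      using odds_lower[OF that] odds_topword[OF assms(2) order_refl] by (auto simp: ident_def)
    show ?case
    proof (rule submodI)
      show "r \<le> odds n a r + 1" if "foldr (mmul n r) [] (ident n r) a b \<noteq> 0" for a
        using that odds_topword[OF assms(2) order_refl] by (auto simp: ident_def split: if_splits)
      show "foldr (mmul n r) [] (ident n r) (lower n k u) b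
          = (-1) ^ k * foldr (mmul n r) [] (ident n r) (lower n 0 u) b" if "topword n r u" "k < r" for u k
        using z[OF that] z[OF that(1), of 0] that(2) by simp
    qed
  next
    case (Cons x xs)
    then show ?case by (simp add: submod_gact)
  qed
  then show ?thesis by (simp add: xs)
qed

lemma submod_UImg:
  assumes "M \<in> UImg n r" "topword n r b"
  shows "submod n r (\<lambda>a. M a b)"
proof -
  obtain k c P where M: "\<forall>i<(k::nat). P i \<in> gmonos n r" "M = (\<lambda>x y. \<Sum>i<k. c i * P i x y)"
    using assms(1) by (auto simp: UImg_def)
  show ?thesis unfolding M(2)
    by (intro submod_sum submod_scale submod_gmonos assms(2)) (use M(1) in auto)
qed

text \<open>The witness \<open>X\<close> is a matrix unit in the upper right block of gl(n|n), so it
  commutes with permutations. It lowers the letter \<open>n\<close> and no other, whereas in the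
  submodule all lowerings of a top word have the same coefficient up to sign.\<close>

lemma EndS_not_UImg:
  assumes n: "2 \<le> n" and r: "1 < r"
  shows "\<not> EndS n r \<subseteq> UImg n r"
proof
  assume sub: "EndS n r \<subseteq> UImg n r"
  define X :: "nat \<Rightarrow> nat \<Rightarrow> complex" where "X = (\<lambda>x y. if x = 0 \<and> y = n then 1 else 0)"
  \<comment> \<open>The letter \<open>n\<close> occurs once, at position \<open>0\<close>. The bound
    on \<open>n\<close> makes \<open>n + 1\<close> a valid odd letter, and \<open>1 < r\<close>
    provides position \<open>1\<close> for the comparison.\<close>
  define b where "b = map (\<lambda>k. if k = 0 then n else n + 1) [0..<r]"
  have X: "homog n 1 (\<lambda>_. X)" unfolding homog_1 using n by (auto simp: X_def par_def)
  have "mmul n r (rho n r 1 X) (permact n r \<sigma>) = mmul n r (permact n r \<sigma>) (rho n r 1 X)"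
    if "\<sigma> permutes {..<r}" for \<sigma>
    unfolding rho_prho using permact_prho[OF that X] by simp
  then have "rho n r 1 X \<in> EndS n r" using supported_rho by (simp add: EndS_def)
  then have "rho n r 1 X \<in> UImg n r" using sub by blast
  moreover have b: "topword n r b" using n by (auto simp: topword_def words_iff b_def)
  ultimately have "submod n r (\<lambda>a. rho n r 1 X a b)" by (rule submod_UImg)
  then have eq: "rho n r 1 X (lower n 1 b) b = - rho n r 1 X (lower n 0 b) b"
    using submod_lower[OF _ b r, of "\<lambda>a. rho n r 1 X a b"] by simp
  have bn: "b ! k = (if k = 0 then n else n + 1)" if "k < r" for k
    using that by (simp add: b_def)
  have lb: "length b = r" by (simp add: b_def)
  have "rho n r 1 X (lower n 0 b) b = (\<Sum>k<r. if k = 0 then 1 else 0)"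
    using lower_words[OF b, of 0] topword_words[OF b] r n lb unfolding rho_def
    by (auto simp: bn X_def lower_def intro!: sum.cong)
  then have one: "rho n r 1 X (lower n 0 b) b = 1" using r by simp
  have "(\<Sum>k<r. if \<forall>l<r. l \<noteq> k \<longrightarrow> lower n 1 b ! l = b ! l
      then (-1) ^ (1 * odds n b k) * X (lower n 1 b ! k) (b ! k) else 0) = 0"
  proof (intro sum.neutral ballI)
    fix k assume "k \<in> {..<r}"
    then have k: "k < r" by simp
    show "(if \<forall>l<r. l \<noteq> k \<longrightarrow> lower n 1 b ! l = b ! l
        then (-1) ^ (1 * odds n b k) * X (lower n 1 b ! k) (b ! k) else 0) = 0"
    proof (cases "k = 0")
      case True
      have "lower n 1 b ! 1 \<noteq> b ! 1" using r n lb by (simp add: lower_def bn)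
      then have "\<not> (\<forall>l<r. l \<noteq> k \<longrightarrow> lower n 1 b ! l = b ! l)" using r True by auto
      then show ?thesis by (simp only: if_False)
    next
      case False
      then show ?thesis using k by (simp add: X_def bn)
    qed
  qed
  then have "rho n r 1 X (lower n 1 b) b = 0" unfolding rho_def by (simp only: if_cancel)
  then show False using eq one by simp
qed

section \<open>The theorem\<close>

theorem theorem3p16:
  fixes n :: nat
  assumes "n \<ge> 2"
  shows "(\<forall>r. (r < n \<or> (r = n \<and> n \<ge> 3)) \<longrightarrow> bij_betw (phi n r) (CS r) (Endg n r))
       \<and> (n = 2 \<longrightarrow> \<not> (Endg n n \<subseteq> phi n n ` CS n))
       \<and> (\<forall>r. r > 2 * n - 2 \<longrightarrow> \<not> (Endg n r \<subseteq> phi n r ` CS r))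
       \<and> (\<forall>r. r > 1 \<longrightarrow> \<not> (EndS n r \<subseteq> UImg n r))"
proof (intro conjI allI impI)
  fix r assume "r < n \<or> r = n \<and> n \<ge> 3"
  then show "bij_betw (phi n r) (CS r) (Endg n r)" by (intro phi_bij) auto
next
  assume "n = 2"
  then show "\<not> Endg n n \<subseteq> phi n n ` CS n" using not_surjective_22 by simp
next
  fix r assume "r > 2 * n - 2"
  then interpret odd_map n r "2 * n - 1"
    using assms by unfold_locales auto
  show "\<not> Endg n r \<subseteq> phi n r ` CS r" by (rule not_surjective)
next
  fix r :: nat assume "r > 1"
  then show "\<not> EndS n r \<subseteq> UImg n r" by (rule EndS_not_UImg[OF assms])
qed

end
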